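(* Let $n\ge 1$ and let $f\in L^2(\mathbb{H}^n)$. Let $u(\mathbf z,t;s)=e^{-is\mathscr L}f(\mathbf z,t)$, $(\mathbf z,t)\in\mathbb{H}^n$, $s\in\mathbb{R}$, be the solution of the Schrödinger equation $i\partial_s u-\mathscr L u=0$ with $u(\mathbf z,t;0)=f(\mathbf z,t)$. Suppose that there are constants $C>0$, $a>0$, $b>0$ and a fixed $s_0\in\mathbb{R}\setminus\{0\}$ such that $$|f(\mathbf z,t)|\le C\,q_a(\mathbf z,t)\quad\text{and}\quad |u(\mathbf z,t;s_0)|\le C\,q_b(\mathbf z,t)\qquad\text{for all }(\mathbf z,t)\in\mathbb{H}^n .$$ If $ab<s_0^2$, then $u(\mathbf z,t;s)=0$ for all $(\mathbf z,t)\in\mathbb{H}^n$ and all $s\in\mathbb{R}$.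
   Context: The Heisenberg group $\mathbb{H}^n$ is $\mathbb{C}^n\times\mathbb{R}$ with group law $(\mathbf z,t)(\mathbf w,s)=(\mathbf z+\mathbf w,\,t+s+\tfrac12\operatorname{Im}(\mathbf z\cdot\bar{\mathbf w}))$ and Haar measure $d\mathbf z\,dt$. Writing $z_j=x_j+iy_j$, let $X_j=\partial_{x_j}+\tfrac12 y_j\partial_t$, $Y_j=\partial_{y_j}-\tfrac12 x_j\partial_t$, and let $\mathscr L=-\sum_{j=1}^n(X_j^2+Y_j^2)$ be the sub-Laplacian; its closure on $C_c^\infty(\mathbb{H}^n)$ is self-adjoint and nonnegative on $L^2(\mathbb{H}^n)$, so $e^{-is\mathscr L}$ is a unitary group. For $s>0$, $q_s$ is the heat kernel of $\mathscr L$ (the kernel of $e^{-s\mathscr L}$, i.e. $e^{-s\mathscr L}f=f*q_s$ with group convolution); it is nonnegative and is characterized by $\int_{\mathbb{R}}e^{i\lambda t}q_s(\mathbf z,t)\,dt=(4\pi)^{-n}\big(\tfrac{\lambda}{\sinh\lambda s}\big)^n e^{-\frac14\lambda(\coth s\lambda)|\mathbf z|^2}$. *)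

theory Defs
  imports "HOL-Analysis.Analysis"
begin

text \<open>Points of the Heisenberg group H^n = C^n x R; the dimension n is CARD('n).
  Haar measure dz dt is Lebesgue measure lborel on this euclidean space.\<close>
type_synonym 'n hpoint = "(complex ^ 'n) \<times> real"

text \<open>Left-invariant vector fields X_j, Y_j (as vector fields on C^n x R), z_j = x_j + i y_j:
  X_j = d/dx_j + (1/2) y_j d/dt,  Y_j = d/dy_j - (1/2) x_j d/dt.\<close>
definition fieldX :: "'n::finite \<Rightarrow> 'n hpoint \<Rightarrow> 'n hpoint" where
  "fieldX j p = (axis j 1, Im (fst p $ j) / 2)"

definition fieldY :: "'n::finite \<Rightarrow> 'n hpoint \<Rightarrow> 'n hpoint" where
  "fieldY j p = (axis j \<i>, - Re (fst p $ j) / 2)"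

definition along :: "('n::finite hpoint \<Rightarrow> 'n hpoint) \<Rightarrow> ('n hpoint \<Rightarrow> complex) \<Rightarrow> 'n hpoint \<Rightarrow> complex" where
  "along V \<phi> p = vector_derivative (\<lambda>h::real. \<phi> (p + h *\<^sub>R V p)) (at 0)"

definition sublaplacian :: "('n::finite hpoint \<Rightarrow> complex) \<Rightarrow> 'n hpoint \<Rightarrow> complex" where
  "sublaplacian \<phi> p = - (\<Sum>j\<in>UNIV. along (fieldX j) (along (fieldX j) \<phi>) p
                                   + along (fieldY j) (along (fieldY j) \<phi>) p)"

coinductive smooth_fun :: "('a::euclidean_space \<Rightarrow> complex) \<Rightarrow> bool" where
  "(\<forall>p. \<phi> differentiable (at p)) \<Longrightarrow> (\<forall>v. smooth_fun (\<lambda>p. frechet_derivative \<phi> (at p) v))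
     \<Longrightarrow> smooth_fun \<phi>"

definition test_fun :: "('a::euclidean_space \<Rightarrow> complex) \<Rightarrow> bool" where
  "test_fun \<phi> \<longleftrightarrow> smooth_fun \<phi> \<and> compact (closure {p. \<phi> p \<noteq> 0})"

definition sq_int :: "('a::euclidean_space \<Rightarrow> complex) \<Rightarrow> bool" where
  "sq_int g \<longleftrightarrow> g \<in> borel_measurable lborel \<and> integrable lborel (\<lambda>x. (cmod (g x))\<^sup>2)"

definition L2norm :: "('a::euclidean_space \<Rightarrow> complex) \<Rightarrow> real" where
  "L2norm g = sqrt (\<integral>x. (cmod (g x))\<^sup>2 \<partial>lborel)"

text \<open>U is the unitary group e^{-isL}, L the self-adjoint closure of the sub-Laplacian on
  C_c^infinity.  By Stone's theorem U is a strongly continuous unitary group U(s) = e^{-isH}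
  with H self-adjoint; requiring that the generator -iH extends -iL on C_c^infinity forces
  H = closure of L, since L is essentially self-adjoint on C_c^infinity.  Operators act on
  representatives; everything is modulo a.e. equality.\<close>
definition schroedinger_group :: "(real \<Rightarrow> ('n::finite hpoint \<Rightarrow> complex) \<Rightarrow> ('n hpoint \<Rightarrow> complex)) \<Rightarrow> bool" where
  "schroedinger_group U \<longleftrightarrow>
     (\<forall>s g. sq_int g \<longrightarrow> sq_int (U s g) \<and> L2norm (U s g) = L2norm g) \<and>
     (\<forall>s g g'. sq_int g \<longrightarrow> sq_int g' \<longrightarrow> (AE x in lborel. g x = g' x) \<longrightarrow>
         (AE x in lborel. U s g x = U s g' x)) \<and>
     (\<forall>s c g g'. sq_int g \<longrightarrow> sq_int g' \<longrightarrow>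
         (AE x in lborel. U s (\<lambda>y. c * g y + g' y) x = c * U s g x + U s g' x)) \<and>
     (\<forall>g. sq_int g \<longrightarrow> (AE x in lborel. U 0 g x = g x)) \<and>
     (\<forall>s r g. sq_int g \<longrightarrow> (AE x in lborel. U (s + r) g x = U s (U r g) x)) \<and>
     (\<forall>g s0. sq_int g \<longrightarrow> ((\<lambda>s. L2norm (\<lambda>x. U s g x - U s0 g x)) \<longlongrightarrow> 0) (at s0)) \<and>
     (\<forall>\<phi>. test_fun \<phi> \<longrightarrow>
        ((\<lambda>h. L2norm (\<lambda>x. (U h \<phi> x - \<phi> x) / of_real h + \<i> * sublaplacian \<phi> x)) \<longlongrightarrow> 0) (at 0))"

text \<open>Heat kernel q_s of L, given by Fourier inversion in t of
  (4 pi)^{-n} (lambda / sinh (lambda s))^n exp(-(1/4) lambda coth(s lambda) |z|^2).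
  (It is real-valued; the integrand at lambda = 0 is irrelevant, a null set.)\<close>
definition heat_kernel :: "real \<Rightarrow> 'n::finite hpoint \<Rightarrow> complex" where
  "heat_kernel s p = (let z = fst p; t = snd p; n = CARD('n) in
     (1 / (2 * pi)) * (\<integral>l. exp (- \<i> * of_real (l * t)) *
        of_real ((4 * pi) powr (- real n) * (l / sinh (l * s)) ^ n *
                 exp (- (1/4) * l * (cosh (s * l) / sinh (s * l)) * (norm z)\<^sup>2)) \<partial>lborel))"

end

theory Submission
  imports Defs "HOL-Complex_Analysis.Complex_Analysis" "HOL-Probability.Probability"
begin

text \<open>Fix a small \<open>\<lambda> > 0\<close>. Pairing with \<open>e\<^sup>i\<^sup>\<lambda>\<^sup>t\<close> times a coherent state of the scaled twisted Laplacian,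
  suitably cut off, turns the evolution into an exact identity: up to a quadratic exponential, the
  Fock (Bargmann) transform of \<open>u(s\<^sub>0)\<close> is a rotation by the angle \<open>\<lambda>s\<^sub>0\<close> of that of \<open>f\<close>. Along a complex line
  the transform of \<open>f\<close> is an entire function of order two for which the two heat kernel bounds give two
  Gaussian bounds. If \<open>ab < s\<^sub>0\<^sup>2\<close>, then for small \<open>\<lambda>\<close> their exponents along two perpendicular rays have negative
  sum, and the Phragmen-Lindelof principle makes the transform vanish. Hence the partial Fourier
  transform of \<open>f\<close> in \<open>t\<close> vanishes for all small \<open>\<lambda> > 0\<close>; as the heat kernel decays exponentially in \<open>t\<close>, it is
  analytic in \<open>\<lambda>\<close>, so \<open>f = 0\<close>.\<close>

section \<open>Gaussians and uniqueness of the Fourier transform\<close>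

text \<open>The group \<open>U\<close> is known only through its derivative at 0 on test functions.
  The given \<open>f\<close> need not lie in the domain of the generator, and a state carrying a
  character in \<open>t\<close> is not square integrable. So every time derivative falls on a
  compactly supported cutoff of an explicit solution, and the radius of the cutoff goes to infinity
  only after the identity has been integrated in time.

  The kernel bounds enter twice. Integrated over \<open>t\<close>, the heat kernel becomes a
  Gaussian in \<open>z\<close> with exponent \<open>|z|^2 / (4 a)\<close>; the growth of the
  transform follows from this. Its exponential decay in \<open>t\<close>, uniform in
  \<open>z\<close>, serves the return from the transform to \<open>f\<close>. Both facts come from
  continuing its symbol in \<lambda> to a complex strip.

  The quadratic exponential accompanying the rotation has the coefficient
  \<open>(1 - exp (2 \<i> l s)) / (2 l)\<close>, which tends to \<open>- \<i> s\<close> as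
  \<open>l\<close> tends to 0. In the limit the sum of the two exponents is the real form
  \<open>a u^2 - 2 s u v + b v^2\<close> at \<open>w = u + \<i> v\<close>, and this takes negative
  values exactly when \<open>a b < s^2\<close>. The strict inequality therefore leaves an interval
  of usable frequencies.\<close>

lemma Fubini_bounded_kernel:
  fixes g :: "'a::euclidean_space \<Rightarrow> complex" and h :: "'b::euclidean_space \<Rightarrow> complex"
    and k :: "'a \<Rightarrow> 'b \<Rightarrow> complex"
  assumes g: "integrable lborel g" and h: "integrable lborel h"
    and k: "(\<lambda>p. k (fst p) (snd p)) \<in> borel_measurable (lborel \<Otimes>\<^sub>M lborel)"
    and B: "\<And>x y. cmod (k x y) \<le> B"
  shows "(\<integral>y. (\<integral>x. g x * h y * k x y \<partial>lborel) \<partial>lborel) = (\<integral>x. (\<integral>y. g x * h y * k x y \<partial>lborel) \<partial>lborel)"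
proof -
  note [measurable] = k borel_measurable_integrable[OF g] borel_measurable_integrable[OF h]
  have "integrable (lborel \<Otimes>\<^sub>M lborel) (\<lambda>p. g (fst p) * h (snd p))"
    by (rule lborel_pair.Fubini_integrable) (use g h in \<open>auto simp: norm_mult\<close>)
  then have "integrable (lborel \<Otimes>\<^sub>M lborel) (\<lambda>p. (g (fst p) * h (snd p)) * of_real B)"
    by simp
  then have "integrable (lborel \<Otimes>\<^sub>M lborel) (\<lambda>p. g (fst p) * h (snd p) * k (fst p) (snd p))"
  proof (rule Bochner_Integration.integrable_bound)
    show "AE x in lborel \<Otimes>\<^sub>M lborel. norm (g (fst x) * h (snd x) * k (fst x) (snd x))
      \<le> norm (g (fst x) * h (snd x) * of_real B)"
    proof (rule AE_I2)
      fix x :: "'a \<times> 'b"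
      have "cmod (k (fst x) (snd x)) \<le> \<bar>B\<bar>"
        using B[of "fst x" "snd x"] by linarith
      then show "norm (g (fst x) * h (snd x) * k (fst x) (snd x)) \<le> norm (g (fst x) * h (snd x) * of_real B)"
        by (simp add: norm_mult mult_left_mono)
    qed
  qed measurable
  then have "integrable (lborel \<Otimes>\<^sub>M lborel) (case_prod (\<lambda>x y. g x * h y * k x y))"
    by (simp add: case_prod_beta')
  from lborel_pair.Fubini_integral[OF this] show ?thesis .
qed

text \<open>\<open>lborel\<close> on a euclidean space is the image of a product of copies of real
  Lebesgue measure, so a product of functions of single coordinates integrates factor by
  factor.\<close>

lemma has_bochner_integral_lborel_prod:
  fixes f :: "'a::euclidean_space \<Rightarrow> real \<Rightarrow> complex"
  assumes f: "\<And>b. b \<in> Basis \<Longrightarrow> has_bochner_integral lborel (f b) (I b)"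
  shows "has_bochner_integral lborel (\<lambda>x::'a. \<Prod>b\<in>Basis. f b (x \<bullet> b)) (\<Prod>b\<in>Basis. I b)"
proof -
  interpret product_sigma_finite "\<lambda>b::'a. lborel :: real measure" ..
  have int: "integrable lborel (f b)" if "b \<in> Basis" for b
    using f[OF that] by (simp add: has_bochner_integral_iff)
  have [measurable]: "(\<lambda>x::'a. \<Prod>b\<in>Basis. f b (x \<bullet> b)) \<in> borel_measurable borel"
  proof (rule borel_measurable_prod)
    fix b :: 'a assume "b \<in> Basis"
    then have [measurable]: "f b \<in> borel_measurable lborel" using int by auto
    show "(\<lambda>x. f b (x \<bullet> b)) \<in> borel_measurable borel" by measurable
  qed
  have *: "(\<lambda>x. \<Prod>b\<in>Basis. f b ((\<Sum>c\<in>Basis. x c *\<^sub>R c) \<bullet> b)) = (\<lambda>x. \<Prod>b\<in>Basis. f b (x b))"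
    by (auto intro!: prod.cong ext simp: inner_sum_left inner_Basis if_distrib sum.delta cong: if_cong)
  have m: "(\<lambda>x. \<Sum>b\<in>Basis. x b *\<^sub>R b) \<in> measurable (\<Pi>\<^sub>M b\<in>(Basis::'a set). lborel) borel" by measurable
  show ?thesis
    unfolding has_bochner_integral_iff
  proof
    show "integrable lborel (\<lambda>x::'a. \<Prod>b\<in>Basis. f b (x \<bullet> b))"
      by (subst lborel_eq, subst integrable_distr_eq[OF m]) (auto simp: * intro!: product_integrable_prod int)
    show "integral\<^sup>L lborel (\<lambda>x::'a. \<Prod>b\<in>Basis. f b (x \<bullet> b)) = (\<Prod>b\<in>Basis. I b)"
      by (subst lborel_eq, subst integral_distr[OF m])
        (use f in \<open>auto simp: * product_integral_prod int has_bochner_integral_iff intro!: prod.cong\<close>)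
  qed
qed

text \<open>This is the characteristic function of the standard normal distribution with the
  normalising factor of the density undone.\<close>

lemma fourier_gaussian_real:
  "has_bochner_integral lborel (\<lambda>x::real. exp (\<i> * of_real (x * t)) * of_real (exp (- x\<^sup>2 / 2)))
     (of_real (sqrt (2 * pi) * exp (- t\<^sup>2 / 2)))"
proof -
  have i: "integrable lborel (\<lambda>x::real. exp (- x\<^sup>2 / 2))"
  proof -
    have "integrable lborel (\<lambda>x. sqrt (2 * pi) * std_normal_density x)"
      by (intro integrable_mult_right) (auto intro: integrable_normal_density)
    then show ?thesis by (simp add: std_normal_density_def)
  qed
  have "complex_of_real (exp (- t\<^sup>2 / 2)) = (\<integral>x. iexp (t * x) \<partial>std_normal_distribution)"
    using fun_cong[OF char_std_normal_distribution, of t] by (simp add: char_def)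
  also have "\<dots> = (\<integral>x. std_normal_density x *\<^sub>R iexp (t * x) \<partial>lborel)"
    by (subst integral_density) auto
  also have "\<dots> = (\<integral>x. of_real (1 / sqrt (2 * pi)) * (exp (\<i> * of_real (x * t)) * of_real (exp (- x\<^sup>2 / 2))) \<partial>lborel)"
    by (rule Bochner_Integration.integral_cong) (auto simp: std_normal_density_def scaleR_conv_of_real ac_simps)
  also have "\<dots> = of_real (1 / sqrt (2 * pi)) * (\<integral>x. exp (\<i> * of_real (x * t)) * of_real (exp (- x\<^sup>2 / 2)) \<partial>lborel)"
    by (rule integral_mult_right_zero)
  finally have e: "(\<integral>x. exp (\<i> * of_real (x * t)) * of_real (exp (- x\<^sup>2 / 2)) \<partial>lborel) = of_real (sqrt (2 * pi) * exp (- t\<^sup>2 / 2))"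
    by (simp add: field_simps)
  have "integrable lborel (\<lambda>x::real. exp (\<i> * of_real (x * t)) * of_real (exp (- x\<^sup>2 / 2)))"
    by (rule Bochner_Integration.integrable_bound[OF i]) (auto simp: norm_mult)
  with e show ?thesis by (simp add: has_bochner_integral_iff)
qed

lemma norm_power2_euclidean: "(norm (x::'a::euclidean_space))\<^sup>2 = (\<Sum>b\<in>Basis. (x \<bullet> b)\<^sup>2)"
  unfolding power2_norm_eq_inner by (subst euclidean_inner) (simp add: power2_eq_square)

lemma fourier_gaussian:
  fixes t :: "'a::euclidean_space"
  shows "has_bochner_integral lborel (\<lambda>x::'a. exp (\<i> * of_real (x \<bullet> t)) * of_real (exp (- (norm x)\<^sup>2 / 2)))
     (of_real (sqrt (2 * pi) ^ DIM('a) * exp (- (norm t)\<^sup>2 / 2)))"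
proof -
  have 1: "exp (\<i> * of_real (x \<bullet> t)) * of_real (exp (- (norm x)\<^sup>2 / 2))
     = (\<Prod>b\<in>Basis. exp (\<i> * of_real ((x \<bullet> b) * (t \<bullet> b))) * of_real (exp (- (x \<bullet> b)\<^sup>2 / 2)))" for x :: 'a
  proof -
    have "x \<bullet> t = (\<Sum>b\<in>Basis. (x \<bullet> b) * (t \<bullet> b))" by (rule euclidean_inner)
    then show ?thesis
      by (simp add: prod.distrib exp_sum[symmetric] sum_distrib_left[symmetric] norm_power2_euclidean
          sum_negf sum_divide_distrib flip: of_real_prod)
  qed
  have 2: "of_real (sqrt (2 * pi) ^ DIM('a) * exp (- (norm t)\<^sup>2 / 2))
     = (\<Prod>b\<in>(Basis::'a set). complex_of_real (sqrt (2 * pi) * exp (- (t \<bullet> b)\<^sup>2 / 2)))"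
    by (simp add: prod.distrib exp_sum[symmetric] norm_power2_euclidean
          sum_negf sum_divide_distrib flip: of_real_prod)
  show ?thesis
    unfolding 1 2
    by (rule has_bochner_integral_lborel_prod) (rule fourier_gaussian_real)
qed

lemma integrable_affine_euclidean:
  fixes f :: "'a::euclidean_space \<Rightarrow> 'b::{banach, second_countable_topology}"
  assumes c: "c \<noteq> 0" and f: "integrable lborel f"
  shows "integrable lborel (\<lambda>x. f (t + c *\<^sub>R x))"
proof -
  have m: "(\<lambda>x::'a. t + c *\<^sub>R x) \<in> measurable lborel borel" by measurable
  have [measurable]: "f \<in> borel_measurable borel" using borel_measurable_integrable[OF f] by simp
  have "integrable (density (distr lborel borel (\<lambda>x. t + c *\<^sub>R x)) (\<lambda>_. ennreal (\<bar>c\<bar> ^ DIM('a)))) f"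
    using f by (subst (asm) lborel_affine[OF c, of t]) (simp add: ennreal_power)
  then have "integrable lborel (\<lambda>x. (\<bar>c\<bar> ^ DIM('a)) *\<^sub>R f (t + c *\<^sub>R x))"
    by (subst (asm) integrable_density) (auto simp: integrable_distr_eq[OF m])
  then have "integrable lborel (\<lambda>x. inverse (\<bar>c\<bar> ^ DIM('a)) *\<^sub>R ((\<bar>c\<bar> ^ DIM('a)) *\<^sub>R f (t + c *\<^sub>R x)))"
    by (rule integrable_scaleR_right)
  then show ?thesis using c by simp
qed

lemma integral_affine_euclidean:
  fixes f :: "'a::euclidean_space \<Rightarrow> 'b::{banach, second_countable_topology}"
  assumes c: "c \<noteq> 0" and [measurable]: "f \<in> borel_measurable borel"
  shows "(\<integral>x. f x \<partial>lborel) = (\<bar>c\<bar> ^ DIM('a)) *\<^sub>R (\<integral>x. f (t + c *\<^sub>R x) \<partial>lborel)"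
proof -
  have m: "(\<lambda>x::'a. t + c *\<^sub>R x) \<in> measurable lborel borel" by measurable
  have "(\<integral>x. f x \<partial>lborel) = (\<integral>x. f x \<partial>density (distr lborel borel (\<lambda>x. t + c *\<^sub>R x)) (\<lambda>_. ennreal (\<bar>c\<bar> ^ DIM('a))))"
    by (subst lborel_affine[OF c, of t]) (simp add: ennreal_power)
  also have "\<dots> = (\<integral>x. (\<bar>c\<bar> ^ DIM('a)) *\<^sub>R f (t + c *\<^sub>R x) \<partial>lborel)"
    by (subst integral_density) (auto simp: integral_distr[OF m])
  finally show ?thesis by simp
qed

lemma integrable_gaussian:
  assumes k: "k > 0"
  shows "integrable lborel (\<lambda>x::'a::euclidean_space. exp (- k * (norm x)\<^sup>2))"
proof -
  have "integrable lborel (\<lambda>x::'a. exp (- (norm x)\<^sup>2 / 2))"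
    using fourier_gaussian[of "0::'a"] integrable_norm[of lborel "\<lambda>x::'a. complex_of_real (exp (- (norm x)\<^sup>2 / 2))"]
    by (simp add: has_bochner_integral_iff)
  from integrable_affine_euclidean[OF _ this, of "sqrt (2 * k)" 0] k show ?thesis
    by (simp add: power_mult_distrib)
qed

section \<open>From integrals over boxes to uniqueness of the Fourier transform\<close>

lemma box_continuous_approx:
  fixes l u :: "'a::euclidean_space"
  obtains h :: "nat \<Rightarrow> 'a \<Rightarrow> real" where
    "\<And>n. continuous_on UNIV (h n)" "\<And>n x. \<bar>h n x\<bar> \<le> indicator (box l u) x"
    "\<And>x. (\<lambda>n. h n x) \<longlonglongrightarrow> indicator (box l u) x"
proof
  let ?S = "- box l u"
  \<comment> \<open>The distance to the empty set is 0 by convention, so the complement of the box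
    has to be nonempty for the distance to detect it.\<close>
  have ne: "?S \<noteq> {}"
    using bounded_box[of l u] not_bounded_UNIV[where 'a='a] by (metis Compl_empty_eq double_complement)
  let ?h = "\<lambda>n x. min 1 (real n * infdist x ?S)"
  show "continuous_on UNIV (?h n)" for n by (intro continuous_intros)
  have 0: "infdist x ?S = 0" if "x \<notin> box l u" for x
    using that by (intro infdist_zero) auto
  show "\<bar>?h n x\<bar> \<le> indicator (box l u) x" for n x
  proof (cases "x \<in> box l u")
    case True
    have "0 \<le> real n * infdist x ?S" using infdist_nonneg[of x ?S] by simp
    then show ?thesis using True by (auto simp: abs_if)
  qed (simp add: 0)
  show "(\<lambda>n. ?h n x) \<longlonglongrightarrow> indicator (box l u) x" for x
  proof (cases "x \<in> box l u")
    case True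
    have "closed ?S" by (simp add: closed_def open_box)
    then have pos: "infdist x ?S > 0"
      using in_closed_iff_infdist_zero[OF _ ne] True infdist_nonneg[of x ?S] by (auto simp: less_le)
    obtain N :: nat where N: "real N * infdist x ?S > 1"
      using reals_Archimedean3[OF pos] by blast
    have "\<forall>\<^sub>F n in sequentially. ?h n x = 1"
      using eventually_ge_at_top[of N]
    proof eventually_elim
      case (elim n)
      have "real N * infdist x ?S \<le> real n * infdist x ?S" using elim pos by (intro mult_right_mono) auto
      then show ?case using N by simp
    qed
    then show ?thesis using True by (simp add: tendsto_eventually)
  next
    case False
    then show ?thesis using 0[OF False] by simp
  qed
qed

text \<open>Boxes are stable under intersection and generate the Borel sets, so Dynkin induction
  carries the vanishing of integrals to all Borel sets; the total integral enters at the step for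
  complements.\<close>

lemma AE_zero_if_box_integrals_zero:
  fixes g :: "'a::euclidean_space \<Rightarrow> complex"
  assumes g: "integrable lborel g" and U: "(\<integral>x. g x \<partial>lborel) = 0"
    and box: "\<And>l u. (\<integral>x. indicator (box l u) x *\<^sub>R g x \<partial>lborel) = 0"
  shows "AE x in lborel. g x = 0"
proof (rule sigma_finite_measure.density_zero[OF _ g])
  show "sigma_finite_measure (lborel :: 'a measure)" ..
  fix A :: "'a set" assume "A \<in> sets lborel"
  then have A: "A \<in> sigma_sets UNIV (range (\<lambda>(a, b). box a b))"
    by (simp add: borel_eq_box)
  have "Int_stable (range (\<lambda>(a, b). box a b :: 'a set))"
    by (auto simp: Int_stable_def box_Int_box)
  moreover have "range (\<lambda>(a, b). box a b :: 'a set) \<subseteq> Pow UNIV" by simp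
  ultimately have "integrable lborel (\<lambda>x. indicator A x *\<^sub>R g x) \<and> set_lebesgue_integral lborel A g = 0"
    unfolding set_lebesgue_integral_def using A
  proof (induction rule: sigma_sets_induct_disjoint)
    case (basic A)
    then show ?case using box g by (auto intro!: integrable_mult_indicator)
  next
    case empty
    then show ?case by simp
  next
    case (compl A)
    then have eq: "(\<lambda>x. indicator (UNIV - A) x *\<^sub>R g x) = (\<lambda>x. g x - indicator A x *\<^sub>R g x)"
      by (auto simp: indicator_def)
    show ?case unfolding eq using compl g U by simp
  next
    case (union A)
    have A: "A i \<in> sets lborel" for i using union(2) by (auto simp: borel_eq_box)
    have i: "set_integrable lborel (\<Union>i. A i) g"
      unfolding set_integrable_def using A g by (intro integrable_mult_indicator) auto
    have "set_lebesgue_integral lborel (\<Union>i. A i) g = (\<Sum>i. set_lebesgue_integral lborel (A i) g)"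
      using union(1) A i by (intro lebesgue_integral_countable_add) (auto simp: disjoint_family_on_def)
    then show ?case using union(3) i unfolding set_lebesgue_integral_def set_integrable_def by simp
  qed
  then show "set_lebesgue_integral lborel A g = 0" by simp
qed

text \<open>A Gaussian is a superposition of characters, so \<open>g\<close> integrates to 0 against
  every translated and dilated Gaussian, hence against Gaussian averages of a continuous
  \<open>h\<close>. Letting the width shrink gives \<open>h\<close> itself, and continuous functions
  approximate indicators of boxes.\<close>

theorem fourier_uniqueness:
  fixes g :: "'a::euclidean_space \<Rightarrow> complex"
  assumes g: "integrable lborel g"
    and F: "\<And>\<xi>. (\<integral>x. g x * exp (\<i> * of_real (x \<bullet> \<xi>)) \<partial>lborel) = 0"
  shows "AE x in lborel. g x = 0"
proof -
  note [measurable] = borel_measurable_integrable[OF g]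
  let ?G = "\<lambda>x::'a. exp (- (norm x)\<^sup>2 / 2)"
  have G: "integrable lborel ?G"
    using integrable_gaussian[of "1/2", where 'a='a] by simp
  have conv: "(\<integral>x. g x * of_real (?G ((x - y) /\<^sub>R e)) \<partial>lborel) = 0" for y and e :: real
  proof -
    let ?c = "complex_of_real (sqrt (2 * pi) ^ DIM('a))"
    have "(\<integral>x. g x * of_real (?G ((x - y) /\<^sub>R e)) \<partial>lborel)
       = (\<integral>x. g x * ((\<integral>\<eta>. exp (\<i> * of_real (\<eta> \<bullet> ((x - y) /\<^sub>R e))) * of_real (?G \<eta>) \<partial>lborel) / ?c) \<partial>lborel)"
    proof (intro Bochner_Integration.integral_cong refl)
      fix x
      have "(\<integral>\<eta>. exp (\<i> * of_real (\<eta> \<bullet> ((x - y) /\<^sub>R e))) * of_real (?G \<eta>) \<partial>lborel) = ?c * of_real (?G ((x - y) /\<^sub>R e))"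
        using fourier_gaussian[of "(x - y) /\<^sub>R e"] unfolding has_bochner_integral_iff of_real_mult by blast
      then show "g x * of_real (?G ((x - y) /\<^sub>R e))
        = g x * ((\<integral>\<eta>. exp (\<i> * of_real (\<eta> \<bullet> ((x - y) /\<^sub>R e))) * of_real (?G \<eta>) \<partial>lborel) / ?c)"
        by (simp only:) simp
    qed
    also have "\<dots> = (\<integral>x. (\<integral>\<eta>. g x * of_real (?G \<eta>) * exp (\<i> * of_real (\<eta> \<bullet> ((x - y) /\<^sub>R e))) \<partial>lborel) \<partial>lborel) / ?c"
      by (subst integral_divide_zero[symmetric], intro Bochner_Integration.integral_cong refl)
        (simp add: ac_simps flip: integral_mult_right_zero)
    also have "(\<integral>x. (\<integral>\<eta>. g x * of_real (?G \<eta>) * exp (\<i> * of_real (\<eta> \<bullet> ((x - y) /\<^sub>R e))) \<partial>lborel) \<partial>lborel)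
       = (\<integral>\<eta>. (\<integral>x. g x * of_real (?G \<eta>) * exp (\<i> * of_real (\<eta> \<bullet> ((x - y) /\<^sub>R e))) \<partial>lborel) \<partial>lborel)"
      by (rule Fubini_bounded_kernel[symmetric, OF g, where B=1]) (use G in auto)
    also have "\<dots> = (\<integral>\<eta>. 0 \<partial>(lborel :: 'a measure))"
    proof (rule Bochner_Integration.integral_cong)
      fix \<eta> :: 'a
      have "(\<integral>x. g x * of_real (?G \<eta>) * exp (\<i> * of_real (\<eta> \<bullet> ((x - y) /\<^sub>R e))) \<partial>lborel)
        = (\<integral>x. of_real (?G \<eta>) * exp (- \<i> * of_real (\<eta> \<bullet> y / e)) * (g x * exp (\<i> * of_real (x \<bullet> (\<eta> /\<^sub>R e)))) \<partial>lborel)"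
      proof (intro Bochner_Integration.integral_cong refl)
        fix x
        have "\<i> * of_real (\<eta> \<bullet> ((x - y) /\<^sub>R e)) = - \<i> * of_real (\<eta> \<bullet> y / e) + \<i> * of_real (x \<bullet> (\<eta> /\<^sub>R e))"
          by (simp add: inner_diff_right inner_commute[of \<eta>] algebra_simps divide_inverse)
        then show "g x * of_real (?G \<eta>) * exp (\<i> * of_real (\<eta> \<bullet> ((x - y) /\<^sub>R e)))
          = of_real (?G \<eta>) * exp (- \<i> * of_real (\<eta> \<bullet> y / e)) * (g x * exp (\<i> * of_real (x \<bullet> (\<eta> /\<^sub>R e))))"
          by (simp only: exp_add) (simp only: ac_simps)
      qed
      also have "\<dots> = 0" by (subst integral_mult_right_zero) (simp add: F del: inner_scaleR_right)
      finally show "(\<integral>x. g x * of_real (?G \<eta>) * exp (\<i> * of_real (\<eta> \<bullet> ((x - y) /\<^sub>R e))) \<partial>lborel) = 0" .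
    qed simp
    finally show ?thesis by simp
  qed
  have zero: "(\<integral>x. g x * of_real (h x) \<partial>lborel) = 0"
    if hc: "continuous_on UNIV h" and hi: "integrable lborel h" and hb: "\<And>x. \<bar>h x\<bar> \<le> 1" for h :: "'a \<Rightarrow> real"
  proof -
    have [measurable]: "h \<in> borel_measurable borel" using hc by (simp add: borel_measurable_continuous_onI)
    \<comment> \<open>\<open>K e\<close> is, up to a constant, \<open>h\<close> averaged over a
      Gaussian of width \<open>e\<close>; the rescaled variable makes dominated convergence
      applicable as \<open>e\<close> tends to 0.\<close>
    define K where "K = (\<lambda>e x. \<integral>u. h (x + e *\<^sub>R u) * ?G u \<partial>lborel)"
      have gK: "(\<integral>x. g x * of_real (K e x) \<partial>lborel) = 0" if e: "e > 0" for e
    proof -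
      have *: "(\<integral>y. h y * ?G ((x - y) /\<^sub>R e) \<partial>lborel) = e ^ DIM('a) * K e x" for x
        unfolding K_def by (subst integral_affine_euclidean[where t=x and c=e]) (use e in \<open>auto\<close>)
      have "of_real (e ^ DIM('a)) * (\<integral>x. g x * of_real (K e x) \<partial>lborel)
          = (\<integral>x. g x * of_real (\<integral>y. h y * ?G ((x - y) /\<^sub>R e) \<partial>lborel) \<partial>lborel)"
        unfolding * by (subst integral_mult_right_zero[symmetric]) (simp add: ac_simps)
      also have "\<dots> = (\<integral>x. (\<integral>y. g x * of_real (h y) * of_real (?G ((x - y) /\<^sub>R e)) \<partial>lborel) \<partial>lborel)"
        by (intro Bochner_Integration.integral_cong refl)
          (simp add: ac_simps flip: integral_mult_right_zero integral_complex_of_real)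
      also have "\<dots> = (\<integral>y. (\<integral>x. g x * of_real (h y) * of_real (?G ((x - y) /\<^sub>R e)) \<partial>lborel) \<partial>lborel)"
        by (rule Fubini_bounded_kernel[symmetric, OF g, where B=1]) (use hi in auto)
      also have "\<dots> = (\<integral>y. of_real (h y) * (\<integral>x. g x * of_real (?G ((x - y) /\<^sub>R e)) \<partial>lborel) \<partial>lborel)"
        by (intro Bochner_Integration.integral_cong refl)
          (simp add: ac_simps flip: integral_mult_right_zero)
      also have "\<dots> = 0" by (simp only: conv) simp
      finally show ?thesis using e by simp
    qed
    have lim: "(\<lambda>n. K (1 / Suc n) x) \<longlonglongrightarrow> (\<integral>u. h x * ?G u \<partial>lborel)" for x
      unfolding K_def
    proof (rule integral_dominated_convergence[where w="?G"])
      show "AE u in lborel. (\<lambda>n. h (x + (1 / Suc n) *\<^sub>R u) * ?G u) \<longlonglongrightarrow> h x * ?G u"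
      proof (rule AE_I2)
        fix u :: 'a
        have "(\<lambda>n. x + (1 / Suc n) *\<^sub>R u) \<longlonglongrightarrow> x + 0 *\<^sub>R u"
          by (intro tendsto_intros LIMSEQ_Suc[OF lim_1_over_n])
        then have "(\<lambda>n. h (x + (1 / Suc n) *\<^sub>R u)) \<longlonglongrightarrow> h (x + 0 *\<^sub>R u)"
          by (rule continuous_on_tendsto_compose[OF hc]) auto
        then show "(\<lambda>n. h (x + (1 / Suc n) *\<^sub>R u) * ?G u) \<longlonglongrightarrow> h x * ?G u"
          by (intro tendsto_intros) auto
      qed
    qed (use G hb in \<open>auto simp: abs_mult intro!: mult_left_le_one_le\<close>)
    have Kb: "\<bar>K e x\<bar> \<le> (\<integral>u. ?G u \<partial>lborel)" for e x
      unfolding K_def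
      by (rule integral_abs_bound[THEN order_trans], rule integral_mono', rule G)
        (use hb in \<open>auto simp: abs_mult intro!: mult_left_le_one_le\<close>)
    have [measurable]: "K e \<in> borel_measurable borel" for e
      unfolding K_def by measurable
    have "(\<lambda>n. \<integral>x. g x * of_real (K (1 / Suc n) x) \<partial>lborel) \<longlonglongrightarrow> (\<integral>x. g x * of_real (\<integral>u. h x * ?G u \<partial>lborel) \<partial>lborel)"
    proof (rule integral_dominated_convergence[where w="\<lambda>x. norm (g x) * (\<integral>u. ?G u \<partial>lborel)"])
      show "AE x in lborel. (\<lambda>n. g x * of_real (K (1 / Suc n) x)) \<longlonglongrightarrow> g x * of_real (\<integral>u. h x * ?G u \<partial>lborel)"
        using lim by (intro AE_I2 tendsto_intros)
      show "AE x in lborel. norm (g x * of_real (K (1 / Suc n) x)) \<le> norm (g x) * (\<integral>u. ?G u \<partial>lborel)" for n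
        using Kb by (auto simp: norm_mult intro!: mult_left_mono)
    qed (use g in auto)
    then have "(\<integral>x. g x * of_real (\<integral>u. h x * ?G u \<partial>lborel) \<partial>lborel) = 0"
      by (simp add: gK LIMSEQ_const_iff del: of_nat_Suc)
    then have "(\<integral>x. g x * of_real (h x) * of_real (\<integral>u. ?G u \<partial>lborel) \<partial>lborel) = 0"
      by (simp add: ac_simps)
    moreover have "(\<integral>u. ?G u \<partial>lborel) \<noteq> 0"
    proof -
      have "complex_of_real (\<integral>u. ?G u \<partial>lborel) = of_real (sqrt (2 * pi) ^ DIM('a))"
        using fourier_gaussian[of "0::'a"] by (simp add: has_bochner_integral_iff flip: integral_complex_of_real)
      then show ?thesis by (simp only: of_real_eq_iff) simp
    qed
    ultimately show ?thesis by simp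
  qed
  show ?thesis
  proof (rule AE_zero_if_box_integrals_zero[OF g])
    show "(\<integral>x. g x \<partial>lborel) = 0" using F[of 0] by simp
    fix l u :: 'a
    obtain h :: "nat \<Rightarrow> 'a \<Rightarrow> real" where h: "\<And>n. continuous_on UNIV (h n)" "\<And>n x. \<bar>h n x\<bar> \<le> indicator (box l u) x"
      "\<And>x. (\<lambda>n. h n x) \<longlonglongrightarrow> indicator (box l u) x"
      using box_continuous_approx[of l u] by blast
    have [measurable]: "h n \<in> borel_measurable borel" for n using h(1) by (simp add: borel_measurable_continuous_onI)
    have hi: "integrable lborel (h n)" for n
      by (rule Bochner_Integration.integrable_bound[of _ "indicator (box l u) :: 'a \<Rightarrow> real"], rule integrable_real_indicator)
        (use h(2) in \<open>auto simp: emeasure_lborel_box_eq\<close>)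
    have h1: "\<bar>h n x\<bar> \<le> 1" for n x
      using h(2)[of n x] by (rule order_trans) (auto simp: indicator_def)
    have "(\<lambda>n. \<integral>x. g x * of_real (h n x) \<partial>lborel) \<longlonglongrightarrow> (\<integral>x. g x * of_real (indicator (box l u) x) \<partial>lborel)"
    proof (rule integral_dominated_convergence[where w="\<lambda>x. norm (g x)"])
      show "AE x in lborel. (\<lambda>n. g x * of_real (h n x)) \<longlonglongrightarrow> g x * of_real (indicator (box l u) x)"
        using h(3) by (intro AE_I2 tendsto_intros)
      show "AE x in lborel. norm (g x * of_real (h n x)) \<le> norm (g x)" for n
        using h1 by (auto simp: norm_mult intro!: mult_right_le_one_le)
    qed (use g in auto)
    then have "(\<integral>x. g x * of_real (indicator (box l u) x) \<partial>lborel) = 0"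
      using zero[OF h(1) hi h1] by (simp add: LIMSEQ_const_iff)
    then show "(\<integral>x. indicator (box l u) x *\<^sub>R g x \<partial>lborel) = 0"
      by (simp add: scaleR_conv_of_real mult.commute)
  qed
qed

section \<open>Laplace integrals and a Phragmen-Lindelof theorem\<close>

text \<open>Expanding the exponential about \<open>z\<close> gives a power series. Its terms sum
  absolutely to \<open>exp (\<rho> * |\<phi> x|)\<close>, which is at most the sum of the real
  exponentials with rates \<open>\<rho>\<close> and \<open>- \<rho>\<close>; so integrability along
  the real part of the strip is enough to exchange sum and integral.\<close>

lemma holomorphic_on_laplace_integral:
  fixes g :: "'a \<Rightarrow> complex" and \<phi> :: "'a \<Rightarrow> real"
  assumes [measurable]: "g \<in> borel_measurable M" "\<phi> \<in> borel_measurable M"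
    and int: "\<And>\<sigma>. \<bar>\<sigma>\<bar> < c \<Longrightarrow> integrable M (\<lambda>x. g x * of_real (exp (\<sigma> * \<phi> x)))"
  shows "(\<lambda>\<zeta>. \<integral>x. g x * exp (\<zeta> * of_real (\<phi> x)) \<partial>M) holomorphic_on {\<zeta>. \<bar>Re \<zeta>\<bar> < c}"
proof (rule analytic_imp_holomorphic, unfold analytic_on_def, safe)
  fix z :: complex assume z: "\<bar>Re z\<bar> < c"
  define r where "r = c - \<bar>Re z\<bar>"
  let ?a = "\<lambda>n. \<integral>x. g x * exp (z * of_real (\<phi> x)) * of_real (\<phi> x) ^ n /\<^sub>R fact n \<partial>M"
  have "(\<lambda>n. ?a n * (w - z) ^ n) sums (\<integral>x. g x * exp (w * of_real (\<phi> x)) \<partial>M)" if w: "w \<in> ball z r" for w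
  proof -
    define \<rho> where "\<rho> = cmod (w - z)"
    have \<rho>: "0 \<le> \<rho>" "\<rho> < r" using w by (auto simp: \<rho>_def dist_norm norm_minus_commute)
    let ?t = "\<lambda>n x. g x * exp (z * of_real (\<phi> x)) * of_real (\<phi> x) ^ n /\<^sub>R fact n * (w - z) ^ n"
    let ?D = "\<lambda>x. cmod (g x * of_real (exp ((Re z + \<rho>) * \<phi> x))) + cmod (g x * of_real (exp ((Re z - \<rho>) * \<phi> x)))"
    have D: "integrable M ?D"
      by (intro Bochner_Integration.integrable_add integrable_norm int) (use \<rho> z in \<open>auto simp: r_def\<close>)
    have nt: "cmod (?t n x) = cmod (g x) * exp (Re z * \<phi> x) * ((\<rho> * \<bar>\<phi> x\<bar>) ^ n /\<^sub>R fact n)" for n x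
      by (simp add: norm_mult norm_power norm_divide \<rho>_def power_mult_distrib field_simps)
    have nts: "(\<lambda>n. cmod (?t n x)) sums (cmod (g x) * exp (Re z * \<phi> x) * exp (\<rho> * \<bar>\<phi> x\<bar>))" for x
      unfolding nt by (intro sums_mult exp_converges)
    have le: "cmod (g x) * exp (Re z * \<phi> x) * exp (\<rho> * \<bar>\<phi> x\<bar>) \<le> ?D x" for x
    proof (cases "\<phi> x \<ge> 0")
      case True
      then have "cmod (g x) * exp (Re z * \<phi> x) * exp (\<rho> * \<bar>\<phi> x\<bar>) = cmod (g x * of_real (exp ((Re z + \<rho>) * \<phi> x)))"
        by (simp add: norm_mult exp_add[symmetric] ring_distribs)
      then show ?thesis by simp
    next
      case False
      then have "cmod (g x) * exp (Re z * \<phi> x) * exp (\<rho> * \<bar>\<phi> x\<bar>) = cmod (g x * of_real (exp ((Re z - \<rho>) * \<phi> x)))"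
        by (simp add: norm_mult exp_add[symmetric] ring_distribs left_diff_distrib)
      then show ?thesis by simp
    qed
    have it: "integrable M (?t n)" for n
    proof (rule Bochner_Integration.integrable_bound[OF D])
      show "AE x in M. norm (?t n x) \<le> norm (?D x)"
      proof (rule AE_I2)
        fix x
        have "cmod (?t n x) \<le> (\<Sum>n. cmod (?t n x))"
          using sum_le_suminf[OF sums_summable[OF nts[of x]], of "{n}"] by simp
        also have "\<dots> \<le> ?D x" using le[of x] sums_unique[OF nts[of x]] by simp
        finally show "norm (?t n x) \<le> norm (?D x)" by simp
      qed
    qed measurable
    have sn: "summable (\<lambda>n. \<integral>x. norm (?t n x) \<partial>M)"
    proof (rule summableI_nonneg_bounded[where x="integral\<^sup>L M ?D"])
      fix N
      have "(\<Sum>n<N. \<integral>x. norm (?t n x) \<partial>M) = (\<integral>x. (\<Sum>n<N. norm (?t n x)) \<partial>M)"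
        by (rule Bochner_Integration.integral_sum[symmetric], rule integrable_norm, rule it)
      also have "\<dots> \<le> integral\<^sup>L M ?D"
      proof (rule integral_mono)
        show "integrable M (\<lambda>x. \<Sum>n<N. norm (?t n x))" using it by (intro Bochner_Integration.integrable_sum integrable_norm)
        show "(\<Sum>n<N. norm (?t n x)) \<le> ?D x" for x
        proof -
          have "(\<Sum>n<N. norm (?t n x)) \<le> (\<Sum>n. norm (?t n x))"
            by (rule sum_le_suminf[OF sums_summable[OF nts]]) auto
          then show ?thesis using le[of x] sums_unique[OF nts[of x]] by simp
        qed
      qed (rule D)
      finally show "(\<Sum>n<N. \<integral>x. norm (?t n x) \<partial>M) \<le> integral\<^sup>L M ?D" .
    qed auto
    have "(\<lambda>n. integral\<^sup>L M (?t n)) sums (\<integral>x. (\<Sum>n. ?t n x) \<partial>M)"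
      by (rule sums_integral[OF it _ sn]) (use nts sums_summable in blast)
    moreover have "(\<Sum>n. ?t n x) = g x * exp (w * of_real (\<phi> x))" for x
    proof -
      have "(\<lambda>n. g x * exp (z * of_real (\<phi> x)) * ((of_real (\<phi> x) * (w - z)) ^ n /\<^sub>R fact n)) sums
          (g x * exp (z * of_real (\<phi> x)) * exp (of_real (\<phi> x) * (w - z)))"
        by (intro sums_mult exp_converges)
      have "(\<lambda>n. ?t n x) sums (g x * exp (z * of_real (\<phi> x)) * exp (of_real (\<phi> x) * (w - z)))"
        using \<open>(\<lambda>n. _ * (_ ^ n /\<^sub>R fact n)) sums _\<close> by (simp add: power_mult_distrib ac_simps)
      moreover have "g x * exp (z * of_real (\<phi> x)) * exp (of_real (\<phi> x) * (w - z)) = g x * exp (w * of_real (\<phi> x))"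
        by (simp add: mult.assoc exp_add[symmetric] algebra_simps)
      ultimately show ?thesis using sums_unique by metis
    qed
    moreover have "integral\<^sup>L M (?t n) = ?a n * (w - z) ^ n" for n by (rule integral_mult_left_zero)
    ultimately show ?thesis by simp
  qed
  then have "(\<lambda>\<zeta>. \<integral>x. g x * exp (\<zeta> * of_real (\<phi> x)) \<partial>M) holomorphic_on ball z r"
    by (rule power_series_holomorphic)
  moreover have "r > 0" using z by (simp add: r_def)
  ultimately show "\<exists>e>0. (\<lambda>\<zeta>. \<integral>x. g x * exp (\<zeta> * of_real (\<phi> x)) \<partial>M) holomorphic_on ball z e" by blast
qed

text \<open>In logarithmic coordinates a sector of opening less than a right angle becomes a
  half-strip, and growth of order two becomes \<open>exp (K * exp (2 * Re w))\<close>. The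
  multiplier \<open>exp (- e * exp (\<rho> * w))\<close> beats this growth if
  \<open>\<rho> > 2\<close> and has modulus at most 1 on the strip if
  \<open>\<rho> * \<beta> < pi / 2\<close>; both are possible because
  \<open>\<beta> < pi / 4\<close>. At the end \<open>e\<close> tends to 0.\<close>

lemma phragmen_lindelof_strip:
  assumes g: "g holomorphic_on UNIV" and \<beta>: "0 < \<beta>" "\<beta> < pi / 4" and C: "C > 0"
    and growth: "\<And>w. Re w \<ge> 0 \<Longrightarrow> \<bar>Im w\<bar> \<le> \<beta> \<Longrightarrow> cmod (g w) \<le> L * exp (K * exp (2 * Re w))"
    and side: "\<And>w. Re w \<ge> 0 \<Longrightarrow> \<bar>Im w\<bar> = \<beta> \<Longrightarrow> cmod (g w) \<le> C"
    and base: "\<And>w. Re w = 0 \<Longrightarrow> \<bar>Im w\<bar> \<le> \<beta> \<Longrightarrow> cmod (g w) \<le> C"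
    and w: "Re w \<ge> 0" "\<bar>Im w\<bar> \<le> \<beta>"
  shows "cmod (g w) \<le> C"
proof -
  \<comment> \<open>The midpoint of the admissible interval from 2 to
    \<open>pi / (2 * \<beta>)\<close>.\<close>
  define \<rho> where "\<rho> = (2 + pi / (2 * \<beta>)) / 2"
  have "pi / (2 * \<beta>) > 2" using \<beta> by (simp add: field_simps)
  then have \<rho>: "\<rho> > 2" "\<rho> < pi / (2 * \<beta>)" by (auto simp: \<rho>_def)
  then have \<rho>\<beta>: "\<rho> * \<beta> < pi / 2" using \<beta> by (simp add: field_simps)
  define \<delta> where "\<delta> = cos (\<rho> * \<beta>)"
  have \<delta>: "\<delta> > 0" unfolding \<delta>_def using \<rho>\<beta> \<rho> \<beta> by (intro cos_gt_zero_pi) (auto simp: less_trans[of _ 0])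
  have Re_exp: "Re (exp (of_real \<rho> * v)) \<ge> \<delta> * exp (\<rho> * Re v)" if "\<bar>Im v\<bar> \<le> \<beta>" for v
  proof -
    have "cos (\<rho> * \<beta>) \<le> cos (\<rho> * \<bar>Im v\<bar>)"
      using that \<rho> \<beta> \<rho>\<beta> by (intro cos_monotone_0_pi_le mult_left_mono) auto
    also have "\<dots> = cos (\<rho> * Im v)" by (simp add: abs_if)
    finally show ?thesis by (simp add: Re_exp \<delta>_def mult.commute mult_left_mono)
  qed
  have key: "cmod (g w) \<le> C * exp (e * cmod (exp (of_real \<rho> * w)))" if e: "e > 0" for e
  proof -
    have "((\<lambda>x. L * exp (exp (2 * x) * (K - e * \<delta> * exp ((\<rho> - 2) * x)))) \<longlongrightarrow> 0) at_top"
    proof -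
      have "filterlim (\<lambda>x. e * \<delta> * exp ((\<rho> - 2) * x)) at_top at_top"
        using e \<delta> \<rho> by (intro filterlim_tendsto_pos_mult_at_top[OF tendsto_const] filterlim_compose[OF exp_at_top] filterlim_ident) auto
      then have "filterlim (\<lambda>x. - K + e * \<delta> * exp ((\<rho> - 2) * x)) at_top at_top"
        by (rule filterlim_tendsto_add_at_top[OF tendsto_const])
      moreover have "filterlim (\<lambda>x::real. exp (2 * x)) at_top at_top"
        by (intro filterlim_compose[OF exp_at_top] filterlim_tendsto_pos_mult_at_top[OF tendsto_const] filterlim_ident) auto
      ultimately have "filterlim (\<lambda>x. exp (2 * x) * (- K + e * \<delta> * exp ((\<rho> - 2) * x))) at_top at_top"
        by (intro filterlim_at_top_mult_at_top)
      then have "filterlim (\<lambda>x. exp (2 * x) * (K - e * \<delta> * exp ((\<rho> - 2) * x))) at_bot at_top"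
        by (subst filterlim_uminus_at_bot) (simp add: algebra_simps)
      then have "((\<lambda>x. exp (exp (2 * x) * (K - e * \<delta> * exp ((\<rho> - 2) * x)))) \<longlongrightarrow> 0) at_top"
        by (rule filterlim_compose[OF exp_at_bot])
      from tendsto_mult_left[OF this, of L] show ?thesis by simp
    qed
    then have "\<forall>\<^sub>F x in at_top. L * exp (exp (2 * x) * (K - e * \<delta> * exp ((\<rho> - 2) * x))) < C"
      using C by (rule order_tendstoD)
    then have "\<forall>\<^sub>F x in at_top. L * exp (exp (2 * x) * (K - e * \<delta> * exp ((\<rho> - 2) * x))) < C \<and> x \<ge> Re w"
      by (intro eventually_conj eventually_ge_at_top)
    \<comment> \<open>Far enough to the right the multiplier pushes the product below
      \<open>C\<close> on the vertical edge, so the maximum principle applies to a rectangle that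
      contains \<open>w\<close>.\<close>
    then obtain X where X: "L * exp (exp (2 * X) * (K - e * \<delta> * exp ((\<rho> - 2) * X))) < C" "X \<ge> Re w"
      using eventually_happens'[of at_top] by (metis (no_types, lifting) trivial_limit_at_top_linorder)
    let ?S = "cbox (Complex 0 (- \<beta>)) (Complex X \<beta>)"
    let ?f = "\<lambda>v. g v * exp (- of_real e * exp (of_real \<rho> * v))"
    have nf: "cmod (?f v) \<le> cmod (g v) * exp (- (e * \<delta> * exp (\<rho> * Re v)))" if "\<bar>Im v\<bar> \<le> \<beta>" for v
    proof -
      have "cmod (?f v) = cmod (g v) * exp (- e * Re (exp (of_real \<rho> * v)))"
        by (simp add: norm_mult)
      also have "\<dots> \<le> cmod (g v) * exp (- (e * \<delta> * exp (\<rho> * Re v)))"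
        using Re_exp[OF that] e by (intro mult_left_mono) (auto simp: mult.assoc)
      finally show ?thesis .
    qed
    have "cmod (?f w) \<le> C"
    proof (rule maximum_modulus_frontier[of ?f ?S])
      show "?f holomorphic_on interior ?S" "continuous_on (closure ?S) ?f"
        using g by (auto intro!: holomorphic_intros holomorphic_on_imp_continuous_on intro: holomorphic_on_subset)
      show "bounded ?S" by simp
      show "w \<in> ?S" using w X by (auto simp: in_cbox_complex_iff)
      fix v assume "v \<in> frontier ?S"
      then have v: "v \<in> ?S" "v \<notin> box (Complex 0 (- \<beta>)) (Complex X \<beta>)" by (auto simp: frontier_cbox)
      then have vr: "0 \<le> Re v" "\<bar>Im v\<bar> \<le> \<beta>" by (auto simp: in_cbox_complex_iff)
      have le1: "exp (- (e * \<delta> * exp (\<rho> * Re v))) \<le> 1" using e \<delta> by simp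
      from v have "\<bar>Im v\<bar> = \<beta> \<or> Re v = 0 \<or> Re v = X"
        unfolding in_cbox_complex_iff in_box_complex_iff by auto
      then consider "\<bar>Im v\<bar> = \<beta>" | "Re v = 0" | "Re v = X" by blast
      then have "cmod (g v) * exp (- (e * \<delta> * exp (\<rho> * Re v))) \<le> C"
      proof cases
        case 1
        then show ?thesis using side[OF vr(1) 1]
          by (intro order_trans[OF mult_right_le_one_le[OF _ _ le1]]) auto
      next
        case 2
        then show ?thesis using base[OF 2 vr(2)]
          by (intro order_trans[OF mult_right_le_one_le[OF _ _ le1]]) auto
      next
        case 3
        have "cmod (g v) * exp (- (e * \<delta> * exp (\<rho> * Re v))) \<le> L * exp (K * exp (2 * Re v)) * exp (- (e * \<delta> * exp (\<rho> * Re v)))"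
          using growth[OF vr] by (intro mult_right_mono) auto
        also have "\<dots> = L * exp (K * exp (2 * X) - (e * \<delta> * exp (\<rho> * X)))"
          by (simp add: 3 mult.assoc exp_add[symmetric])
        also have "K * exp (2 * X) - (e * \<delta> * exp (\<rho> * X)) = exp (2 * X) * (K - e * \<delta> * exp ((\<rho> - 2) * X))"
        proof -
          have "exp (\<rho> * X) = exp (2 * X) * exp ((\<rho> - 2) * X)" by (simp add: exp_add[symmetric] algebra_simps)
          then show ?thesis by (simp add: algebra_simps)
        qed
        finally show ?thesis using X by simp
      qed
      then show "cmod (?f v) \<le> C" using nf[OF vr(2)] by linarith
    qed
    moreover have "cmod (?f w) = cmod (g w) * exp (- e * Re (exp (of_real \<rho> * w)))"
      by (simp add: norm_mult)
    ultimately have "cmod (g w) * exp (- e * Re (exp (of_real \<rho> * w))) \<le> C" by (simp only:)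
    then have "cmod (g w) \<le> C * exp (e * Re (exp (of_real \<rho> * w)))"
      by (simp add: exp_minus field_simps)
    also have "\<dots> \<le> C * exp (e * cmod (exp (of_real \<rho> * w)))"
      using C e complex_Re_le_cmod[of "exp (of_real \<rho> * w)"] by (intro mult_left_mono iffD2[OF exp_le_cancel_iff]) (auto simp del: norm_exp_eq_Re)
    finally show ?thesis .
  qed
  have "((\<lambda>e. C * exp (e * cmod (exp (of_real \<rho> * w)))) \<longlongrightarrow> C * exp (0 * cmod (exp (of_real \<rho> * w)))) (at_right 0)"
    by (intro tendsto_intros)
  then have "((\<lambda>e. C * exp (e * cmod (exp (of_real \<rho> * w)))) \<longlongrightarrow> C) (at_right 0)" by simp
  then show ?thesis
    by (rule tendsto_lowerbound[OF _ eventually_mono[OF eventually_at_right_less key]]) simp_all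
qed

text \<open>The rays \<open>w\<close> and \<open>\<i>w\<close> span a right angle, where order two is critical; strict negativity
  of the sum of the two exponents leaves room to shrink the angle, so that Phragmen-Lindelof applies.\<close>

lemma entire_zero_if_two_gaussian_bounds:
  fixes F :: "complex \<Rightarrow> complex" and k1 k2 :: "complex \<Rightarrow> real"
  assumes F: "F holomorphic_on UNIV"
    and b1: "\<And>z. cmod (F z) \<le> C1 * exp (k1 z)" and b2: "\<And>z. cmod (F z) \<le> C2 * exp (k2 z)"
    and cont: "continuous_on UNIV k1" "continuous_on UNIV k2"
    and hom: "\<And>r z. k1 (of_real r * z) = r\<^sup>2 * k1 z" "\<And>r z. k2 (of_real r * z) = r\<^sup>2 * k2 z"
    and neg: "k1 w + k2 (\<i> * w) < 0"
  shows "F z = 0"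
proof -
  have w0: "w \<noteq> 0" using neg hom(1)[of 0 0] hom(2)[of 0 0] by auto
  \<comment> \<open>Subtracting \<open>c * Re (z^2)\<close> changes the exponents along the two rays
    by \<open>- c\<close> and by \<open>+ c\<close>. This value gives each of them half of the
    negative sum.\<close>
  define c where "c = (k1 w - k2 (\<i> * w)) / 2"
  have c: "k1 w < c" "k2 (\<i> * w) < - c" using neg unfolding c_def by (simp_all add: field_simps)
  define m1 where "m1 = (\<lambda>z. k1 (w * z) - c * Re (z\<^sup>2))"
  define m2 where "m2 = (\<lambda>z. k2 (w * z) - c * Re (z\<^sup>2))"
  define H where "H = (\<lambda>z. F (w * z) * exp (- of_real c * z\<^sup>2))"
  define C where "C = max (max C1 C2) 1"
  have C: "C > 0" "C1 \<le> C" "C2 \<le> C" by (auto simp: C_def)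
  have H: "H holomorphic_on UNIV"
  proof -
    have "(\<lambda>z. F (w * z)) holomorphic_on UNIV"
      using holomorphic_on_compose_gen[of "(*) w" UNIV F UNIV] F by (auto simp: o_def intro!: holomorphic_intros)
    then show ?thesis unfolding H_def by (intro holomorphic_intros)
  qed
  have nH: "cmod (H z) = cmod (F (w * z)) * exp (- c * Re (z\<^sup>2))" for z
    by (simp add: H_def norm_mult)
  have H1: "cmod (H z) \<le> C * exp (m1 z)" for z
  proof -
    have "cmod (F (w * z)) \<le> C * exp (k1 (w * z))"
      using b1[of "w * z"] C by (meson exp_ge_zero mult_right_mono order_trans)
    then have "cmod (H z) \<le> C * exp (k1 (w * z)) * exp (- c * Re (z\<^sup>2))"
      unfolding nH by (intro mult_right_mono) auto
    then show ?thesis by (simp add: m1_def exp_diff exp_minus field_simps)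
  qed
  have H2: "cmod (H z) \<le> C * exp (m2 z)" for z
  proof -
    have "cmod (F (w * z)) \<le> C * exp (k2 (w * z))"
      using b2[of "w * z"] C by (meson exp_ge_zero mult_right_mono order_trans)
    then have "cmod (H z) \<le> C * exp (k2 (w * z)) * exp (- c * Re (z\<^sup>2))"
      unfolding nH by (intro mult_right_mono) auto
    then show ?thesis by (simp add: m2_def exp_diff exp_minus field_simps)
  qed
  have hm: "m1 (of_real r * z) = r\<^sup>2 * m1 z" "m2 (of_real r * z) = r\<^sup>2 * m2 z" for r z
    using hom(1)[of r "w * z"] hom(2)[of r "w * z"]
    by (simp_all add: m1_def m2_def power_mult_distrib algebra_simps flip: of_real_power)
  have cm: "continuous_on UNIV m1" "continuous_on UNIV m2"
    unfolding m1_def m2_def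
    by (intro continuous_intros continuous_on_compose2[OF cont(1)] continuous_on_compose2[OF cont(2)]; simp)+
  have n1: "m1 1 < 0" and n2: "m2 \<i> < 0" using c by (auto simp: m1_def m2_def mult.commute)
  obtain \<alpha> where \<alpha>: "0 < \<alpha>" "\<alpha> < pi / 4" and near: "\<And>\<phi>. \<bar>\<phi>\<bar> \<le> \<alpha> \<Longrightarrow> m1 (cis \<phi>) \<le> 0 \<and> m2 (\<i> * cis \<phi>) \<le> 0"
  proof -
    have "continuous_on UNIV (\<lambda>\<phi>. m1 (cis \<phi>))" "continuous_on UNIV (\<lambda>\<phi>. m2 (\<i> * cis \<phi>))"
      by (intro continuous_on_compose2[OF cm(1)] continuous_on_compose2[OF cm(2)] continuous_intros; simp)+
    then have "isCont (\<lambda>\<phi>. m1 (cis \<phi>)) 0" "isCont (\<lambda>\<phi>. m2 (\<i> * cis \<phi>)) 0"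
      by (simp_all add: continuous_on_eq_continuous_at)
    then have "((\<lambda>\<phi>. m1 (cis \<phi>)) \<longlongrightarrow> m1 (cis 0)) (nhds 0)" "((\<lambda>\<phi>. m2 (\<i> * cis \<phi>)) \<longlongrightarrow> m2 (\<i> * cis 0)) (nhds 0)"
      using tendsto_at_iff_tendsto_nhds[of "\<lambda>\<phi>. m1 (cis \<phi>)" 0]
        tendsto_at_iff_tendsto_nhds[of "\<lambda>\<phi>. m2 (\<i> * cis \<phi>)" 0] unfolding isCont_def by (blast, blast)
    then have "\<forall>\<^sub>F \<phi> in nhds 0. m1 (cis \<phi>) < 0 \<and> m2 (\<i> * cis \<phi>) < 0"
      using n1 n2 by (auto intro!: eventually_conj dest: order_tendstoD)
    then obtain d where d: "d > 0" "\<And>\<phi>. dist \<phi> 0 < d \<Longrightarrow> m1 (cis \<phi>) < 0 \<and> m2 (\<i> * cis \<phi>) < 0"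
      unfolding eventually_nhds_metric by blast
    show ?thesis
    proof (rule that[of "min (d / 2) (pi / 8)"])
      show "min (d / 2) (pi / 8) < pi / 4" using pi_gt_zero by linarith
      fix \<phi> :: real assume "\<bar>\<phi>\<bar> \<le> min (d / 2) (pi / 8)"
      then have "dist \<phi> 0 < d" using d(1) by (simp add: dist_real_def)
      then show "m1 (cis \<phi>) \<le> 0 \<and> m2 (\<i> * cis \<phi>) \<le> 0" using d(2) less_imp_le by blast
    qed (use d in auto)
  qed
  \<comment> \<open>The directions of the four half-axes. Homogeneity with negative \<open>r\<close>
    carries the estimates from two of them to the opposite two.\<close>
  define Q where "Q = {1, \<i>, -1, -\<i>}"
  have good: "cmod (H (q * (of_real r * cis \<phi>))) \<le> C" if "q \<in> Q" "\<bar>\<phi>\<bar> \<le> \<alpha>" for q r \<phi>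
  proof -
    have C1: "C * exp x \<le> C" if "x \<le> 0" for x using that C by simp
    have "m1 (of_real (r * s) * cis \<phi>) \<le> 0" "m2 (of_real (r * s) * (\<i> * cis \<phi>)) \<le> 0" for s
      unfolding hm using near[OF that(2)] by (auto simp: mult_nonneg_nonpos)
    from C1[OF this(1)] C1[OF this(2)] have *: "cmod (H (of_real (r * s) * cis \<phi>)) \<le> C"
      "cmod (H (of_real (r * s) * (\<i> * cis \<phi>))) \<le> C" for s
      using H1 H2 order_trans by blast+
    show ?thesis using that(1) *[of 1] *[of "-1"] by (auto simp: Q_def ac_simps)
  qed
  \<comment> \<open>By homogeneity a bound on the unit circle is a bound of order two on the whole
    plane.\<close>
  obtain K where K: "\<And>z. m1 z \<le> K * (cmod z)\<^sup>2"
  proof -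
    have "compact (m1 ` sphere 0 1)" using cm by (intro compact_continuous_image) (auto intro: continuous_on_subset)
    then obtain K where K: "\<And>z. cmod z = 1 \<Longrightarrow> m1 z \<le> K"
      using compact_imp_bounded bounded_imp_bdd_above unfolding bdd_above_def by (metis imageI mem_sphere_0)
    have "m1 z \<le> K * (cmod z)\<^sup>2" for z
    proof -
      have "z = of_real (cmod z) * cis (Arg z)" using rcis_cmod_Arg[of z] by (simp add: rcis_def)
      then have "m1 z = (cmod z)\<^sup>2 * m1 (cis (Arg z))" using hm(1) by metis
      then show ?thesis using K[of "cis (Arg z)"] by (simp add: mult.commute[of "(cmod z)\<^sup>2"] mult_right_mono)
    qed
    then show ?thesis using that by blast
  qed
  \<comment> \<open>The half-strip covers only \<open>|z| \<ge> 1\<close>. The closed unit disc is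
    treated by compactness, and the same constant bounds the vertical edge of the
    half-strip.\<close>
  obtain C0 where C0: "\<And>z. cmod z \<le> 1 \<Longrightarrow> cmod (H z) \<le> C0"
  proof -
    have "compact (H ` cball 0 1)" using H by (intro compact_continuous_image holomorphic_on_imp_continuous_on) (auto intro: holomorphic_on_subset)
    then have "bounded (H ` cball 0 1)" by (rule compact_imp_bounded)
    then obtain B where "\<forall>x\<in>H ` cball 0 1. norm x \<le> B" unfolding bounded_iff ..
    then show ?thesis by (intro that[of B]) simp
  qed
  define B where "B = max C C0"
  have B: "B > 0" "C \<le> B" "C0 \<le> B" using C by (auto simp: B_def)
  have bound: "cmod (H z) \<le> B" for z
  proof (cases "cmod z \<le> 1")
    case True
    then show ?thesis using C0[OF True] B by linarith
  next
    case False
    \<comment> \<open>Division by a fourth root of unity brings \<open>z\<close> into the closed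
      first quadrant.\<close>
    obtain q where q: "q \<in> Q" "Re (z / q) \<ge> 0" "Im (z / q) \<ge> 0"
    proof -
      consider "Re z \<ge> 0" "Im z \<ge> 0" | "Re z < 0" "Im z \<ge> 0" | "Re z < 0" "Im z < 0" | "Re z \<ge> 0" "Im z < 0" by linarith
      then show ?thesis
        by cases (auto intro: that[of 1] that[of \<i>] that[of "-1"] that[of "-\<i>"] simp: Q_def Re_divide Im_divide)
    qed
    have cq: "cmod q = 1" and q0: "q \<noteq> 0" using q(1) by (auto simp: Q_def)
    have "z / q \<noteq> 0" using q0 False by auto
    define \<theta> where "\<theta> = Arg (z / q)"
    have nz: "cmod (z / q) = cmod z" by (simp add: norm_divide cq)
    have zq: "z / q = of_real (cmod z) * cis \<theta>" using rcis_cmod_Arg[of "z / q"] by (simp add: rcis_def \<theta>_def nz)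
    have "z = q * (z / q)" using q0 by simp
    then have z: "z = q * (of_real (cmod z) * cis \<theta>)" unfolding zq .
    have r0: "cmod z > 0" using False by linarith
    have cs: "cos \<theta> \<ge> 0" "sin \<theta> \<ge> 0" using q(2,3) r0 unfolding zq by (auto simp: zero_le_mult_iff)
    have \<theta>r: "- pi < \<theta>" "\<theta> \<le> pi" using mpi_less_Arg Arg_le_pi by (auto simp: \<theta>_def)
    have \<theta>0: "\<theta> \<ge> 0" using cs(2) \<theta>r sin_gt_zero[of "- \<theta>"] by fastforce
    have \<theta>1: "\<theta> \<le> pi / 2" using cs(1) \<theta>r cos_gt_zero_pi[of "pi - \<theta>"] by fastforce
    show ?thesis
    proof (cases "\<theta> \<le> \<alpha> \<or> \<theta> \<ge> pi / 2 - \<alpha>")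
      case True
      then show ?thesis
      proof
        assume "\<theta> \<le> \<alpha>"
        then show ?thesis using good[OF q(1), of \<theta> "cmod z"] \<theta>0 z B by simp
      next
        assume a: "\<theta> \<ge> pi / 2 - \<alpha>"
        have "q * \<i> \<in> Q" using q(1) by (auto simp: Q_def)
        moreover have "z = (q * \<i>) * (of_real (cmod z) * cis (\<theta> - pi / 2))"
        proof -
          have "cis \<theta> = \<i> * cis (\<theta> - pi / 2)" using cis_mult[of "pi / 2" "\<theta> - pi / 2"] by simp
          then show ?thesis by (subst z) (simp only: ac_simps)
        qed
        moreover have "\<bar>\<theta> - pi / 2\<bar> \<le> \<alpha>" using a \<theta>1 \<alpha>(1) by linarith
        ultimately have "cmod (H z) \<le> C" using good by metis
        then show ?thesis using B by linarith
      qed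
    next
      case False
      \<comment> \<open>Turning by \<open>pi / 4\<close> centres the remaining sector of the
        quadrant on the real axis; its half-opening is now strictly below the critical value
        \<open>pi / 4\<close>.\<close>
      define \<beta> where "\<beta> = pi / 4 - \<alpha>"
      define g where "g = (\<lambda>v. H (q * (cis (pi / 4) * exp v)))"
      have gv: "g v = H (q * (of_real (exp (Re v)) * cis (pi / 4 + Im v)))" for v
        by (simp add: g_def exp_eq_polar cis_mult[symmetric] ac_simps)
      let ?v = "Complex (ln (cmod z)) (\<theta> - pi / 4)"
      have "cmod (g ?v) \<le> B"
      proof (rule phragmen_lindelof_strip[where g=g and w="?v" and \<beta>=\<beta> and L=C and K="\<bar>K\<bar>"])
        show "g holomorphic_on UNIV" unfolding g_def
          by (rule holomorphic_on_compose_gen[of "\<lambda>v. q * (cis (pi / 4) * exp v)" UNIV H UNIV, unfolded o_def])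
            (auto intro!: holomorphic_intros H)
        show "0 < \<beta>" "\<beta> < pi / 4" using \<alpha> by (auto simp: \<beta>_def)
        show "B > 0" by fact
        show "0 \<le> Re ?v" using \<open>\<not> cmod z \<le> 1\<close> by simp
        show "\<bar>Im ?v\<bar> \<le> \<beta>" using False by (auto simp: \<beta>_def)
      next
        fix v :: complex
        show "cmod (g v) \<le> C * exp (\<bar>K\<bar> * exp (2 * Re v))"
        proof -
          have "cmod (q * (cis (pi / 4) * exp v)) = exp (Re v)" by (simp add: norm_mult cq)
          then have "m1 (q * (cis (pi / 4) * exp v)) \<le> K * (exp (Re v))\<^sup>2" using K by metis
          also have "\<dots> \<le> \<bar>K\<bar> * (exp (Re v))\<^sup>2" by (intro mult_right_mono) auto
          also have "(exp (Re v))\<^sup>2 = exp (2 * Re v)" by (rule exp_double[symmetric])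
          finally have "C * exp (m1 (q * (cis (pi / 4) * exp v))) \<le> C * exp (\<bar>K\<bar> * exp (2 * Re v))" using C by simp
          then show ?thesis unfolding g_def by (rule order_trans[OF H1])
        qed
      next
        fix v :: complex assume v: "\<bar>Im v\<bar> = \<beta>"
        then consider "Im v = \<beta>" | "Im v = - \<beta>" by linarith
        then show "cmod (g v) \<le> B"
        proof cases
          case 1
          have "q * \<i> \<in> Q" using q(1) by (auto simp: Q_def)
          moreover have "pi / 4 + Im v = pi / 2 + (- \<alpha>)" using 1 by (simp add: \<beta>_def)
          then have "g v = H ((q * \<i>) * (of_real (exp (Re v)) * cis (- \<alpha>)))"
            unfolding gv by (simp only: cis_mult[symmetric] cis_pi_half ac_simps)
          ultimately have "cmod (g v) \<le> C" using good[of "q * \<i>" "- \<alpha>" "exp (Re v)"] \<alpha> by simp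
          then show ?thesis using B by linarith
        next
          case 2
          have "pi / 4 + Im v = \<alpha>" using 2 by (simp add: \<beta>_def)
          then have "cmod (g v) \<le> C" unfolding gv using good[OF q(1), of "\<alpha>" "exp (Re v)"] \<alpha> by simp
          then show ?thesis using B by linarith
        qed
      next
        fix v :: complex assume "Re v = 0"
        then have "cmod (q * (cis (pi / 4) * exp v)) \<le> 1" by (simp add: norm_mult cq)
        then show "cmod (g v) \<le> B" unfolding g_def using B by (intro order_trans[OF C0]) auto
      qed
      moreover have "g ?v = H z" unfolding gv using z r0 by simp
      ultimately show ?thesis by simp
    qed
  qed
  \<comment> \<open>A bounded entire function is constant, and decay along the positive axis forces
    this constant to be 0.\<close>
  have "H constant_on UNIV"
    using bound by (intro Liouville_theorem[OF H]) (auto simp: bounded_iff)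
  then obtain v where v: "\<And>z. H z = v" by (auto simp: constant_on_def)
  have "((\<lambda>r::real. C * exp (r\<^sup>2 * m1 1)) \<longlongrightarrow> C * 0) at_top"
  proof (intro tendsto_mult tendsto_const filterlim_compose[OF exp_at_bot])
    have "filterlim (\<lambda>r::real. r\<^sup>2) at_top at_top" by (intro filterlim_pow_at_top filterlim_ident) simp
    then show "filterlim (\<lambda>r. r\<^sup>2 * m1 1) at_bot at_top"
      by (subst mult.commute) (rule filterlim_tendsto_neg_mult_at_bot[OF tendsto_const n1])
  qed
  moreover have "cmod v \<le> C * exp (r\<^sup>2 * m1 1)" for r :: real
    using H1[of "of_real r"] hm(1)[of r 1] v by simp
  ultimately have "cmod v \<le> C * 0"
    by (intro tendsto_lowerbound[where F=at_top]) (auto intro: always_eventually)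
  then have "H (z / w) = 0" using v by simp
  then show ?thesis using w0 by (simp add: H_def)
qed

section \<open>Coherent states with a smooth cutoff\<close>

definition flat_exp :: "nat \<Rightarrow> real \<Rightarrow> real" where
  "flat_exp k u = (if u > 0 then exp (- 1 / u) / u ^ k else 0)"

text \<open>A single term of the exponential series bounds \<open>exp (1 / u)\<close> from below.
  The free exponent \<open>m\<close> gives boundedness for \<open>m = 0\<close> and
  differentiability at the origin for \<open>m = 2\<close>.\<close>

lemma flat_exp_bounds:
  shows "0 \<le> flat_exp k u" and "flat_exp k u \<le> fact (k + m) * \<bar>u\<bar> ^ m"
proof -
  show "0 \<le> flat_exp k u" by (simp add: flat_exp_def)
  show "flat_exp k u \<le> fact (k + m) * \<bar>u\<bar> ^ m"
  proof (cases "u > 0")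
    case True
    have "(1 / u) ^ (k + m) /\<^sub>R fact (k + m) \<le> (\<Sum>i. (1 / u) ^ i /\<^sub>R fact i)"
      using sum_le_suminf[OF summable_exp_generic[of "1 / u"], of "{k + m}"] True by simp
    then have "(1 / u) ^ (k + m) / fact (k + m) \<le> exp (1 / u)"
      by (simp add: exp_def field_simps)
    then have "exp (- 1 / u) \<le> fact (k + m) * u ^ (k + m)"
      using True by (simp add: exp_minus field_simps)
    then show ?thesis using True by (simp add: flat_exp_def field_simps power_add)
  qed (simp add: flat_exp_def)
qed

lemma flat_exp_le: "flat_exp k u \<le> fact k"
  using flat_exp_bounds(2)[of k u 0] by simp

lemma DERIV_flat_exp:
  "(flat_exp k has_real_derivative flat_exp (k + 2) u - k * flat_exp (k + 1) u) (at u)"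
proof (cases u "0::real" rule: linorder_cases)
  case less
  have "((\<lambda>_. 0) has_real_derivative 0) (at u)" by simp
  then have "(flat_exp k has_real_derivative 0) (at u)"
    by (rule has_field_derivative_transform_within_open[where S="{..<0}"]) (use less in \<open>auto simp: flat_exp_def\<close>)
  then show ?thesis using less by (simp add: flat_exp_def)
next
  case greater
  have "((\<lambda>v. exp (- 1 / v) / v ^ k) has_real_derivative
     ((exp (- 1 / u) * (1 / u\<^sup>2)) * u ^ k - exp (- 1 / u) * (real k * u ^ (k - 1))) / (u ^ k * u ^ k)) (at u)"
    using greater by (auto intro!: derivative_eq_intros simp: power2_eq_square)
  then have "(flat_exp k has_real_derivative
     ((exp (- 1 / u) * (1 / u\<^sup>2)) * u ^ k - exp (- 1 / u) * (real k * u ^ (k - 1))) / (u ^ k * u ^ k)) (at u)"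
    by (rule has_field_derivative_transform_within_open[where S="{0<..}"]) (use greater in \<open>auto simp: flat_exp_def\<close>)
  moreover have "((exp (- 1 / u) * (1 / u\<^sup>2)) * u ^ k - exp (- 1 / u) * (real k * u ^ (k - 1))) / (u ^ k * u ^ k)
     = flat_exp (k + 2) u - k * flat_exp (k + 1) u"
    using greater by (cases k) (simp_all add: flat_exp_def field_simps power2_eq_square)
  ultimately show ?thesis by simp
next
  case equal
  have "((\<lambda>h. (flat_exp k (0 + h) - flat_exp k 0) / h) \<longlongrightarrow> 0) (at 0)"
  proof (rule Lim_null_comparison)
    have "((\<lambda>h::real. fact (k + 2) * \<bar>h\<bar>) \<longlongrightarrow> fact (k + 2) * \<bar>0\<bar>) (at 0)" by (intro tendsto_intros)
    then show "((\<lambda>h::real. fact (k + 2) * \<bar>h\<bar>) \<longlongrightarrow> 0) (at 0)" by simp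
    have "norm ((flat_exp k (0 + h) - flat_exp k 0) / h) \<le> fact (k + 2) * \<bar>h\<bar>" if "h \<noteq> 0" for h
      using flat_exp_bounds[of k h] flat_exp_bounds(2)[of k h 2] that
      by (simp add: flat_exp_def[of k 0] divide_le_eq power2_eq_square abs_mult[symmetric])
    then show "\<forall>\<^sub>F h in at 0. norm ((flat_exp k (0 + h) - flat_exp k 0) / h) \<le> fact (k + 2) * \<bar>h\<bar>"
      by (simp add: eventually_at_filter)
  qed
  then show ?thesis using equal by (simp add: DERIV_def flat_exp_def)
qed

text \<open>This class is closed under differentiation, which gives \<open>smooth_fun\<close> by coinduction. The powers \<open>u\<^sup>-\<^sup>k\<close>
  in \<open>flat_exp\<close> are there for the same reason.\<close>

inductive smooth_gen :: "('a::euclidean_space \<Rightarrow> complex) \<Rightarrow> bool" where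
  const: "smooth_gen (\<lambda>p. c)"
| linear: "bounded_linear L \<Longrightarrow> smooth_gen (\<lambda>p. L p)"
| add: "smooth_gen f \<Longrightarrow> smooth_gen g \<Longrightarrow> smooth_gen (\<lambda>p. f p + g p)"
| mult: "smooth_gen f \<Longrightarrow> smooth_gen g \<Longrightarrow> smooth_gen (\<lambda>p. f p * g p)"
| exp: "smooth_gen f \<Longrightarrow> smooth_gen (\<lambda>p. exp (f p))"
| lin_comp: "smooth_gen f \<Longrightarrow> bounded_linear (T :: complex \<Rightarrow> complex) \<Longrightarrow> smooth_gen (\<lambda>p. T (f p))"
| flat: "smooth_gen f \<Longrightarrow> smooth_gen (\<lambda>p. of_real (flat_exp k (Re (f p))))"

lemma bounded_linear_of_real_Re: "bounded_linear (\<lambda>z. complex_of_real (Re z))"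
  by (intro bounded_linear_compose[OF bounded_linear_of_real bounded_linear_Re])

lemma smooth_gen_derivative:
  "smooth_gen f \<Longrightarrow> \<exists>f'. (\<forall>p. (f has_derivative f' p) (at p)) \<and> (\<forall>v. smooth_gen (\<lambda>p. f' p v))"
proof (induction rule: smooth_gen.induct)
  case (const c)
  show ?case by (rule exI[of _ "\<lambda>p v. 0"]) (auto intro: smooth_gen.const)
next
  case (linear L)
  then show ?case
    by (intro exI[of _ "\<lambda>p. L"]) (auto intro: smooth_gen.const bounded_linear_imp_has_derivative)
next
  case (add f g)
  then obtain f' g' where *: "\<And>p. (f has_derivative f' p) (at p)" "\<And>p. (g has_derivative g' p) (at p)"
    "\<And>v. smooth_gen (\<lambda>p. f' p v)" "\<And>v. smooth_gen (\<lambda>p. g' p v)" by blast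
  show ?case
    by (rule exI[of _ "\<lambda>p v. f' p v + g' p v"]) (auto intro!: * smooth_gen.add has_derivative_add)
next
  case (mult f g)
  then obtain f' g' where *: "\<And>p. (f has_derivative f' p) (at p)" "\<And>p. (g has_derivative g' p) (at p)"
    "\<And>v. smooth_gen (\<lambda>p. f' p v)" "\<And>v. smooth_gen (\<lambda>p. g' p v)" by blast
  show ?case
    by (rule exI[of _ "\<lambda>p v. f p * g' p v + f' p v * g p"])
      (auto intro!: * mult.hyps smooth_gen.add smooth_gen.mult has_derivative_mult)
next
  case (exp f)
  then obtain f' where *: "\<And>p. (f has_derivative f' p) (at p)" "\<And>v. smooth_gen (\<lambda>p. f' p v)" by blast
  have "((\<lambda>p. exp (f p)) has_derivative (\<lambda>v. exp (f p) * f' p v)) (at p)" for p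
    using has_derivative_compose[OF *(1) DERIV_exp[unfolded has_field_derivative_def]] by simp
  then show ?case
    by (intro exI[of _ "\<lambda>p v. exp (f p) * f' p v"]) (auto intro!: * exp.hyps smooth_gen.mult smooth_gen.exp)
next
  \<comment> \<open>\<open>T\<close> is linear over the reals only, which admits complex conjugation
    and the real part.\<close>
  case (lin_comp f T)
  then obtain f' where *: "\<And>p. (f has_derivative f' p) (at p)" "\<And>v. smooth_gen (\<lambda>p. f' p v)" by blast
  show ?case
    by (intro exI[of _ "\<lambda>p v. T (f' p v)"] conjI allI bounded_linear.has_derivative[OF lin_comp.hyps(2) *(1)]
        smooth_gen.lin_comp[OF *(2) lin_comp.hyps(2)])
next
  case (flat f k)
  then obtain f' where *: "\<And>p. (f has_derivative f' p) (at p)" "\<And>v. smooth_gen (\<lambda>p. f' p v)" by blast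
  let ?d = "\<lambda>p. flat_exp (k + 2) (Re (f p)) - k * flat_exp (k + 1) (Re (f p))"
  have "((\<lambda>p. complex_of_real (flat_exp k (Re (f p)))) has_derivative (\<lambda>v. of_real (?d p * Re (f' p v)))) (at p)" for p
    using has_derivative_compose[OF bounded_linear.has_derivative[OF bounded_linear_Re *(1)]
        DERIV_flat_exp[unfolded has_field_derivative_def]]
    by (rule bounded_linear.has_derivative[OF bounded_linear_of_real])
  moreover have "smooth_gen (\<lambda>p. of_real (?d p * Re (f' p v)))" for v
  proof -
    have "smooth_gen (\<lambda>p. (of_real (flat_exp (k + 2) (Re (f p)))
        + - of_nat k * of_real (flat_exp (k + 1) (Re (f p)))) * of_real (Re (f' p v)))"
      by (intro smooth_gen.add smooth_gen.mult smooth_gen.const smooth_gen.flat flat.hyps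
          smooth_gen.lin_comp[OF _ bounded_linear_of_real_Re] *(2))
    then show ?thesis by simp
  qed
  ultimately show ?case by (intro exI[of _ "\<lambda>p v. of_real (?d p * Re (f' p v))"]) auto
qed

lemma smooth_gen_imp_smooth_fun: "smooth_gen f \<Longrightarrow> smooth_fun f"
proof (coinduction arbitrary: f rule: smooth_fun.coinduct)
  case (smooth_fun f)
  then obtain f' where f': "\<And>p. (f has_derivative f' p) (at p)" "\<And>v. smooth_gen (\<lambda>p. f' p v)"
    using smooth_gen_derivative by blast
  then have "frechet_derivative f (at p) = f' p" for p
    by (metis frechet_derivative_at)
  then show ?case using f' by (auto simp: differentiable_def)
qed

lemma smooth_gen_continuous: "smooth_gen f \<Longrightarrow> continuous_on UNIV f"
  using smooth_gen_derivative[of f] has_derivative_continuous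
  by (metis continuous_at_imp_continuous_on)

text \<open>With \<open>w = e\<^sup>2\<^sup>i\<^sup>l\<^sup>s\<close> and a suitable \<open>c\<close> depending on \<open>s\<close> (\<open>rot\<close> and \<open>drift\<close> below), the exponential of the phase is
  an exact solution \<open>W\<close> of \<open>- \<i> dW/ds = LW\<close>, the conjugate equation, so that it is paired with \<open>U s f\<close>
  without conjugation; \<open>w\<close> enters only through the antiholomorphic part because the holomorphic modes
  \<open>A \<cdot> z\<close> are degenerate.\<close>

definition phase :: "real \<Rightarrow> complex ^ 'n \<Rightarrow> complex ^ 'n \<Rightarrow> complex \<Rightarrow> complex \<Rightarrow> 'n::finite hpoint \<Rightarrow> complex" where
  "phase l A B w c p = \<i> * of_real (l * snd p) - of_real (l / 4 * (fst p \<bullet> fst p))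
     + (\<Sum>k\<in>UNIV. A $ k * fst p $ k + w * (B $ k * cnj (fst p $ k))) + c"

text \<open>The factor \<open>exp 1\<close> normalises the value at the origin to 1. As a function
  of \<open>p \<bullet> p\<close> alone, the bump has derivatives along the fields that are
  polynomial multiples of the derivatives of one real profile.\<close>

definition bump :: "real \<Rightarrow> 'a::euclidean_space \<Rightarrow> real" where
  "bump R p = exp 1 * flat_exp 0 (1 - (p \<bullet> p) / R\<^sup>2)"

lemma bump_bounds: "0 \<le> bump R p" "bump R p \<le> exp 1"
  using flat_exp_bounds(1)[of 0] flat_exp_le[of 0] by (auto simp: bump_def)

lemma bump_zero: "R > 0 \<Longrightarrow> norm p \<ge> R \<Longrightarrow> bump R p = 0"
proof -
  assume "R > 0" "norm p \<ge> R"
  then have "R\<^sup>2 \<le> p \<bullet> p" by (simp add: power2_norm_eq_inner[symmetric] power_mono)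
  then show ?thesis using \<open>R > 0\<close> by (simp add: bump_def flat_exp_def)
qed

lemma bump_tendsto: "((\<lambda>R. bump R p) \<longlongrightarrow> 1) at_top"
proof -
  have "((\<lambda>R::real. (p \<bullet> p) / R\<^sup>2) \<longlongrightarrow> 0) at_top"
    by (intro real_tendsto_divide_at_top[OF tendsto_const] filterlim_pow_at_top filterlim_ident) simp
  then have "((\<lambda>R::real. 1 - (p \<bullet> p) / R\<^sup>2) \<longlongrightarrow> 1 - 0) at_top" by (intro tendsto_intros)
  then have "((\<lambda>R. flat_exp 0 (1 - (p \<bullet> p) / R\<^sup>2)) \<longlongrightarrow> flat_exp 0 1) at_top"
    by (intro isCont_tendsto_compose[OF DERIV_isCont[OF DERIV_flat_exp]]) simp
  from tendsto_mult[OF tendsto_const[of "exp 1"] this] show ?thesis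
    by (simp add: bump_def flat_exp_def exp_minus)
qed

section \<open>Smoothness and compact support of the cutoff wave\<close>

lemma inner_self_complex_vec: "complex_of_real (z \<bullet> z) = (\<Sum>k\<in>UNIV. z $ k * cnj (z $ k))" for z :: "complex ^ 'n"
  by (simp add: inner_vec_def complex_mult_cnj inner_complex_def power2_eq_square)

lemma smooth_gen_sum: "finite S \<Longrightarrow> (\<And>k. k \<in> S \<Longrightarrow> smooth_gen (f k)) \<Longrightarrow> smooth_gen (\<lambda>p. \<Sum>k\<in>S. f k p)"
  by (induction S rule: finite_induct) (auto intro: smooth_gen.const smooth_gen.add)

lemma smooth_gen_coord: "smooth_gen (\<lambda>p::'n::finite hpoint. fst p $ k)"
  by (intro smooth_gen.linear bounded_linear_compose[OF bounded_linear_vec_nth bounded_linear_fst])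

lemma smooth_gen_time: "smooth_gen (\<lambda>p::'n::finite hpoint. complex_of_real (snd p))"
  by (intro smooth_gen.linear bounded_linear_compose[OF bounded_linear_of_real bounded_linear_snd])

lemma smooth_gen_cnj: "smooth_gen f \<Longrightarrow> smooth_gen (\<lambda>p. cnj (f p))"
  by (rule smooth_gen.lin_comp[OF _ bounded_linear_cnj])

lemma smooth_gen_inner_fst: "smooth_gen (\<lambda>p::'n::finite hpoint. complex_of_real (fst p \<bullet> fst p))"
  unfolding inner_self_complex_vec
  by (intro smooth_gen_sum smooth_gen.mult smooth_gen_cnj smooth_gen_coord) simp

lemma smooth_gen_phase: "smooth_gen (phase l A B w c)"
proof -
  have "smooth_gen (\<lambda>p. (\<i> * of_real l) * of_real (snd p) + - of_real (l / 4) * of_real (fst p \<bullet> fst p)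
     + (\<Sum>k\<in>UNIV. A $ k * fst p $ k + w * (B $ k * cnj (fst p $ k))) + c)"
    by (intro smooth_gen.add smooth_gen.mult smooth_gen.const smooth_gen_time smooth_gen_inner_fst
        smooth_gen_sum smooth_gen_coord smooth_gen_cnj) simp
  then show ?thesis by (simp add: phase_def[abs_def] mult.assoc)
qed

lemma smooth_gen_bump: "smooth_gen (\<lambda>p::'n::finite hpoint. complex_of_real (bump R p))"
proof -
  have "smooth_gen (\<lambda>p::'n hpoint. complex_of_real (exp 1) * complex_of_real (flat_exp 0 (Re (1 + - of_real (1 / R\<^sup>2) *
       (complex_of_real (fst p \<bullet> fst p) + of_real (snd p) * of_real (snd p))))))"
    by (intro smooth_gen.add smooth_gen.mult smooth_gen.const smooth_gen_time smooth_gen_inner_fst smooth_gen.flat)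
  moreover have "complex_of_real (exp 1) * complex_of_real (flat_exp 0 (Re (1 + - of_real (1 / R\<^sup>2) *
       (complex_of_real (fst p \<bullet> fst p) + of_real (snd p) * of_real (snd p))))) = complex_of_real (bump R p)" for p :: "'n hpoint"
    by (simp add: bump_def inner_prod_def del: of_real_exp flip: of_real_mult of_real_add)
  ultimately show ?thesis by simp
qed

definition wave :: "real \<Rightarrow> complex ^ 'n \<Rightarrow> complex ^ 'n \<Rightarrow> complex \<Rightarrow> complex \<Rightarrow> real \<Rightarrow> 'n::finite hpoint \<Rightarrow> complex" where
  "wave l A B w c R p = exp (phase l A B w c p) * of_real (bump R p)"

lemma smooth_gen_wave: "smooth_gen (wave l A B w c R)"
  unfolding wave_def[abs_def] by (intro smooth_gen.mult smooth_gen.exp smooth_gen_phase smooth_gen_bump)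

lemma sq_int_cutoff:
  fixes \<phi> :: "'a::euclidean_space \<Rightarrow> complex"
  assumes c: "continuous_on UNIV \<phi>" and z: "\<And>p. norm p \<ge> R \<Longrightarrow> \<phi> p = 0"
  shows "sq_int \<phi>"
proof -
  have [measurable]: "\<phi> \<in> borel_measurable borel" using c by (rule borel_measurable_continuous_onI)
  have "compact (\<phi> ` cball 0 R)" using c by (intro compact_continuous_image) (auto intro: continuous_on_subset)
  then have "bounded (\<phi> ` cball 0 R)" by (rule compact_imp_bounded)
  then obtain K where K: "\<forall>x\<in>\<phi> ` cball 0 R. norm x \<le> K" unfolding bounded_iff ..
  have "integrable lborel (\<lambda>x. K\<^sup>2 * indicator (cball 0 R) x :: real)"
    by (intro integrable_mult_right integrable_real_indicator) (use emeasure_bounded_finite[OF bounded_cball[of 0 R]] in auto)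
  then have "integrable lborel (\<lambda>x. (cmod (\<phi> x))\<^sup>2)"
  proof (rule Bochner_Integration.integrable_bound)
    show "AE x in lborel. norm ((cmod (\<phi> x))\<^sup>2) \<le> norm (K\<^sup>2 * indicator (cball 0 R) x :: real)"
    proof (rule AE_I2)
      fix x :: 'a
      show "norm ((cmod (\<phi> x))\<^sup>2) \<le> norm (K\<^sup>2 * indicator (cball 0 R) x :: real)"
        using K z[of x] by (cases "norm x \<le> R") (auto intro!: power_mono)
    qed
  qed measurable
  then show ?thesis by (simp add: sq_int_def)
qed

lemma test_fun_cutoff:
  assumes "smooth_gen \<phi>" "\<And>p. norm p \<ge> R \<Longrightarrow> \<phi> p = 0"
  shows "test_fun \<phi>"
proof -
  have "closure {p. \<phi> p \<noteq> 0} \<subseteq> cball 0 R"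
    by (rule closure_minimal) (use assms(2) in \<open>force simp: not_le\<close>)+
  then have "bounded (closure {p. \<phi> p \<noteq> 0})" by (rule bounded_subset[OF bounded_cball])
  then show ?thesis using smooth_gen_imp_smooth_fun[OF assms(1)]
    by (simp add: test_fun_def compact_eq_bounded_closed)
qed

section \<open>Derivatives along the left-invariant fields\<close>

abbreviation has_along :: "('n::finite hpoint \<Rightarrow> 'n hpoint) \<Rightarrow> ('n hpoint \<Rightarrow> 'b::real_normed_vector) \<Rightarrow> 'n hpoint \<Rightarrow> 'b \<Rightarrow> bool" where
  "has_along V \<phi> p d \<equiv> ((\<lambda>h::real. \<phi> (p + h *\<^sub>R V p)) has_vector_derivative d) (at 0)"

text \<open>\<open>along\<close> picks some value even where no derivative exists; computing with
  \<open>has_along\<close> and converting only here keeps existence and value together.\<close>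

lemma along_eq: "has_along V \<phi> p d \<Longrightarrow> along V \<phi> p = d"
  by (simp add: along_def vector_derivative_at)

lemma has_along_if_has_derivative:
  assumes "(\<phi> has_derivative \<phi>') (at p)"
  shows "has_along V \<phi> p (\<phi>' (V p))"
proof -
  have "((\<lambda>h::real. p + h *\<^sub>R V p) has_derivative (\<lambda>h. h *\<^sub>R V p)) (at 0)"
    by (auto intro!: derivative_eq_intros)
  then have "((\<lambda>h. \<phi> (p + h *\<^sub>R V p)) has_derivative (\<lambda>h. \<phi>' (h *\<^sub>R V p))) (at 0)"
    using assms by (intro has_derivative_compose[of "\<lambda>h. p + h *\<^sub>R V p" _ 0 UNIV \<phi> \<phi>']) auto
  moreover have "\<phi>' (h *\<^sub>R V p) = h *\<^sub>R \<phi>' (V p)" for h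
    using has_derivative_bounded_linear[OF assms] by (simp add: linear_simps)
  ultimately show ?thesis by (simp add: has_vector_derivative_def)
qed

lemma has_along_exp:
  "has_along V E p (a :: complex) \<Longrightarrow> has_along V (\<lambda>p. exp (E p)) p (exp (E p) * a)"
  using field_vector_diff_chain_at[of "\<lambda>h::real. E (p + h *\<^sub>R V p)" a 0 exp "exp (E p)"]
  by (simp add: o_def DERIV_exp mult.commute)

lemma has_along_of_real:
  assumes "has_along V N p n" "(g has_real_derivative g') (at (N p))"
  shows "has_along V (\<lambda>p. complex_of_real (g (N p))) p (of_real (g' * n))"
proof -
  have "((\<lambda>h. N (p + h *\<^sub>R V p)) has_real_derivative n) (at 0)"
    using assms(1) by (simp add: has_real_derivative_iff_has_vector_derivative)
  then have "((\<lambda>h. g (N (p + h *\<^sub>R V p))) has_real_derivative g' * n) (at 0)"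
    using assms(2) by (intro DERIV_chain2[of g _ "\<lambda>h. N (p + h *\<^sub>R V p)"]) simp_all
  then show ?thesis by (rule has_vector_derivative_of_real)
qed

text \<open>Pulling out \<open>exp (E p)\<close> splits the second derivative into a bulk term with
  \<open>g\<close>, which yields the symbol, and terms with \<open>g1\<close> or \<open>g2\<close>,
  which are collected in the remainder. \<open>E\<close> and \<open>N\<close> are differentiated at
  every point because the outer derivative acts on the inner one as a function.\<close>

lemma along_along_exp_cutoff:
  fixes E a :: "'n::finite hpoint \<Rightarrow> complex" and N n :: "'n hpoint \<Rightarrow> real"
  assumes E: "\<And>p. has_along V E p (a p)" and a: "has_along V a p a'"
    and N: "\<And>p. has_along V N p (n p)" and n: "has_along V n p n'"
    and g: "\<And>x. (g has_real_derivative g1 x) (at x)" "\<And>x. (g1 has_real_derivative g2 x) (at x)"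
  shows "along V (along V (\<lambda>p. exp (E p) * of_real (g (N p)))) p
    = exp (E p) * (((a p)\<^sup>2 + a') * of_real (g (N p)) + of_real (2 * g1 (N p) * n p) * a p
        + of_real (g2 (N p) * (n p)\<^sup>2 + g1 (N p) * n'))"
proof -
  have hE: "has_along V (\<lambda>p. exp (E p)) q (exp (E q) * a q)" for q
    by (rule has_along_exp[where V=V and E=E and p=q and a="a q", OF E])
  have hg: "has_along V (\<lambda>p. complex_of_real (\<gamma> (N p))) q (of_real (\<gamma>' * n q))"
    if "(\<gamma> has_real_derivative \<gamma>') (at (N q))" for \<gamma> \<gamma>' q
    by (rule has_along_of_real[where V=V and N=N and p=q and n="n q" and g=\<gamma> and g'=\<gamma>', OF N that])
  have "has_along V (\<lambda>p. exp (E p) * of_real (g (N p))) q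
     (exp (E q) * (a q * of_real (g (N q)) + of_real (g1 (N q)) * of_real (n q)))" for q
    using has_vector_derivative_mult[OF hE[of q] hg[OF g(1), of q]]
    by (simp add: algebra_simps)
  then have 1: "along V (\<lambda>p. exp (E p) * of_real (g (N p)))
     = (\<lambda>q. exp (E q) * (a q * of_real (g (N q)) + of_real (g1 (N q)) * of_real (n q)))"
    by (intro ext along_eq)
  have n': "has_along V (\<lambda>p. complex_of_real (n p)) p (of_real n')"
    using has_along_of_real[where V=V and N=n and p=p and n=n' and g="\<lambda>x. x" and g'=1, OF n] by simp
  have "has_along V (\<lambda>q. exp (E q) * (a q * of_real (g (N q)) + of_real (g1 (N q)) * of_real (n q))) p
     (exp (E p) * (((a p)\<^sup>2 + a') * of_real (g (N p)) + of_real (2 * g1 (N p) * n p) * a p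
        + of_real (g2 (N p) * (n p)\<^sup>2 + g1 (N p) * n')))"
    using has_vector_derivative_mult[OF hE[of p]
      has_vector_derivative_add[OF has_vector_derivative_mult[OF a hg[OF g(1), of p]]
        has_vector_derivative_mult[OF hg[OF g(2), of p] n']]]
    by (simp add: algebra_simps power2_eq_square)
  then show ?thesis unfolding 1 by (rule along_eq)
qed

lemma phase_has_derivative:
  "(phase l A B w c has_derivative (\<lambda>v. \<i> * of_real (l * snd v) - of_real (l / 2 * (fst p \<bullet> fst v))
     + (\<Sum>k\<in>UNIV. A $ k * fst v $ k + w * (B $ k * cnj (fst v $ k))))) (at p)"
  unfolding phase_def[abs_def]
  by (auto intro!: derivative_eq_intros ext bounded_linear.has_derivative[OF bounded_linear_vec_nth]
     bounded_linear.has_derivative[OF bounded_linear_of_real] bounded_linear.has_derivative[OF bounded_linear_cnj]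
     simp: inner_commute algebra_simps)

text \<open>The derivative of the phase along \<open>fieldX j\<close>. The character in
  \<open>t\<close> contributes \<open>\<i> * l * y / 2\<close> and the Gaussian
  \<open>- l * x / 2\<close>; thanks to the coefficient \<open>l / 4\<close> in the phase they
  combine into the conjugate coordinate alone.\<close>

definition slopeX :: "real \<Rightarrow> complex ^ 'n \<Rightarrow> complex ^ 'n \<Rightarrow> complex \<Rightarrow> 'n \<Rightarrow> 'n::finite hpoint \<Rightarrow> complex" where
  "slopeX l A B w j p = - complex_of_real (l / 2) * cnj (fst p $ j) + (A $ j + w * B $ j)"

definition slopeY :: "real \<Rightarrow> complex ^ 'n \<Rightarrow> complex ^ 'n \<Rightarrow> complex \<Rightarrow> 'n \<Rightarrow> 'n::finite hpoint \<Rightarrow> complex" where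
  "slopeY l A B w j p = - complex_of_real (l / 2) * \<i> * cnj (fst p $ j) + \<i> * (A $ j - w * B $ j)"

text \<open>The derivative of \<open>p \<bullet> p\<close> along \<open>fieldX j\<close>; the term
  with \<open>snd p\<close> comes from the vertical component of the field.\<close>

definition gradX :: "'n \<Rightarrow> 'n::finite hpoint \<Rightarrow> real" where
  "gradX j p = 2 * Re (fst p $ j) + snd p * Im (fst p $ j)"

definition gradY :: "'n \<Rightarrow> 'n::finite hpoint \<Rightarrow> real" where
  "gradY j p = 2 * Im (fst p $ j) - snd p * Re (fst p $ j)"

lemma phase_along:
  "has_along (fieldX j) (phase l A B w c) p (slopeX l A B w j p)"
  "has_along (fieldY j) (phase l A B w c) p (slopeY l A B w j p)"
proof -
  let ?D = "\<lambda>v. \<i> * of_real (l * snd v) - of_real (l / 2 * (fst p \<bullet> fst v))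
     + (\<Sum>k\<in>UNIV. A $ k * fst v $ k + w * (B $ k * cnj (fst v $ k)))"
  have sum: "(\<Sum>k\<in>UNIV. A $ k * axis j d $ k + w * (B $ k * cnj (axis j d $ k))) = A $ j * d + w * (B $ j * cnj d)" for d
  proof -
    have "(\<Sum>k\<in>UNIV. A $ k * axis j d $ k + w * (B $ k * cnj (axis j d $ k)))
      = (\<Sum>k\<in>UNIV. if k = j then A $ j * d + w * (B $ j * cnj d) else 0)"
      by (intro sum.cong) (auto simp: axis_def)
    then show ?thesis by simp
  qed
  have X: "?D (fieldX j p) = slopeX l A B w j p"
    unfolding fieldX_def fst_conv snd_conv sum inner_axis
    by (simp add: complex_eq_iff inner_complex_def slopeX_def)
  have Y: "?D (fieldY j p) = slopeY l A B w j p"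
    unfolding fieldY_def fst_conv snd_conv sum inner_axis
    by (simp add: complex_eq_iff inner_complex_def algebra_simps slopeY_def)
  show "has_along (fieldX j) (phase l A B w c) p (slopeX l A B w j p)"
    using has_along_if_has_derivative[OF phase_has_derivative[of l A B w c p], where V="fieldX j"] unfolding X .
  show "has_along (fieldY j) (phase l A B w c) p (slopeY l A B w j p)"
    using has_along_if_has_derivative[OF phase_has_derivative[of l A B w c p], where V="fieldY j"] unfolding Y .
qed

lemma slope_along:
  "has_along (fieldX j) (slopeX l A B w j) p (- of_real (l / 2))"
  "has_along (fieldY j) (slopeY l A B w j) p (- of_real (l / 2))"
proof -
  have *: "((\<lambda>p::'a::finite hpoint. e * cnj (fst p $ j) + d) has_derivative (\<lambda>v. e * cnj (fst v $ j))) (at p)" for e d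
    by (auto intro!: derivative_eq_intros bounded_linear.has_derivative[OF bounded_linear_vec_nth]
       bounded_linear.has_derivative[OF bounded_linear_cnj])
  show "has_along (fieldX j) (slopeX l A B w j) p (- of_real (l / 2))"
    using has_along_if_has_derivative[OF *[of "- of_real (l / 2)" "A $ j + w * B $ j"], where V="fieldX j"] by (simp add: fieldX_def slopeX_def)
  show "has_along (fieldY j) (slopeY l A B w j) p (- of_real (l / 2))"
    using has_along_if_has_derivative[OF *[of "- of_real (l / 2) * \<i>" "\<i> * (A $ j - w * B $ j)"], where V="fieldY j"] by (simp add: fieldY_def slopeY_def mult.assoc)
qed

lemma inner_self_along:
  fixes p :: "'n::finite hpoint"
  shows "has_along (fieldX j) (\<lambda>p. p \<bullet> p) p (gradX j p)"
    "has_along (fieldY j) (\<lambda>p. p \<bullet> p) p (gradY j p)"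
    "has_along (fieldX j) (gradX j) p (2 + (Im (fst p $ j))\<^sup>2 / 2)"
    "has_along (fieldY j) (gradY j) p (2 + (Re (fst p $ j))\<^sup>2 / 2)"
proof -
  have 1: "((\<lambda>p::'n hpoint. p \<bullet> p) has_derivative (\<lambda>v. 2 * (p \<bullet> v))) (at p)"
    by (auto intro!: derivative_eq_intros simp: inner_commute)
  have 2: "(gradX j has_derivative
    (\<lambda>v. 2 * Re (fst v $ j) + (snd p * Im (fst v $ j) + snd v * Im (fst p $ j)))) (at p)"
    unfolding gradX_def[abs_def] gradY_def[abs_def]
    by (intro derivative_intros bounded_linear.has_derivative[OF bounded_linear_vec_nth])
  have 3: "(gradY j has_derivative
    (\<lambda>v. 2 * Im (fst v $ j) - (snd p * Re (fst v $ j) + snd v * Re (fst p $ j)))) (at p)"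
    unfolding gradX_def[abs_def] gradY_def[abs_def]
    by (intro derivative_intros bounded_linear.has_derivative[OF bounded_linear_vec_nth])
  show "has_along (fieldX j) (\<lambda>p. p \<bullet> p) p (gradX j p)"
    using has_along_if_has_derivative[OF 1, where V="fieldX j"]
    by (simp add: fieldX_def inner_prod_def inner_axis inner_complex_def gradX_def gradY_def)
  show "has_along (fieldY j) (\<lambda>p. p \<bullet> p) p (gradY j p)"
    using has_along_if_has_derivative[OF 1, where V="fieldY j"]
    by (simp add: fieldY_def inner_prod_def inner_axis inner_complex_def gradX_def gradY_def)
  show "has_along (fieldX j) (gradX j) p (2 + (Im (fst p $ j))\<^sup>2 / 2)"
    using has_along_if_has_derivative[OF 2, where V="fieldX j"] by (simp add: fieldX_def gradX_def power2_eq_square)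
  show "has_along (fieldY j) (gradY j) p (2 + (Re (fst p $ j))\<^sup>2 / 2)"
    using has_along_if_has_derivative[OF 3, where V="fieldY j"] by (simp add: fieldY_def gradY_def power2_eq_square)
qed

text \<open>\<open>bump1\<close> and \<open>bump2\<close> are the first and second derivatives of
  the profile \<open>\<lambda>x. exp 1 * flat_exp 0 (1 - x / R\<^sup>2)\<close>, taken at
  \<open>x = p \<bullet> p\<close>.\<close>

definition bump1 :: "real \<Rightarrow> 'a::euclidean_space \<Rightarrow> real" where
  "bump1 R p = - (exp 1 * flat_exp 2 (1 - (p \<bullet> p) / R\<^sup>2) / R\<^sup>2)"

definition bump2 :: "real \<Rightarrow> 'a::euclidean_space \<Rightarrow> real" where
  "bump2 R p = exp 1 * (flat_exp 4 (1 - (p \<bullet> p) / R\<^sup>2) - 2 * flat_exp 3 (1 - (p \<bullet> p) / R\<^sup>2)) / R\<^sup>2 / R\<^sup>2"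

text \<open>The terms of the sum of squares in which at least one derivative falls on the cutoff,
  with the exponential of the phase divided out.\<close>

definition remainder :: "real \<Rightarrow> complex ^ 'n \<Rightarrow> complex ^ 'n \<Rightarrow> complex \<Rightarrow> real \<Rightarrow> 'n::finite hpoint \<Rightarrow> complex" where
  "remainder l A B w R p = (\<Sum>j\<in>UNIV.
     complex_of_real (2 * bump1 R p * gradX j p) * slopeX l A B w j p
   + complex_of_real (2 * bump1 R p * gradY j p) * slopeY l A B w j p
   + complex_of_real (bump2 R p * ((gradX j p)\<^sup>2 + (gradY j p)\<^sup>2)
       + bump1 R p * (4 + ((Re (fst p $ j))\<^sup>2 + (Im (fst p $ j))\<^sup>2) / 2)))"

text \<open>The factor by which the sub-Laplacian multiplies the exponential of the phase when there
  is no cutoff.\<close>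

definition symbol :: "real \<Rightarrow> complex ^ 'n \<Rightarrow> complex ^ 'n \<Rightarrow> complex \<Rightarrow> 'n::finite hpoint \<Rightarrow> complex" where
  "symbol l A B w p = (\<Sum>j\<in>UNIV. of_real l - 2 * w * B $ j * (2 * A $ j - of_real l * cnj (fst p $ j)))"

text \<open>The pairing conjugates its second argument, so the test function is the conjugate of the
  wave and the wave itself meets \<open>U s f\<close>. The fields are real, so conjugation passes
  through them.\<close>

lemma sublaplacian_wave_cnj:
  "sublaplacian (\<lambda>p. cnj (wave l A B w c R p)) p
    = cnj (exp (phase l A B w c p) * (symbol l A B w p * of_real (bump R p) - remainder l A B w R p))"
proof -
  let ?E = "phase l A B w c"
  let ?aX = "slopeX l A B w"
  let ?aY = "slopeY l A B w"
  let ?nX = "gradX"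
  let ?nY = "gradY"
  let ?g = "\<lambda>x. exp 1 * flat_exp 0 (1 - x / R\<^sup>2)"
  let ?g1 = "\<lambda>x. - (exp 1 * flat_exp 2 (1 - x / R\<^sup>2) / R\<^sup>2)"
  let ?g2 = "\<lambda>x. exp 1 * (flat_exp 4 (1 - x / R\<^sup>2) - 2 * flat_exp 3 (1 - x / R\<^sup>2)) / R\<^sup>2 / R\<^sup>2"
  have fe: "((\<lambda>x. flat_exp k (1 - x / R\<^sup>2)) has_real_derivative
      (flat_exp (k + 2) (1 - x / R\<^sup>2) - k * flat_exp (k + 1) (1 - x / R\<^sup>2)) * (- 1 / R\<^sup>2)) (at x)" for k x
    using DERIV_chain2[OF DERIV_flat_exp DERIV_diff[OF DERIV_const DERIV_cdivide[OF DERIV_ident]], of k 1 "R\<^sup>2" x UNIV]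
    by simp
  have g1: "(?g has_real_derivative ?g1 x) (at x)" for x
    using DERIV_cmult[OF fe[of 0 x], of "exp 1"] by (simp add: algebra_simps numeral_2_eq_2)
  have g2: "(?g1 has_real_derivative ?g2 x) (at x)" for x
  proof -
    have "((\<lambda>x. - (exp 1 / R\<^sup>2) * flat_exp 2 (1 - x / R\<^sup>2)) has_real_derivative
      - (exp 1 / R\<^sup>2) * ((flat_exp (2 + 2) (1 - x / R\<^sup>2) - real 2 * flat_exp (2 + 1) (1 - x / R\<^sup>2)) * (- 1 / R\<^sup>2))) (at x)"
      by (rule DERIV_cmult[OF fe[of 2 x]])
    moreover have "2 + 2 = (4::nat)" "2 + 1 = (3::nat)" by simp_all
    ultimately show ?thesis by (simp only: of_nat_numeral) (simp add: algebra_simps diff_divide_distrib)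
  qed
  have W: "(\<lambda>p. cnj (wave l A B w c R p)) = (\<lambda>p. exp (cnj (?E p)) * of_real (?g (p \<bullet> p)))"
    by (simp add: wave_def exp_cnj bump_def)
  have X: "along (fieldX j) (along (fieldX j) (\<lambda>p. cnj (wave l A B w c R p))) p
     = exp (cnj (?E p)) * (((cnj (?aX j p))\<^sup>2 + cnj (- of_real (l / 2))) * of_real (?g (p \<bullet> p))
       + of_real (2 * ?g1 (p \<bullet> p) * ?nX j p) * cnj (?aX j p)
       + of_real (?g2 (p \<bullet> p) * (?nX j p)\<^sup>2 + ?g1 (p \<bullet> p) * (2 + (Im (fst p $ j))\<^sup>2 / 2)))" for j
    unfolding W
    by (rule along_along_exp_cutoff[where a="\<lambda>p. cnj (?aX j p)" and n="?nX j", OF _ _ _ _ g1 g2])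
      (intro has_vector_derivative_cnj phase_along slope_along inner_self_along)+
  have Y: "along (fieldY j) (along (fieldY j) (\<lambda>p. cnj (wave l A B w c R p))) p
     = exp (cnj (?E p)) * (((cnj (?aY j p))\<^sup>2 + cnj (- of_real (l / 2))) * of_real (?g (p \<bullet> p))
       + of_real (2 * ?g1 (p \<bullet> p) * ?nY j p) * cnj (?aY j p)
       + of_real (?g2 (p \<bullet> p) * (?nY j p)\<^sup>2 + ?g1 (p \<bullet> p) * (2 + (Re (fst p $ j))\<^sup>2 / 2)))" for j
    unfolding W
    by (rule along_along_exp_cutoff[where a="\<lambda>p. cnj (?aY j p)" and n="?nY j", OF _ _ _ _ g1 g2])
      (intro has_vector_derivative_cnj phase_along slope_along inner_self_along)+
  have XY: "along (fieldX j) (along (fieldX j) (\<lambda>p. cnj (wave l A B w c R p))) p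
     + along (fieldY j) (along (fieldY j) (\<lambda>p. cnj (wave l A B w c R p))) p
     = cnj (exp (?E p) * (
          (of_real (2 * bump1 R p * ?nX j p) * ?aX j p + of_real (2 * bump1 R p * ?nY j p) * ?aY j p
            + of_real (bump2 R p * ((?nX j p)\<^sup>2 + (?nY j p)\<^sup>2) + bump1 R p * (4 + ((Re (fst p $ j))\<^sup>2 + (Im (fst p $ j))\<^sup>2) / 2)))
          - (of_real l - 2 * w * B $ j * (2 * A $ j - of_real l * cnj (fst p $ j))) * of_real (bump R p)))" for j
  proof -
    \<comment> \<open>With \<open>h = A - l / 2 * cnj z\<close> the slopes are
      \<open>h + w * B\<close> and \<open>\<i> * (h - w * B)\<close>, so the squares cancel and only
      the cross term \<open>4 * h * w * B\<close> survives. This is why the symbol is affine in the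
      conjugate coordinate.\<close>
    have sq: "(?aX j p)\<^sup>2 + (?aY j p)\<^sup>2 - of_real l = - (of_real l - 2 * w * B $ j * (2 * A $ j - of_real l * cnj (fst p $ j)))"
    proof -
      define z where "z = cnj (fst p $ j)"
      show ?thesis unfolding slopeX_def slopeY_def z_def[symmetric]
        by (simp add: power2_eq_square algebra_simps)
    qed
    have sum: "exp e * ((x\<^sup>2 + m) * g + u + r) + exp e * ((y\<^sup>2 + m) * g + v + s)
      = exp e * ((u + v + (r + s)) + (x\<^sup>2 + y\<^sup>2 + 2 * m) * g)" for e x y m g u v r s :: complex
      by (simp add: algebra_simps)
    have g': "?g (p \<bullet> p) = bump R p" "?g1 (p \<bullet> p) = bump1 R p" "?g2 (p \<bullet> p) = bump2 R p"
      by (simp_all add: bump_def bump1_def bump2_def)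
    have rs: "complex_of_real (bump2 R p * (?nX j p)\<^sup>2 + bump1 R p * (2 + (Im (fst p $ j))\<^sup>2 / 2))
        + of_real (bump2 R p * (?nY j p)\<^sup>2 + bump1 R p * (2 + (Re (fst p $ j))\<^sup>2 / 2))
      = of_real (bump2 R p * ((?nX j p)\<^sup>2 + (?nY j p)\<^sup>2) + bump1 R p * (4 + ((Re (fst p $ j))\<^sup>2 + (Im (fst p $ j))\<^sup>2) / 2))"
      unfolding of_real_add[symmetric] of_real_eq_iff by (simp add: algebra_simps add_divide_distrib)
    have m: "2 * cnj (- complex_of_real (l / 2)) = - of_real l" by simp
    have cs: "(cnj (?aX j p))\<^sup>2 + (cnj (?aY j p))\<^sup>2 + - complex_of_real l = cnj ((?aX j p)\<^sup>2 + (?aY j p)\<^sup>2 - of_real l)"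
      by (simp only: complex_cnj_add complex_cnj_diff complex_cnj_power complex_cnj_complex_of_real diff_conv_add_uminus complex_cnj_minus)
    show ?thesis
      unfolding X Y sum m cs sq g' rs by (simp add: exp_cnj minus_mult_left del: mult_minus_left)
  qed
  have "- (\<Sum>j\<in>UNIV. cnj (e * (r j - s j * g))) = cnj (e * ((\<Sum>j\<in>UNIV. s j) * g - (\<Sum>j\<in>UNIV. r j)))"
    for e g :: complex and r s :: "'a \<Rightarrow> complex"
    by (simp add: sum_subtractf sum_distrib_left sum_distrib_right right_diff_distrib)
  then show ?thesis
    unfolding sublaplacian_def XY symbol_def remainder_def .
qed

section \<open>Pairings with the Schroedinger group\<close>

lemma borel_measurable_cnj_comp [measurable]:
  "f \<in> borel_measurable M \<Longrightarrow> (\<lambda>x. cnj (f x)) \<in> borel_measurable M"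
  by (rule borel_measurable_continuous_on[of cnj]) (intro continuous_intros)

lemma sq_int_measurable [measurable_dest]: "sq_int g \<Longrightarrow> g \<in> borel_measurable borel"
  by (simp add: sq_int_def)

lemma sq_int_integrable: "sq_int g \<Longrightarrow> integrable lborel (\<lambda>x. (cmod (g x))\<^sup>2)"
  by (simp add: sq_int_def)

lemma sq_int_lincomb:
  fixes g h :: "'a::euclidean_space \<Rightarrow> complex"
  assumes g: "sq_int g" and h: "sq_int h"
  shows "sq_int (\<lambda>x. c * g x + h x)"
proof -
  note [measurable] = sq_int_measurable[OF g] sq_int_measurable[OF h]
  have "integrable lborel (\<lambda>x. 2 * (cmod c)\<^sup>2 * (cmod (g x))\<^sup>2 + 2 * (cmod (h x))\<^sup>2)"
    using g h by (intro Bochner_Integration.integrable_add integrable_mult_right sq_int_integrable)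
  then have "integrable lborel (\<lambda>x. (cmod (c * g x + h x))\<^sup>2)"
  proof (rule Bochner_Integration.integrable_bound)
    show "AE x in lborel. norm ((cmod (c * g x + h x))\<^sup>2) \<le> norm (2 * (cmod c)\<^sup>2 * (cmod (g x))\<^sup>2 + 2 * (cmod (h x))\<^sup>2)"
    proof (rule AE_I2)
      fix x
      have "(cmod (c * g x + h x))\<^sup>2 \<le> (cmod c * cmod (g x) + cmod (h x))\<^sup>2"
        by (intro power_mono order_trans[OF norm_triangle_ineq]) (auto simp: norm_mult)
      also have "\<dots> \<le> 2 * (cmod c * cmod (g x))\<^sup>2 + 2 * (cmod (h x))\<^sup>2"
        using zero_le_power2[of "cmod c * cmod (g x) - cmod (h x)"] by (simp add: power2_eq_square algebra_simps)
      finally show "norm ((cmod (c * g x + h x))\<^sup>2) \<le> norm (2 * (cmod c)\<^sup>2 * (cmod (g x))\<^sup>2 + 2 * (cmod (h x))\<^sup>2)"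
        by (simp add: power_mult_distrib)
    qed
  qed measurable
  then show ?thesis by (simp add: sq_int_def)
qed

lemma sq_int_zero: "sq_int (\<lambda>x. 0)"
  by (simp add: sq_int_def)

lemma sq_int_cmult: "sq_int g \<Longrightarrow> sq_int (\<lambda>x. c * g x)"
  using sq_int_lincomb[OF _ sq_int_zero, of g c] by simp

lemma sq_int_add: "sq_int g \<Longrightarrow> sq_int h \<Longrightarrow> sq_int (\<lambda>x. g x + h x)"
  using sq_int_lincomb[of g h 1] by simp

lemma sq_int_diff: "sq_int g \<Longrightarrow> sq_int h \<Longrightarrow> sq_int (\<lambda>x. g x - h x)"
  using sq_int_lincomb[of h g "-1"] by simp

lemma sq_int_divide: "sq_int g \<Longrightarrow> sq_int (\<lambda>x. g x / c)"
  using sq_int_cmult[of g "1 / c"] by simp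

lemmas sq_int_intros = sq_int_cmult sq_int_add sq_int_diff sq_int_divide

lemma sq_int_integrable_norm_mult:
  fixes g h :: "'a::euclidean_space \<Rightarrow> complex"
  assumes g: "sq_int g" and h: "sq_int h"
  shows "integrable lborel (\<lambda>x. cmod (g x) * cmod (h x))"
proof -
  note [measurable] = sq_int_measurable[OF g] sq_int_measurable[OF h]
  have "integrable lborel (\<lambda>x. (cmod (g x))\<^sup>2 + (cmod (h x))\<^sup>2)"
    using g h by (intro Bochner_Integration.integrable_add sq_int_integrable)
  then show ?thesis
  proof (rule Bochner_Integration.integrable_bound)
    show "AE x in lborel. norm (cmod (g x) * cmod (h x)) \<le> norm ((cmod (g x))\<^sup>2 + (cmod (h x))\<^sup>2)"
    proof (rule AE_I2)
      fix x
      have "2 * (cmod (g x) * cmod (h x)) \<le> (cmod (g x))\<^sup>2 + (cmod (h x))\<^sup>2"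
        using zero_le_power2[of "cmod (g x) - cmod (h x)"] by (simp add: power2_eq_square algebra_simps)
      moreover have "0 \<le> cmod (g x) * cmod (h x)" by simp
      ultimately have "cmod (g x) * cmod (h x) \<le> (cmod (g x))\<^sup>2 + (cmod (h x))\<^sup>2" by linarith
      then show "norm (cmod (g x) * cmod (h x)) \<le> norm ((cmod (g x))\<^sup>2 + (cmod (h x))\<^sup>2)" by simp
    qed
  qed measurable
qed

lemma sq_int_integrable_pairing:
  fixes g h :: "'a::euclidean_space \<Rightarrow> complex"
  assumes g: "sq_int g" and h: "sq_int h"
  shows "integrable lborel (\<lambda>x. g x * cnj (h x))"
proof -
  note [measurable] = sq_int_measurable[OF g] sq_int_measurable[OF h]
  show ?thesis
    by (rule Bochner_Integration.integrable_bound[OF sq_int_integrable_norm_mult[OF g h]])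
      (auto simp: norm_mult)
qed

lemma L2norm_nonneg: "0 \<le> L2norm g" by (simp add: L2norm_def)

lemma L2norm_power2: "(L2norm g)\<^sup>2 = (\<integral>x. (cmod (g x))\<^sup>2 \<partial>lborel)"
  by (simp add: L2norm_def)

text \<open>The integral of \<open>(|g| - t * |h|)^2\<close> is a nonnegative quadratic polynomial
  in \<open>t\<close>, and its minimum gives the bound. If \<open>h\<close> has norm 0 the
  polynomial is linear in \<open>t\<close>, so the mixed term must vanish.\<close>

lemma L2_Cauchy_Schwarz:
  fixes g h :: "'a::euclidean_space \<Rightarrow> complex"
  assumes g: "sq_int g" and h: "sq_int h"
  shows "cmod (\<integral>x. g x * cnj (h x) \<partial>lborel) \<le> L2norm g * L2norm h"
proof -
  define b where "b = (\<integral>x. cmod (g x) * cmod (h x) \<partial>lborel)"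
  note int = sq_int_integrable_norm_mult[OF g h] sq_int_integrable[OF g] sq_int_integrable[OF h]
  have q: "0 \<le> (L2norm g)\<^sup>2 - 2 * t * b + t\<^sup>2 * (L2norm h)\<^sup>2" for t
  proof -
    have "0 \<le> (\<integral>x. (cmod (g x) - t * cmod (h x))\<^sup>2 \<partial>lborel)" by simp
    also have "\<dots> = (\<integral>x. (cmod (g x))\<^sup>2 - 2 * t * (cmod (g x) * cmod (h x)) + t\<^sup>2 * (cmod (h x))\<^sup>2 \<partial>lborel)"
      by (intro Bochner_Integration.integral_cong refl) (simp add: power2_eq_square algebra_simps)
    also have "\<dots> = (L2norm g)\<^sup>2 - 2 * t * b + t\<^sup>2 * (L2norm h)\<^sup>2"
      using int by (simp add: b_def L2norm_power2)
    finally show ?thesis .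
  qed
  have b0: "b \<ge> 0" unfolding b_def by simp
  have "b\<^sup>2 \<le> (L2norm g)\<^sup>2 * (L2norm h)\<^sup>2"
  proof (cases "L2norm h = 0")
    case True
    have "b = 0"
    proof (rule ccontr)
      assume "b \<noteq> 0"
      then show False using q[of "((L2norm g)\<^sup>2 + 1) / b"] True by simp (use zero_le_power2[of "L2norm g"] in linarith)
    qed
    then show ?thesis by simp
  next
    case False
    then have "L2norm h > 0" using L2norm_nonneg[of h] by linarith
    then show ?thesis using q[of "b / (L2norm h)\<^sup>2"]
      by (auto simp: field_simps power2_eq_square zero_le_divide_iff mult_le_0_iff)
  qed
  then have "b \<le> L2norm g * L2norm h"
    using b0 L2norm_nonneg by (metis abs_le_square_iff abs_of_nonneg mult_nonneg_nonneg power_mult_distrib)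
  moreover have "cmod (\<integral>x. g x * cnj (h x) \<partial>lborel) \<le> b"
    unfolding b_def using integral_norm_bound[of lborel "\<lambda>x. g x * cnj (h x)"] by (simp add: norm_mult)
  ultimately show ?thesis by linarith
qed

lemma L2norm_lincomb:
  fixes g h :: "'a::euclidean_space \<Rightarrow> complex"
  assumes g: "sq_int g" and h: "sq_int h"
  shows "(L2norm (\<lambda>x. c * g x + h x))\<^sup>2 = (cmod c)\<^sup>2 * (L2norm g)\<^sup>2 + (L2norm h)\<^sup>2
     + 2 * Re (c * (\<integral>x. g x * cnj (h x) \<partial>lborel))"
proof -
  define k where "k = (\<lambda>x. g x * cnj (h x))"
  note int = sq_int_integrable[OF g] sq_int_integrable[OF h]
  have k: "integrable lborel k" unfolding k_def by (rule sq_int_integrable_pairing[OF g h])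
  have sq: "(cmod (c * g x + h x))\<^sup>2 = (cmod c)\<^sup>2 * (cmod (g x))\<^sup>2 + (cmod (h x))\<^sup>2 + 2 * Re (c * k x)" for x
    unfolding cmod_power2 k_def by (simp add: power2_eq_square algebra_simps)
  have "integrable lborel (\<lambda>x. Re (c * k x))" using k by (intro integrable_Re integrable_mult_right)
  moreover have "(\<integral>x. Re (c * k x) \<partial>lborel) = Re (c * (\<integral>x. k x \<partial>lborel))"
    using k by (subst integral_Re) (simp_all del: times_complex.sel)
  ultimately show ?thesis
    unfolding L2norm_power2 sq k_def[symmetric] using int by (simp del: times_complex.sel)
qed

lemma L2norm_cong_AE:
  assumes "AE x in lborel. g x = h x" "g \<in> borel_measurable borel" "h \<in> borel_measurable borel"
  shows "L2norm g = L2norm h"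
  unfolding L2norm_def using assms by (intro arg_cong[of _ _ sqrt] integral_cong_AE) auto

section \<open>Unitarity and differentiation of pairings in time\<close>

lemma schroedinger_groupD:
  assumes "schroedinger_group U"
  shows "\<And>s g. sq_int g \<Longrightarrow> sq_int (U s g)" "\<And>s g. sq_int g \<Longrightarrow> L2norm (U s g) = L2norm g"
    "\<And>s c g g'. sq_int g \<Longrightarrow> sq_int g' \<Longrightarrow> AE x in lborel. U s (\<lambda>y. c * g y + g' y) x = c * U s g x + U s g' x"
    "\<And>g. sq_int g \<Longrightarrow> AE x in lborel. U 0 g x = g x"
    "\<And>s r g. sq_int g \<Longrightarrow> AE x in lborel. U (s + r) g x = U s (U r g) x"
    "\<And>g s0. sq_int g \<Longrightarrow> ((\<lambda>s. L2norm (\<lambda>x. U s g x - U s0 g x)) \<longlongrightarrow> 0) (at s0)"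
    "\<And>\<phi>. test_fun \<phi> \<Longrightarrow> ((\<lambda>h. L2norm (\<lambda>x. (U h \<phi> x - \<phi> x) / of_real h + \<i> * sublaplacian \<phi> x)) \<longlongrightarrow> 0) (at 0)"
  using assms unfolding schroedinger_group_def by blast+

text \<open>Polarisation: preservation of the norm of \<open>c * g + h\<close> fixes the real part
  of \<open>c\<close> times the pairing, and \<open>c = 1\<close> and \<open>c = \<i>\<close>
  recover both parts.\<close>

lemma schroedinger_unitary:
  assumes U: "schroedinger_group U" and g: "sq_int g" and h: "sq_int h"
  shows "(\<integral>x. U s g x * cnj (U s h x) \<partial>lborel) = (\<integral>x. g x * cnj (h x) \<partial>lborel)"
proof -
  note D = schroedinger_groupD[OF U]
  have "Re (c * (\<integral>x. U s g x * cnj (U s h x) \<partial>lborel)) = Re (c * (\<integral>x. g x * cnj (h x) \<partial>lborel))" for c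
  proof -
    have "L2norm (\<lambda>x. c * U s g x + U s h x) = L2norm (U s (\<lambda>x. c * g x + h x))"
      using D(3)[OF g h, of s c] D(1)[OF g] D(1)[OF h] D(1)[OF sq_int_lincomb[OF g h]]
      by (intro L2norm_cong_AE sq_int_measurable sq_int_lincomb) auto
    also have "\<dots> = L2norm (\<lambda>x. c * g x + h x)" by (rule D(2)[OF sq_int_lincomb[OF g h]])
    finally have "(L2norm (\<lambda>x. c * U s g x + U s h x))\<^sup>2 = (L2norm (\<lambda>x. c * g x + h x))\<^sup>2" by simp
    then show ?thesis
      unfolding L2norm_lincomb[OF g h] L2norm_lincomb[OF D(1)[OF g] D(1)[OF h]] by (simp add: D(2) g h)
  qed
  from this[of 1] this[of "\<i>"] show ?thesis by (simp add: complex_eq_iff)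
qed

text \<open>Applying the isometry \<open>U (- h)\<close> to both factors moves the increment of time
  from \<open>f\<close> to the test function, where the generator is known.\<close>

lemma schroedinger_adjoint:
  assumes U: "schroedinger_group U" and f: "sq_int f" and \<phi>: "sq_int \<phi>"
  shows "(\<integral>x. U (s + h) f x * cnj (\<phi> x) \<partial>lborel) = (\<integral>x. U s f x * cnj (U (- h) \<phi> x) \<partial>lborel)"
proof -
  note D = schroedinger_groupD[OF U]
  note [measurable] = sq_int_measurable[OF D(1)[OF f]] sq_int_measurable[OF D(1)[OF \<phi>]] sq_int_measurable[OF D(1)[OF D(1)[OF f]]]
  have "(\<integral>x. U (s + h) f x * cnj (\<phi> x) \<partial>lborel) = (\<integral>x. U (- h) (U (s + h) f) x * cnj (U (- h) \<phi> x) \<partial>lborel)"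
    by (rule schroedinger_unitary[OF U D(1)[OF f] \<phi>, symmetric])
  also have "\<dots> = (\<integral>x. U s f x * cnj (U (- h) \<phi> x) \<partial>lborel)"
    using D(5)[OF f, of "- h" "s + h"] by (intro integral_cong_AE) (auto elim!: eventually_mono)
  finally show ?thesis .
qed

lemma norm_difference_quotient:
  fixes x y T :: complex
  assumes "h \<noteq> 0"
  shows "norm ((x - y) / of_real h - T) = norm (x - y - h *\<^sub>R T) / norm h"
proof -
  have "x - y - h *\<^sub>R T = of_real h * ((x - y) / of_real h - T)"
    using assms by (simp add: scaleR_conv_of_real field_simps)
  then show ?thesis using assms by (simp add: norm_mult)
qed

text \<open>A product rule in which \<open>f\<close> need not lie in the domain of the generator.
  The difference quotient is split into three pairings: \<open>U (s + h) f\<close> with the error of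
  the quotient of \<open>\<phi>\<close>, the increment of \<open>U s f\<close> with
  \<open>\<psi>\<close>, and \<open>U s f\<close> with the error of the quotient of the group on
  \<open>\<phi> s\<close>. Cauchy-Schwarz sends each of them to 0.\<close>

lemma schroedinger_pairing_derivative:
  fixes U :: "real \<Rightarrow> ('n::finite hpoint \<Rightarrow> complex) \<Rightarrow> ('n hpoint \<Rightarrow> complex)"
  assumes U: "schroedinger_group U" and f: "sq_int f"
    and \<phi>: "\<And>s. sq_int (\<phi> s)" "test_fun (\<phi> s)" and \<psi>: "sq_int \<psi>" and L: "sq_int (sublaplacian (\<phi> s))"
    and lim: "((\<lambda>h. L2norm (\<lambda>x. (\<phi> (s + h) x - \<phi> s x) / of_real h - \<psi> x)) \<longlongrightarrow> 0) (at 0)"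
  shows "((\<lambda>s. \<integral>x. U s f x * cnj (\<phi> s x) \<partial>lborel) has_vector_derivative
     (\<integral>x. U s f x * cnj (\<psi> x + \<i> * sublaplacian (\<phi> s) x) \<partial>lborel)) (at s)"
proof -
  note D = schroedinger_groupD[OF U]
  let ?F = "\<lambda>s. \<integral>x. U s f x * cnj (\<phi> s x) \<partial>lborel"
  let ?T = "\<integral>x. U s f x * cnj (\<psi> x + \<i> * sublaplacian (\<phi> s) x) \<partial>lborel"
  let ?d = "\<lambda>h x. (\<phi> (s + h) x - \<phi> s x) / of_real h - \<psi> x"
  let ?e = "\<lambda>h x. (U h (\<phi> s) x - \<phi> s x) / of_real h + \<i> * sublaplacian (\<phi> s) x"
  let ?u = "\<lambda>h x. U (s + h) f x - U s f x"
  let ?B = "\<lambda>h. L2norm f * L2norm (?d h) + L2norm (?u h) * L2norm \<psi> + L2norm f * L2norm (?e (- h))"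
  have si: "sq_int (?d h)" "sq_int (?e h)" "sq_int (?u h)" for h
    using f \<phi> \<psi> L D(1) by (intro sq_int_intros; simp)+
  have bound: "cmod ((?F (s + h) - ?F s) / of_real h - ?T) \<le> ?B h" if h: "h \<noteq> 0" for h
  proof -
    have i: "integrable lborel (\<lambda>x. U a f x * cnj (k x))" if "sq_int k" for a k
      by (rule sq_int_integrable_pairing[OF D(1)[OF f] that])
    have dU: "(\<integral>x. U (s + h) f x * cnj (\<phi> s x) \<partial>lborel) = (\<integral>x. U s f x * cnj (U (- h) (\<phi> s) x) \<partial>lborel)"
      by (rule schroedinger_adjoint[OF U f \<phi>(1)])
    have 1: "(\<integral>x. U (s + h) f x * cnj (?d h x) \<partial>lborel)
       = (?F (s + h) - (\<integral>x. U (s + h) f x * cnj (\<phi> s x) \<partial>lborel)) / of_real h - (\<integral>x. U (s + h) f x * cnj (\<psi> x) \<partial>lborel)"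
      using i[OF \<phi>(1)] i[OF \<psi>] by (simp add: right_diff_distrib diff_divide_distrib)
    have 2: "(\<integral>x. ?u h x * cnj (\<psi> x) \<partial>lborel) = (\<integral>x. U (s + h) f x * cnj (\<psi> x) \<partial>lborel) - (\<integral>x. U s f x * cnj (\<psi> x) \<partial>lborel)"
      using i[OF \<psi>] by (simp add: left_diff_distrib)
    \<comment> \<open>Taking the adjoint turns \<open>h\<close> into \<open>- h\<close>, so the
      quotient of the group is formed at \<open>- h\<close>; this reverses the sign of the
      difference.\<close>
    have 3: "(\<integral>x. U s f x * cnj (?e (- h) x) \<partial>lborel)
       = (?F s - (\<integral>x. U s f x * cnj (U (- h) (\<phi> s) x) \<partial>lborel)) / of_real h + (\<integral>x. U s f x * cnj (\<i> * sublaplacian (\<phi> s) x) \<partial>lborel)"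
    proof -
      have "(\<integral>x. U s f x * cnj (?e (- h) x) \<partial>lborel)
         = (\<integral>x. (U s f x * cnj (\<phi> s x)) / of_real h - (U s f x * cnj (U (- h) (\<phi> s) x)) / of_real h
            + U s f x * cnj (\<i> * sublaplacian (\<phi> s) x) \<partial>lborel)"
        using h by (intro Bochner_Integration.integral_cong refl) (simp add: field_simps)
      then show ?thesis
        using i[OF \<phi>(1)] i[OF D(1)[OF \<phi>(1)]] i[OF sq_int_cmult[OF L, of "\<i>"]]
        by (simp add: diff_divide_distrib)
    qed
    have 4: "?T = (\<integral>x. U s f x * cnj (\<psi> x) \<partial>lborel) + (\<integral>x. U s f x * cnj (\<i> * sublaplacian (\<phi> s) x) \<partial>lborel)"
      using i[OF \<psi>] i[OF sq_int_cmult[OF L, of "\<i>"]] by (simp add: distrib_left right_diff_distrib)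
    have c: "cmod (\<integral>x. U (s + h) f x * cnj (?d h x) \<partial>lborel) \<le> L2norm f * L2norm (?d h)"
      "cmod (\<integral>x. ?u h x * cnj (\<psi> x) \<partial>lborel) \<le> L2norm (?u h) * L2norm \<psi>"
      "cmod (\<integral>x. U s f x * cnj (?e (- h) x) \<partial>lborel) \<le> L2norm f * L2norm (?e (- h))"
      using L2_Cauchy_Schwarz[OF D(1)[OF f, of "s + h"] si(1)[of h]] L2_Cauchy_Schwarz[OF si(3)[of h] \<psi>]
        L2_Cauchy_Schwarz[OF D(1)[OF f, of s] si(2)[of "- h"]]
      unfolding D(2)[OF f] by blast+
    have eq: "(?F (s + h) - ?F s) / of_real h - ?T
       = (\<integral>x. U (s + h) f x * cnj (?d h x) \<partial>lborel) + (\<integral>x. ?u h x * cnj (\<psi> x) \<partial>lborel)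
         - (\<integral>x. U s f x * cnj (?e (- h) x) \<partial>lborel)"
      unfolding 1 2 3 4 dU by (simp add: diff_divide_distrib)
    have tri: "cmod (a + b - c) \<le> A + B + C" if "cmod a \<le> A" "cmod b \<le> B" "cmod c \<le> C" for a b c A B C
      using that norm_triangle_ineq4[of "a + b" c] norm_triangle_ineq[of a b] by linarith
    show ?thesis unfolding eq by (rule tri[OF c])
  qed
  have e0: "((\<lambda>h. L2norm (?e (- h))) \<longlongrightarrow> 0) (at 0)"
    by (rule filterlim_compose[OF D(7)[OF \<phi>(2)]]) (auto simp: filterlim_at eventually_at_filter intro!: tendsto_eq_intros)
  have u0: "((\<lambda>h. L2norm (?u h)) \<longlongrightarrow> 0) (at 0)"
    using D(6)[OF f, of s] by (subst (asm) at_to_0) (simp add: filterlim_filtermap add.commute)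
  have "(?B \<longlongrightarrow> L2norm f * 0 + 0 * L2norm \<psi> + L2norm f * 0) (at 0)"
    by (intro tendsto_intros lim u0 e0)
  then have B0: "(?B \<longlongrightarrow> 0) (at 0)" by simp
  have "((\<lambda>h. (?F (s + h) - ?F s) / of_real h - ?T) \<longlongrightarrow> 0) (at 0)"
    by (rule Lim_null_comparison[OF _ B0]) (use bound in \<open>auto simp: eventually_at_filter\<close>)
  then have "((\<lambda>h. norm ((?F (s + h) - ?F s) / of_real h - ?T)) \<longlongrightarrow> 0) (at 0)"
    by (rule tendsto_norm_zero)
  moreover have "\<forall>\<^sub>F h in at 0. norm ((?F (s + h) - ?F s) / of_real h - ?T) = norm (?F (s + h) - ?F s - h *\<^sub>R ?T) / norm h"
    using norm_difference_quotient by (auto simp: eventually_at_filter)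
  ultimately have "((\<lambda>h. norm (?F (s + h) - ?F s - h *\<^sub>R ?T) / norm h) \<longlongrightarrow> 0) (at 0)"
    by (rule Lim_transform_eventually)
  then show ?thesis
    unfolding has_vector_derivative_def has_derivative_at by (simp add: bounded_linear_scaleR_left)
qed

section \<open>Removing the cutoff\<close>

lemma has_bochner_integral_fst_snd_mult:
  fixes g :: "'a::euclidean_space \<Rightarrow> real" and h :: "'b::euclidean_space \<Rightarrow> real"
  assumes g: "integrable lborel g" and h: "integrable lborel h"
  shows "has_bochner_integral lborel (\<lambda>p. g (fst p) * h (snd p)) ((\<integral>x. g x \<partial>lborel) * (\<integral>y. h y \<partial>lborel))"
proof -
  note [measurable] = borel_measurable_integrable[OF g] borel_measurable_integrable[OF h]
  have i: "integrable (lborel \<Otimes>\<^sub>M lborel) (\<lambda>p. g (fst p) * h (snd p))"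
    by (rule lborel_pair.Fubini_integrable) (use g h in \<open>auto simp: norm_mult abs_mult\<close>)
  have "integral\<^sup>L (lborel \<Otimes>\<^sub>M lborel) (\<lambda>p. g (fst p) * h (snd p)) = (\<integral>x. g x \<partial>lborel) * (\<integral>y. h y \<partial>lborel)"
    using lborel_pair.integral_fst'[OF i] by simp
  with i show ?thesis unfolding lborel_prod has_bochner_integral_iff by simp
qed

section \<open>The time-dependent phase\<close>

definition rot :: "real \<Rightarrow> real \<Rightarrow> complex" where
  "rot l s = exp (2 * \<i> * of_real l * of_real s)"

text \<open>The derivative in \<open>s\<close> must be \<open>\<i>\<close> times the constant part
  of the symbol, \<open>l * n - 4 * w * (\<Sum>k. A $ k * B $ k)\<close> with
  \<open>w = rot l s\<close>; this is the antiderivative with no constant added. Its value at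
  \<open>s = 0\<close> is in general not 0 and later supplies the 1 in the factor
  \<open>1 - rot l s\<close>.\<close>

definition drift :: "real \<Rightarrow> complex ^ 'n \<Rightarrow> complex ^ 'n::finite \<Rightarrow> real \<Rightarrow> complex" where
  "drift l A B s = \<i> * of_real l * of_nat CARD('n) * of_real s - of_real (2 / l) * rot l s * (\<Sum>k\<in>UNIV. A $ k * B $ k)"

abbreviation phase_at :: "real \<Rightarrow> complex ^ 'n \<Rightarrow> complex ^ 'n \<Rightarrow> real \<Rightarrow> 'n::finite hpoint \<Rightarrow> complex" where
  "phase_at l A B s \<equiv> phase l A B (rot l s) (drift l A B s)"

abbreviation wave_at :: "real \<Rightarrow> complex ^ 'n \<Rightarrow> complex ^ 'n \<Rightarrow> real \<Rightarrow> real \<Rightarrow> 'n::finite hpoint \<Rightarrow> complex" where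
  "wave_at l A B R s \<equiv> wave l A B (rot l s) (drift l A B s) R"

abbreviation symbol_at :: "real \<Rightarrow> complex ^ 'n \<Rightarrow> complex ^ 'n \<Rightarrow> real \<Rightarrow> 'n::finite hpoint \<Rightarrow> complex" where
  "symbol_at l A B s \<equiv> symbol l A B (rot l s)"

lemma norm_rot [simp]: "cmod (rot l s) = 1"
  by (simp add: rot_def)

lemma symbol_split:
  fixes A B :: "complex ^ 'n::finite"
  shows "symbol l A B w p = of_real l * of_nat CARD('n) - 4 * w * (\<Sum>k\<in>UNIV. A $ k * B $ k)
     + 2 * of_real l * w * (\<Sum>k\<in>UNIV. B $ k * cnj (fst p $ k))"
  unfolding symbol_def by (simp add: algebra_simps sum.distrib sum_subtractf sum_distrib_left)

text \<open>Differentiating \<open>rot l s\<close> in the antiholomorphic sum reproduces the part of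
  the symbol that is linear in the conjugate coordinate; the drift accounts for the constant
  part.\<close>

lemma phase_at_derivative:
  fixes A B :: "complex ^ 'n::finite"
  assumes l: "l \<noteq> 0"
  shows "((\<lambda>s. phase_at l A B s p) has_vector_derivative \<i> * symbol_at l A B s p) (at s)"
proof -
  define P b S where "P = \<i> * of_real (l * snd p) - of_real (l / 4 * (fst p \<bullet> fst p)) + (\<Sum>k\<in>UNIV. A $ k * fst p $ k)"
    and "b = (\<Sum>k\<in>UNIV. B $ k * cnj (fst p $ k))" and "S = (\<Sum>k\<in>UNIV. A $ k * B $ k)"
  let ?F = "\<lambda>z. P + exp (2 * \<i> * of_real l * z) * b + (\<i> * of_real l * of_nat CARD('n) * z - of_real (2 / l) * exp (2 * \<i> * of_real l * z) * S)"
  have "phase_at l A B s p = ?F (of_real s)" for s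
    by (simp add: phase_def P_def b_def S_def drift_def rot_def sum.distrib sum_distrib_left)
  moreover have "(?F has_field_derivative \<i> * symbol_at l A B s p) (at (of_real s))"
    unfolding symbol_split b_def[symmetric] S_def[symmetric] using l
    by (auto intro!: derivative_eq_intros simp: rot_def algebra_simps)
  ultimately show ?thesis using has_vector_derivative_real_field[of ?F] by simp
qed

lemma wave_at_derivative:
  assumes "l \<noteq> 0"
  shows "((\<lambda>s. wave_at l A B R s p) has_vector_derivative
     \<i> * symbol_at l A B s p * exp (phase_at l A B s p) * of_real (bump R p)) (at s)"
proof -
  have "((\<lambda>s. exp (phase_at l A B s p)) has_vector_derivative \<i> * symbol_at l A B s p * exp (phase_at l A B s p)) (at s)"
    using field_vector_diff_chain_at[OF phase_at_derivative[OF assms] DERIV_exp] by (simp add: o_def)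
  from has_vector_derivative_mult_left[OF this] show ?thesis unfolding wave_def .
qed

section \<open>Size of the cutoff error\<close>

definition coeff_size :: "complex ^ 'n \<Rightarrow> complex ^ 'n::finite \<Rightarrow> real" where
  "coeff_size A B = (\<Sum>k\<in>UNIV. cmod (A $ k) + cmod (B $ k))"

lemma coeff_size_nonneg: "0 \<le> coeff_size A B" by (simp add: coeff_size_def sum_nonneg)

lemma coeff_size_component: "cmod (A $ k) + cmod (B $ k) \<le> coeff_size A B"
  unfolding coeff_size_def by (rule member_le_sum) auto

lemma norm_linear_part:
  fixes z :: "complex ^ 'n::finite"
  assumes "cmod w = 1"
  shows "cmod (\<Sum>k\<in>UNIV. A $ k * z $ k + w * (B $ k * cnj (z $ k))) \<le> coeff_size A B * norm z"
proof -
  have "cmod (A $ k * z $ k + w * (B $ k * cnj (z $ k))) \<le> (cmod (A $ k) + cmod (B $ k)) * norm z" for k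
  proof -
    have "cmod (A $ k * z $ k + w * (B $ k * cnj (z $ k))) \<le> cmod (A $ k) * cmod (z $ k) + cmod (B $ k) * cmod (z $ k)"
      using norm_triangle_ineq[of "A $ k * z $ k" "w * (B $ k * cnj (z $ k))"] assms by (simp add: norm_mult)
    also have "\<dots> = (cmod (A $ k) + cmod (B $ k)) * cmod (z $ k)" by (simp add: algebra_simps)
    also have "\<dots> \<le> (cmod (A $ k) + cmod (B $ k)) * norm z"
      by (intro mult_left_mono Finite_Cartesian_Product.norm_nth_le) simp
    finally show ?thesis .
  qed
  then show ?thesis unfolding coeff_size_def sum_distrib_right by (rule sum_norm_le)
qed

lemma norm_exp_phase_le:
  assumes "cmod w = 1"
  shows "cmod (exp (phase l A B w c p)) \<le> exp (- l / 4 * (norm (fst p))\<^sup>2 + coeff_size A B * norm (fst p) + Re c)"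
proof -
  have "Re (phase l A B w c p) \<le> - l / 4 * (norm (fst p))\<^sup>2 + coeff_size A B * norm (fst p) + Re c"
    using complex_Re_le_cmod[of "\<Sum>k\<in>UNIV. A $ k * fst p $ k + w * (B $ k * cnj (fst p $ k))"]
      norm_linear_part[OF assms, of A "fst p" B]
    unfolding phase_def by (simp add: power2_norm_eq_inner)
  then show ?thesis by simp
qed

lemma Re_drift_le:
  assumes "l > 0"
  shows "Re (drift l A B s) \<le> 2 / l * cmod (\<Sum>k\<in>UNIV. A $ k * B $ k)"
proof -
  have "Re (drift l A B s) = - Re (of_real (2 / l) * rot l s * (\<Sum>k\<in>UNIV. A $ k * B $ k))"
    by (simp add: drift_def)
  also have "\<dots> \<le> cmod (of_real (2 / l) * rot l s * (\<Sum>k\<in>UNIV. A $ k * B $ k))"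
    using abs_Re_le_cmod[of "of_real (2 / l) * rot l s * (\<Sum>k\<in>UNIV. A $ k * B $ k)"] by linarith
  also have "\<dots> = 2 / l * cmod (\<Sum>k\<in>UNIV. A $ k * B $ k)" using assms by (simp add: norm_mult norm_divide)
  finally show ?thesis .
qed

lemma norm_slope_le:
  assumes "cmod w = 1" "l > 0"
  shows "cmod (slopeX l A B w j p) \<le> (l + coeff_size A B) * (1 + norm (fst p))"
    "cmod (slopeY l A B w j p) \<le> (l + coeff_size A B) * (1 + norm (fst p))"
proof -
  have z: "cmod (fst p $ j) \<le> norm (fst p)" by (rule Finite_Cartesian_Product.norm_nth_le)
  have *: "l / 2 * cmod (fst p $ j) + (cmod (A $ j) + cmod (B $ j)) \<le> (l + coeff_size A B) * (1 + norm (fst p))"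
  proof -
    have "l / 2 * cmod (fst p $ j) \<le> l * norm (fst p)" using z assms by (intro mult_mono) auto
    then have "l / 2 * cmod (fst p $ j) + (cmod (A $ j) + cmod (B $ j)) \<le> l * norm (fst p) + coeff_size A B"
      using coeff_size_component[of A j B] by linarith
    also have "\<dots> \<le> (l + coeff_size A B) * (1 + norm (fst p))"
      using assms coeff_size_nonneg[of A B] by (simp add: algebra_simps)
    finally show ?thesis .
  qed
  have "cmod (slopeX l A B w j p) \<le> l / 2 * cmod (fst p $ j) + (cmod (A $ j) + cmod (B $ j))"
    unfolding slopeX_def using assms
    by (intro norm_triangle_mono) (auto simp: norm_mult norm_divide)
  then show "cmod (slopeX l A B w j p) \<le> (l + coeff_size A B) * (1 + norm (fst p))" using * by linarith
  have "cmod (A $ j - w * B $ j) \<le> cmod (A $ j) + cmod (B $ j)"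
    using norm_triangle_ineq4[of "A $ j" "w * B $ j"] assms by (simp add: norm_mult)
  then have "cmod (slopeY l A B w j p) \<le> l / 2 * cmod (fst p $ j) + (cmod (A $ j) + cmod (B $ j))"
    unfolding slopeY_def using assms
    by (intro norm_triangle_mono) (auto simp: norm_mult norm_divide)
  then show "cmod (slopeY l A B w j p) \<le> (l + coeff_size A B) * (1 + norm (fst p))" using * by linarith
qed

lemma remainder_outside: "R > 0 \<Longrightarrow> norm p \<ge> R \<Longrightarrow> remainder l A B w R p = 0"
proof -
  assume "R > 0" "norm p \<ge> R"
  then have "R\<^sup>2 \<le> p \<bullet> p" by (simp add: power2_norm_eq_inner[symmetric] power_mono)
  then have "bump1 R p = 0" "bump2 R p = 0" using \<open>R > 0\<close> by (simp_all add: bump1_def bump2_def flat_exp_def)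
  then show ?thesis by (simp add: remainder_def)
qed

text \<open>Each derivative of the profile costs \<open>1 / R^2\<close> and each first derivative of
  \<open>p \<bullet> p\<close> is linear in \<open>z\<close> with coefficients that contain
  \<open>snd p\<close>. On the support \<open>|snd p| \<le> R\<close>, so the net gain is at least
  one power of \<open>R\<close>, at the price of polynomial growth in \<open>z\<close> that the
  Gaussian absorbs. The indicator records the support in \<open>t\<close>, where the wave has no
  decay of its own.\<close>

lemma norm_remainder_le:
  fixes A B :: "complex ^ 'n::finite"
  assumes w: "cmod w = 1" and l: "l > 0" and R: "R \<ge> 1"
  shows "cmod (remainder l A B w R p)
    \<le> real CARD('n) * (exp 1 * (24 * (l + coeff_size A B) + 656)) / R * (1 + norm (fst p))\<^sup>2 * indicator {-R..R} (snd p)"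
proof (cases "norm p \<ge> R")
  case True
  have "0 \<le> real CARD('n) * (exp 1 * (24 * (l + coeff_size A B) + 656)) / R * (1 + norm (fst p))\<^sup>2 * indicator {-R..R} (snd p)"
    using l R coeff_size_nonneg[of A B] by (intro mult_nonneg_nonneg divide_nonneg_nonneg) auto
  then show ?thesis using remainder_outside[of R p] True R by simp
next
  case False
  define r where "r = norm (fst p)"
  define S where "S = l + coeff_size A B"
  have r0: "r \<ge> 0" and S0: "S \<ge> 0" using l coeff_size_nonneg[of A B] by (auto simp: r_def S_def)
  have t: "\<bar>snd p\<bar> \<le> R" using norm_snd_le[of "snd p" "fst p"] False by simp
  then have ind: "indicator {-R..R} (snd p) = (1::real)" by (auto simp: indicator_def abs_le_iff)
  have e: "flat_exp k u \<le> fact k" "0 \<le> flat_exp k u" for k u by (auto intro: flat_exp_le flat_exp_bounds)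
  have R2: "R \<le> R\<^sup>2" "0 < R\<^sup>2" using R by (auto simp: power2_eq_square)
  \<comment> \<open>The constants are factorials from \<open>flat_exp_le\<close>: the 2 is
    \<open>2!\<close>, and the 36 below is \<open>4! + 2 * 3!\<close>.\<close>
  have b1: "\<bar>bump1 R p\<bar> \<le> 2 * exp 1 / R\<^sup>2"
    using e[of 2 "1 - (p \<bullet> p) / R\<^sup>2"] by (simp add: bump1_def abs_mult divide_right_mono fact_numeral)
  have b2: "\<bar>bump2 R p\<bar> \<le> 36 * exp 1 / R\<^sup>2 / R\<^sup>2"
  proof -
    have "\<bar>flat_exp 4 (1 - (p \<bullet> p) / R\<^sup>2) - 2 * flat_exp 3 (1 - (p \<bullet> p) / R\<^sup>2)\<bar> \<le> 36"
      using e[of 4 "1 - (p \<bullet> p) / R\<^sup>2"] e[of 3 "1 - (p \<bullet> p) / R\<^sup>2"] by (simp add: fact_numeral)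
    then show ?thesis by (simp add: bump2_def abs_mult divide_right_mono)
  qed
  have zj: "\<bar>Re (fst p $ j)\<bar> \<le> r" "\<bar>Im (fst p $ j)\<bar> \<le> r" for j
    using abs_Re_le_cmod[of "fst p $ j"] abs_Im_le_cmod[of "fst p $ j"] Finite_Cartesian_Product.norm_nth_le[of "fst p" j] by (auto simp: r_def)
  have gX: "\<bar>gradX j p\<bar> \<le> 3 * R * r" and gY: "\<bar>gradY j p\<bar> \<le> 3 * R * r" for j
  proof -
    have "r \<le> R * r" using R r0 by (simp add: mult_le_cancel_right1)
    moreover have "\<bar>snd p * Im (fst p $ j)\<bar> \<le> R * r" "\<bar>snd p * Re (fst p $ j)\<bar> \<le> R * r"
      unfolding abs_mult using t zj R by (auto intro!: mult_mono)
    ultimately show "\<bar>gradX j p\<bar> \<le> 3 * R * r" "\<bar>gradY j p\<bar> \<le> 3 * R * r"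
      using zj[of j] unfolding gradX_def gradY_def by linarith+
  qed
  have rr: "r \<le> 1 + r" "r * (1 + r) \<le> (1 + r)\<^sup>2" "r\<^sup>2 \<le> (1 + r)\<^sup>2" "4 + r\<^sup>2 \<le> 4 * (1 + r)\<^sup>2"
    using r0 by (auto simp: power2_eq_square algebra_simps)
  \<comment> \<open>The numerical factors are \<open>12 = 2 * 2 * 3\<close> here,
    \<open>648 = 36 * 2 * 9\<close> and \<open>8 = 2 * 4\<close> in the next two estimates; in total
    \<open>24 = 12 + 12\<close> and \<open>656 = 648 + 8\<close>.\<close>
  have T1: "\<bar>2 * bump1 R p * g\<bar> * cmod x \<le> 12 * exp 1 * S / R * (1 + r)\<^sup>2"
    if "\<bar>g\<bar> \<le> 3 * R * r" "cmod x \<le> S * (1 + r)" for g x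
  proof -
    have "\<bar>2 * bump1 R p * g\<bar> * cmod x \<le> 2 * (2 * exp 1 / R\<^sup>2) * (3 * R * r) * (S * (1 + r))"
      unfolding abs_mult using that b1 R r0 S0 by (intro mult_mono) auto
    also have "\<dots> = 12 * exp 1 * S / R * (r * (1 + r))" using R by (simp add: field_simps power2_eq_square)
    also have "\<dots> \<le> 12 * exp 1 * S / R * (1 + r)\<^sup>2" using rr S0 R by (intro mult_left_mono) auto
    finally show ?thesis .
  qed
  have T2: "\<bar>bump2 R p * ((gradX j p)\<^sup>2 + (gradY j p)\<^sup>2)\<bar> \<le> 648 * exp 1 / R * (1 + r)\<^sup>2" for j
  proof -
    have "(gradX j p)\<^sup>2 \<le> (3 * R * r)\<^sup>2" "(gradY j p)\<^sup>2 \<le> (3 * R * r)\<^sup>2"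
      using power_mono[OF gX[of j], of 2] power_mono[OF gY[of j], of 2] by auto
    then have "\<bar>bump2 R p * ((gradX j p)\<^sup>2 + (gradY j p)\<^sup>2)\<bar> \<le> (36 * exp 1 / R\<^sup>2 / R\<^sup>2) * (2 * (3 * R * r)\<^sup>2)"
      unfolding abs_mult using b2 by (intro mult_mono) auto
    also have "\<dots> = 648 * exp 1 / R\<^sup>2 * r\<^sup>2" using R by (simp add: field_simps power2_eq_square)
    also have "\<dots> \<le> 648 * exp 1 / R * (1 + r)\<^sup>2" using rr R R2 by (intro mult_mono divide_left_mono) auto
    finally show ?thesis .
  qed
  have T3: "\<bar>bump1 R p * (4 + ((Re (fst p $ j))\<^sup>2 + (Im (fst p $ j))\<^sup>2) / 2)\<bar> \<le> 8 * exp 1 / R * (1 + r)\<^sup>2" for j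
  proof -
    have "(Re (fst p $ j))\<^sup>2 \<le> r\<^sup>2" "(Im (fst p $ j))\<^sup>2 \<le> r\<^sup>2"
      using power_mono[OF zj(1)[of j], of 2] power_mono[OF zj(2)[of j], of 2] by auto
    note sq = this
    have "\<bar>bump1 R p * (4 + ((Re (fst p $ j))\<^sup>2 + (Im (fst p $ j))\<^sup>2) / 2)\<bar> \<le> 2 * exp 1 / R\<^sup>2 * (4 * (1 + r)\<^sup>2)"
      unfolding abs_mult
    proof (intro mult_mono b1)
      have "4 + ((Re (fst p $ j))\<^sup>2 + (Im (fst p $ j))\<^sup>2) / 2 \<le> 4 * (1 + r)\<^sup>2"
      proof (rule order_trans[OF _ rr(4)])
        have "(Re (fst p $ j))\<^sup>2 + (Im (fst p $ j))\<^sup>2 \<le> r\<^sup>2 + r\<^sup>2" by (rule add_mono[OF sq])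
        then show "4 + ((Re (fst p $ j))\<^sup>2 + (Im (fst p $ j))\<^sup>2) / 2 \<le> 4 + r\<^sup>2" by simp
      qed
      then show "\<bar>4 + ((Re (fst p $ j))\<^sup>2 + (Im (fst p $ j))\<^sup>2) / 2\<bar> \<le> 4 * (1 + r)\<^sup>2" by simp
    qed auto
    also have "\<dots> = 8 * exp 1 / R\<^sup>2 * (1 + r)\<^sup>2" by simp
    also have "\<dots> \<le> 8 * exp 1 / R * (1 + r)\<^sup>2" using R R2 by (intro mult_mono divide_left_mono) auto
    finally show ?thesis .
  qed
  have "cmod (remainder l A B w R p) \<le> (\<Sum>j\<in>(UNIV::'n set). exp 1 * (24 * S + 656) / R * (1 + r)\<^sup>2)"
    unfolding remainder_def
  proof (rule sum_norm_le)
    fix j :: 'n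
    have sl: "cmod (slopeX l A B w j p) \<le> S * (1 + r)" "cmod (slopeY l A B w j p) \<le> S * (1 + r)"
      unfolding r_def S_def by (rule norm_slope_le[OF w l])+
    let ?a = "complex_of_real (2 * bump1 R p * gradX j p) * slopeX l A B w j p"
    let ?b = "complex_of_real (2 * bump1 R p * gradY j p) * slopeY l A B w j p"
    let ?c = "bump2 R p * ((gradX j p)\<^sup>2 + (gradY j p)\<^sup>2)"
    let ?d = "bump1 R p * (4 + ((Re (fst p $ j))\<^sup>2 + (Im (fst p $ j))\<^sup>2) / 2)"
    have "cmod ?a \<le> 12 * exp 1 * S / R * (1 + r)\<^sup>2" "cmod ?b \<le> 12 * exp 1 * S / R * (1 + r)\<^sup>2"
      unfolding norm_mult norm_of_real
      using T1[OF gX sl(1)] T1[OF gY sl(2)] by blast+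
    moreover have "cmod (complex_of_real (?c + ?d)) \<le> 656 * exp 1 / R * (1 + r)\<^sup>2"
    proof -
      have "\<bar>?c + ?d\<bar> \<le> 648 * exp 1 / R * (1 + r)\<^sup>2 + 8 * exp 1 / R * (1 + r)\<^sup>2"
        by (rule order_trans[OF abs_triangle_ineq add_mono[OF T2 T3]])
      then show ?thesis unfolding norm_of_real by (simp add: field_simps)
    qed
    ultimately have "cmod (?a + ?b + complex_of_real (?c + ?d)) \<le>
      12 * exp 1 * S / R * (1 + r)\<^sup>2 + 12 * exp 1 * S / R * (1 + r)\<^sup>2 + 656 * exp 1 / R * (1 + r)\<^sup>2"
      by (intro norm_triangle_mono)
    also have "\<dots> = exp 1 * (24 * S + 656) / R * (1 + r)\<^sup>2" using R by (simp add: field_simps)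
    finally show "cmod (?a + ?b + complex_of_real (?c + ?d)) \<le> exp 1 * (24 * S + 656) / R * (1 + r)\<^sup>2" .
  qed
  then show ?thesis unfolding ind r_def[symmetric] S_def[symmetric] by simp
qed

text \<open>The amplitude is of order \<open>1 / R\<close> on an interval of length
  \<open>2 * R\<close> in \<open>t\<close>, with a Gaussian in \<open>z\<close>, so the square of
  the norm is of order \<open>1 / R\<close>. The constant is uniform in \<open>s\<close> because
  \<open>rot l s\<close> has modulus 1.\<close>

lemma L2norm_error:
  fixes A B :: "complex ^ 'n::finite"
  assumes l: "l > 0"
  obtains K where "\<And>R s. R \<ge> 1 \<Longrightarrow> L2norm (\<lambda>p. exp (phase_at l A B s p) * remainder l A B (rot l s) R p) \<le> K / sqrt R"
proof -
  define L where "L = coeff_size A B"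
  define c0 where "c0 = 2 / l * cmod (\<Sum>k\<in>UNIV. A $ k * B $ k)"
  define K1 where "K1 = real CARD('n) * (exp 1 * (24 * (l + L) + 656))"
  \<comment> \<open>Half of the Gaussian exponent absorbs the linear term: the maximum of
    \<open>(L + 2) * r - l / 8 * r^2\<close> is \<open>2 * (L + 2)^2 / l\<close>. The 2 in
    \<open>L + 2\<close> comes from \<open>(1 + r)^2 \<le> exp (2 * r)\<close>.\<close>
  define M where "M = (exp (c0 + (L + 2)\<^sup>2 * 2 / l) * K1)\<^sup>2"
  define G where "G = (\<integral>z. exp (- (l / 4) * (norm z)\<^sup>2) \<partial>(lborel :: (complex ^ 'n) measure))"
  have L0: "L \<ge> 0" by (simp add: L_def coeff_size_nonneg)
  have K10: "K1 \<ge> 0" using L0 l by (simp add: K1_def)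
  have "L2norm (\<lambda>p. exp (phase_at l A B s p) * remainder l A B (rot l s) R p) \<le> sqrt (2 * M * G) / sqrt R"
    if R: "R \<ge> 1" for R s
  proof -
    have pt: "(cmod (exp (phase_at l A B s p) * remainder l A B (rot l s) R p))\<^sup>2
      \<le> (M / R\<^sup>2 * exp (- (l / 4) * (norm (fst p))\<^sup>2)) * indicator {-R..R} (snd p)" for p
    proof -
      define r where "r = norm (fst p)"
      have r0: "r \<ge> 0" by (simp add: r_def)
      have "cmod (exp (phase_at l A B s p) * remainder l A B (rot l s) R p)
         \<le> exp (- l / 4 * r\<^sup>2 + L * r + c0) * (K1 / R * (1 + r)\<^sup>2 * indicator {-R..R} (snd p))"
        unfolding norm_mult
      proof (rule mult_mono)
        show "cmod (exp (phase_at l A B s p)) \<le> exp (- l / 4 * r\<^sup>2 + L * r + c0)"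
          using norm_exp_phase_le[OF norm_rot, of l A B l s "drift l A B s" p] Re_drift_le[OF l, of A B s]
          unfolding r_def L_def c0_def by (meson add_left_mono exp_le_cancel_iff order_trans)
        show "cmod (remainder l A B (rot l s) R p) \<le> K1 / R * (1 + r)\<^sup>2 * indicator {-R..R} (snd p)"
          using norm_remainder_le[OF norm_rot l R, of A B l s p] unfolding r_def L_def K1_def .
      qed auto
      also have "\<dots> \<le> exp (- l / 4 * r\<^sup>2 + L * r + c0) * (K1 / R * exp (2 * r) * indicator {-R..R} (snd p))"
      proof -
        have "(1 + r)\<^sup>2 \<le> (exp r)\<^sup>2" using exp_ge_add_one_self[of r] r0 by (intro power_mono) auto
        then have "(1 + r)\<^sup>2 \<le> exp (2 * r)" by (simp add: exp_double)
        then show ?thesis using K10 R by (intro mult_left_mono mult_right_mono) auto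
      qed
      also have "\<dots> = exp (- l / 4 * r\<^sup>2 + (L + 2) * r + c0) * (K1 / R) * indicator {-R..R} (snd p)"
        by (simp add: exp_add[symmetric] algebra_simps)
      also have "\<dots> \<le> exp (- l / 8 * r\<^sup>2 + (c0 + (L + 2)\<^sup>2 * 2 / l)) * (K1 / R) * indicator {-R..R} (snd p)"
      proof -
        have "0 \<le> (l * r / 4 - (L + 2))\<^sup>2 * (2 / l)" using l by simp
        also have "\<dots> = l / 8 * r\<^sup>2 - (L + 2) * r + (L + 2)\<^sup>2 * 2 / l"
          using l by (simp add: power2_eq_square field_simps)
        finally have "- l / 4 * r\<^sup>2 + (L + 2) * r + c0 \<le> - l / 8 * r\<^sup>2 + (c0 + (L + 2)\<^sup>2 * 2 / l)"
          by (simp add: field_simps)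
        then show ?thesis using K10 R by (intro mult_right_mono) auto
      qed
      finally have "(cmod (exp (phase_at l A B s p) * remainder l A B (rot l s) R p))\<^sup>2
        \<le> (exp (- l / 8 * r\<^sup>2 + (c0 + (L + 2)\<^sup>2 * 2 / l)) * (K1 / R) * indicator {-R..R} (snd p))\<^sup>2"
        by (intro power_mono) auto
      also have "\<dots> = (M / R\<^sup>2 * exp (- (l / 4) * r\<^sup>2)) * indicator {-R..R} (snd p)"
      proof -
        have "(exp (- l / 8 * r\<^sup>2 + (c0 + (L + 2)\<^sup>2 * 2 / l)))\<^sup>2 = exp (- (l / 4) * r\<^sup>2) * (exp (c0 + (L + 2)\<^sup>2 * 2 / l))\<^sup>2"
          unfolding exp_double[symmetric] exp_add[symmetric] by (rule arg_cong[of _ _ exp]) (simp add: algebra_simps)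
        then show ?thesis by (simp add: M_def power_mult_distrib power_divide indicator_def)
      qed
      finally show ?thesis unfolding r_def .
    qed
    have Gi: "integrable lborel (\<lambda>z::complex ^ 'n. M / R\<^sup>2 * exp (- (l / 4) * (norm z)\<^sup>2))"
      using integrable_gaussian[of "l / 4"] l by (intro integrable_mult_right) simp
    have Ii: "integrable lborel (indicator {-R..R} :: real \<Rightarrow> real)"
      by (rule integrable_real_indicator) (simp_all add: emeasure_lborel_Icc_eq)
    note prod = has_bochner_integral_fst_snd_mult[OF Gi Ii]
    have "(L2norm (\<lambda>p. exp (phase_at l A B s p) * remainder l A B (rot l s) R p))\<^sup>2
       \<le> (\<integral>p. (M / R\<^sup>2 * exp (- (l / 4) * (norm (fst p))\<^sup>2)) * indicator {-R..R} (snd p) \<partial>(lborel :: 'n hpoint measure))"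
      unfolding L2norm_power2
    proof (rule integral_mono')
      show "integrable lborel (\<lambda>p::'n hpoint. (M / R\<^sup>2 * exp (- (l / 4) * (norm (fst p))\<^sup>2)) * indicator {-R..R} (snd p))"
        using prod by (simp only: has_bochner_integral_iff)
      show "0 \<le> (M / R\<^sup>2 * exp (- (l / 4) * (norm (fst p))\<^sup>2)) * indicator {-R..R} (snd p)" for p :: "'n hpoint"
        by (simp add: M_def)
    qed (rule pt)
    also have "\<dots> = M / R\<^sup>2 * G * (2 * R)"
      using prod R by (simp add: has_bochner_integral_iff G_def)
    also have "\<dots> = 2 * M * G / R" using R by (simp add: field_simps power2_eq_square)
    finally have "L2norm (\<lambda>p. exp (phase_at l A B s p) * remainder l A B (rot l s) R p) \<le> sqrt (2 * M * G / R)"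
      by (intro real_le_rsqrt)
    then show ?thesis by (simp add: real_sqrt_divide)
  qed
  then show ?thesis by (rule that)
qed

section \<open>Strong differentiability of the cutoff wave\<close>

lemma flat_exp_continuous [continuous_intros]:
  "continuous_on S f \<Longrightarrow> continuous_on S (\<lambda>x. flat_exp k (f x))"
  by (rule continuous_on_compose2[OF continuous_at_imp_continuous_on, of UNIV])
    (auto intro: DERIV_isCont[OF DERIV_flat_exp])

lemma bump_continuous [continuous_intros]:
  "continuous_on S (\<lambda>p. bump R p)" "continuous_on S (\<lambda>p. bump1 R p)" "continuous_on S (\<lambda>p. bump2 R p)"
  unfolding bump_def bump1_def bump2_def divide_inverse by (intro continuous_intros)+

lemma remainder_continuous: "continuous_on UNIV (remainder l A B w R)"
  unfolding remainder_def slopeX_def slopeY_def gradX_def gradY_def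
  by (intro continuous_intros) auto

lemma symbol_continuous: "continuous_on UNIV (symbol l A B w)"
  unfolding symbol_def by (intro continuous_intros)

lemma phase_continuous: "continuous_on UNIV (phase l A B w c)"
  by (rule smooth_gen_continuous[OF smooth_gen_phase])

lemma symbol_at_bound:
  fixes A B :: "complex ^ 'n::finite"
  assumes "l > 0"
  shows "cmod (symbol_at l A B s p) \<le> l * CARD('n) + 4 * cmod (\<Sum>k\<in>UNIV. A $ k * B $ k) + 2 * l * (coeff_size A B * norm (fst p))"
proof -
  have "cmod (\<Sum>k\<in>UNIV. B $ k * cnj (fst p $ k)) \<le> coeff_size A B * norm (fst p)"
  proof -
    have "coeff_size 0 B \<le> coeff_size A B" unfolding coeff_size_def by (rule sum_mono) simp
    then have "coeff_size 0 B * norm (fst p) \<le> coeff_size A B * norm (fst p)" by (intro mult_right_mono) simp_all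
    with norm_linear_part[of 1 0 "fst p" B] show ?thesis by simp
  qed
  then have 1: "cmod (2 * of_real l * rot l s * (\<Sum>k\<in>UNIV. B $ k * cnj (fst p $ k))) \<le> 2 * l * (coeff_size A B * norm (fst p))"
    using assms by (simp add: norm_mult)
  have 2: "cmod (of_real l * of_nat CARD('n) - 4 * rot l s * (\<Sum>k\<in>UNIV. A $ k * B $ k))
     \<le> l * CARD('n) + 4 * cmod (\<Sum>k\<in>UNIV. A $ k * B $ k)"
    using norm_triangle_ineq4[of "complex_of_real l * of_nat CARD('n)" "4 * rot l s * (\<Sum>k\<in>UNIV. A $ k * B $ k)"] assms
    by (simp add: norm_mult)
  show ?thesis unfolding symbol_split by (rule norm_triangle_mono[OF 2 1])
qed

text \<open>The bound is uniform in \<open>s\<close>, so that the mean value inequality turns it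
  into a bound for difference quotients.\<close>

lemma wave_at_velocity_bound:
  fixes A B :: "complex ^ 'n::finite"
  assumes l: "l > 0" and R: "R > 0"
  obtains K where "\<And>s p. cmod (\<i> * symbol_at l A B s p * exp (phase_at l A B s p) * of_real (bump R p)) \<le> K * indicator (cball 0 R) p"
proof -
  define K where "K = (l * CARD('n) + 4 * cmod (\<Sum>k\<in>UNIV. A $ k * B $ k) + 2 * l * (coeff_size A B * R))
     * exp (coeff_size A B * R + 2 / l * cmod (\<Sum>k\<in>UNIV. A $ k * B $ k)) * exp 1"
  have "cmod (\<i> * symbol_at l A B s p * exp (phase_at l A B s p) * of_real (bump R p)) \<le> K * indicator (cball 0 R) p" for s p
  proof (cases "norm p \<le> R")
    case False
    then show ?thesis using bump_zero[OF R, of p] by simp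
  next
    case True
    have r: "norm (fst p) \<le> R" using norm_fst_le[of "fst p" "snd p"] True by simp
    have L: "coeff_size A B * norm (fst p) \<le> coeff_size A B * R" using r coeff_size_nonneg by (rule mult_left_mono)
    have 1: "cmod (symbol_at l A B s p) \<le> l * CARD('n) + 4 * cmod (\<Sum>k\<in>UNIV. A $ k * B $ k) + 2 * l * (coeff_size A B * R)"
      using symbol_at_bound[OF l, of A B s p] L l by (elim order_trans) simp
    have 2: "cmod (exp (phase_at l A B s p)) \<le> exp (coeff_size A B * R + 2 / l * cmod (\<Sum>k\<in>UNIV. A $ k * B $ k))"
    proof (rule order_trans[OF norm_exp_phase_le[OF norm_rot]])
      have "0 \<le> l / 4 * (norm (fst p))\<^sup>2" using l by simp
      then have "- l / 4 * (norm (fst p))\<^sup>2 + coeff_size A B * norm (fst p) + Re (drift l A B s)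
        \<le> coeff_size A B * R + 2 / l * cmod (\<Sum>k\<in>UNIV. A $ k * B $ k)"
        using L Re_drift_le[OF l, of A B s] by simp
      then show "exp (- l / 4 * (norm (fst p))\<^sup>2 + coeff_size A B * norm (fst p) + Re (drift l A B s))
        \<le> exp (coeff_size A B * R + 2 / l * cmod (\<Sum>k\<in>UNIV. A $ k * B $ k))" by simp
    qed
    have 3: "\<bar>bump R p\<bar> \<le> exp 1" using bump_bounds[of R p] by simp
    have "cmod (\<i> * symbol_at l A B s p * exp (phase_at l A B s p) * of_real (bump R p))
      = cmod (symbol_at l A B s p) * cmod (exp (phase_at l A B s p)) * \<bar>bump R p\<bar>"
      by (simp only: norm_mult norm_of_real norm_ii mult_1)
    also have "\<dots> \<le> K" unfolding K_def
      using 1 2 3 l R coeff_size_nonneg[of A B] by (intro mult_mono mult_nonneg_nonneg add_nonneg_nonneg) auto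
    finally show ?thesis using True by simp
  qed
  then show ?thesis by (rule that)
qed

text \<open>The quotient converges at every point, and the velocity bound dominates it by a multiple
  of the indicator of a ball; dominated convergence then upgrades the limit to the norm of
  \<open>L\<^sup>2\<close>.\<close>

lemma wave_at_strong_derivative:
  fixes A B :: "complex ^ 'n::finite"
  assumes l: "l > 0" and R: "R > 0"
  shows "((\<lambda>h. L2norm (\<lambda>p. (cnj (wave_at l A B R (s + h) p) - cnj (wave_at l A B R s p)) / of_real h
     - cnj (\<i> * symbol_at l A B s p * exp (phase_at l A B s p) * of_real (bump R p)))) \<longlongrightarrow> 0) (at 0)"
proof -
  let ?v = "\<lambda>s p. \<i> * symbol_at l A B s p * exp (phase_at l A B s p) * of_real (bump R p)"
  let ?w = "wave_at l A B R"
  have l0: "l \<noteq> 0" using l by simp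
  obtain K where K: "\<And>s p. cmod (?v s p) \<le> K * indicator (cball 0 R) p"
    using wave_at_velocity_bound[OF l R] by blast
  have lip: "cmod ((?w (s + h) p - ?w s p) / of_real h) \<le> K * indicator (cball 0 R) p" if "h \<noteq> 0" for h p
  proof -
    have "norm (?w (s + h) p - ?w s p) \<le> K * indicator (cball 0 R) p * norm (s + h - s)"
    proof (rule differentiable_bound[where S=UNIV])
      show "((\<lambda>s. ?w s p) has_derivative (\<lambda>x. x *\<^sub>R ?v t p)) (at t within UNIV)" for t
        using wave_at_derivative[OF l0] by (simp add: has_vector_derivative_def)
      show "onorm (\<lambda>x. x *\<^sub>R ?v t p) \<le> K * indicator (cball 0 R) p" for t
        by (rule onorm_le) (use mult_left_mono[OF K[of t p] abs_ge_zero] in \<open>simp add: mult.commute del: norm_mult\<close>)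
    qed auto
    then show ?thesis using that by (simp add: norm_divide divide_le_eq)
  qed
  have cw: "continuous_on UNIV (?w s)" for s by (rule smooth_gen_continuous[OF smooth_gen_wave])
  have cv: "continuous_on UNIV (?v s)" for s
    by (intro continuous_intros symbol_continuous phase_continuous)
  note [measurable] = borel_measurable_continuous_onI[OF cw] borel_measurable_continuous_onI[OF cv]
  show ?thesis
    unfolding tendsto_at_iff_sequentially
  proof (intro allI impI)
    fix X :: "nat \<Rightarrow> real" assume X: "\<forall>i. X i \<in> UNIV - {0}" "X \<longlonglongrightarrow> 0"
    let ?q = "\<lambda>i p. (cnj (?w (s + X i) p) - cnj (?w s p)) / of_real (X i) - cnj (?v s p)"
    have q: "cmod (?q i p) = cmod ((?w (s + X i) p - ?w s p) / of_real (X i) - ?v s p)" for i p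
      by (subst complex_mod_cnj[symmetric]) simp
    have lim: "(\<lambda>i. (cmod (?q i p))\<^sup>2) \<longlonglongrightarrow> 0" for p
    proof -
      have "((\<lambda>h. norm (?w (s + h) p - ?w s p - h *\<^sub>R ?v s p) / norm h) \<longlongrightarrow> 0) (at 0)"
        using wave_at_derivative[OF l0, of A B R p s]
        unfolding has_vector_derivative_def has_derivative_at by blast
      then have "(\<lambda>i. norm (?w (s + X i) p - ?w s p - X i *\<^sub>R ?v s p) / norm (X i)) \<longlonglongrightarrow> 0"
        using X unfolding tendsto_at_iff_sequentially o_def by blast
      then have "(\<lambda>i. cmod (?q i p)) \<longlonglongrightarrow> 0"
        using X(1) unfolding q by (simp add: norm_difference_quotient)
      from tendsto_power[OF this, of 2] show ?thesis by simp
    qed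
    have "(\<lambda>i. \<integral>p. (cmod (?q i p))\<^sup>2 \<partial>lborel) \<longlonglongrightarrow> (\<integral>p. 0 \<partial>(lborel :: 'n hpoint measure))"
    proof (rule integral_dominated_convergence[where w="\<lambda>p. (2 * K)\<^sup>2 * indicator (cball 0 R) p"])
      show "integrable lborel (\<lambda>p::'n hpoint. (2 * K)\<^sup>2 * indicator (cball 0 R) p :: real)"
        by (intro integrable_mult_right integrable_real_indicator) (use emeasure_bounded_finite[OF bounded_cball[of "0::'n hpoint" R]] in auto)
      show "AE p in lborel. (\<lambda>i. (cmod (?q i p))\<^sup>2) \<longlonglongrightarrow> 0" using lim by simp
      show "AE p in lborel. norm ((cmod (?q i p))\<^sup>2) \<le> (2 * K)\<^sup>2 * indicator (cball 0 R) p" for i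
      proof (rule AE_I2)
        fix p
        have "cmod (?q i p) \<le> 2 * K * indicator (cball 0 R) p"
          unfolding q using norm_triangle_ineq4[of "(?w (s + X i) p - ?w s p) / of_real (X i)" "?v s p"] lip[of "X i" p] K[of s p] X(1) by simp
        then have "(cmod (?q i p))\<^sup>2 \<le> (2 * K * indicator (cball 0 R) p)\<^sup>2" by (rule power_mono) simp
        moreover have "(2 * K * indicator (cball 0 R) p)\<^sup>2 = (2 * K)\<^sup>2 * indicator (cball 0 R) p"
          by (simp add: indicator_def)
        ultimately show "norm ((cmod (?q i p))\<^sup>2) \<le> (2 * K)\<^sup>2 * indicator (cball 0 R) p"
          by (simp only: real_norm_def abs_power2)
      qed
    qed measurable
    then have "(\<lambda>i. sqrt (\<integral>p. (cmod (?q i p))\<^sup>2 \<partial>lborel)) \<longlonglongrightarrow> sqrt 0" by (intro tendsto_real_sqrt) simp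
    then show "((\<lambda>h. L2norm (\<lambda>p. (cnj (?w (s + h) p) - cnj (?w s p)) / of_real h - cnj (?v s p))) \<circ> X) \<longlonglongrightarrow> 0"
      by (simp add: L2norm_def o_def)
  qed
qed

text \<open>The cutoff wave has \<open>L\<^sup>2\<close>-norm of order \<open>sqrt R\<close>, but its defect from solving the equation is a factor
  \<open>1 / R\<close> smaller, so the pairing is constant in \<open>s\<close> in the limit.\<close>

theorem wave_identity:
  fixes U :: "real \<Rightarrow> ('n::finite hpoint \<Rightarrow> complex) \<Rightarrow> ('n hpoint \<Rightarrow> complex)"
  assumes U: "schroedinger_group U" and f: "sq_int f" and l: "l > 0"
    and i0: "integrable lborel (\<lambda>p. f p * exp (phase_at l A B 0 p))"
    and i1: "integrable lborel (\<lambda>p. U s f p * exp (phase_at l A B s p))"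
  shows "(\<integral>p. U s f p * exp (phase_at l A B s p) \<partial>lborel) = (\<integral>p. f p * exp (phase_at l A B 0 p) \<partial>lborel)"
proof -
  note D = schroedinger_groupD[OF U]
  let ?v = "\<lambda>R s p. \<i> * symbol_at l A B s p * exp (phase_at l A B s p) * of_real (bump R p)"
  let ?w = "wave_at l A B"
  let ?F = "\<lambda>R s. \<integral>p. U s f p * cnj (cnj (?w R s p)) \<partial>lborel"
  obtain K where K: "\<And>R s. R \<ge> 1 \<Longrightarrow> L2norm (\<lambda>p. exp (phase_at l A B s p) * remainder l A B (rot l s) R p) \<le> K / sqrt R"
    using L2norm_error[OF l] by blast
  have bound: "cmod (?F R s - ?F R 0) \<le> L2norm f * (K / sqrt R) * \<bar>s\<bar>" if R: "R \<ge> 1" for R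
  proof -
    have R0: "R > 0" using R by simp
    let ?e = "\<lambda>t p. exp (phase_at l A B t p) * remainder l A B (rot l t) R p"
    have cw: "continuous_on UNIV (\<lambda>p. cnj (?w R t p))" for t
      by (intro continuous_intros smooth_gen_continuous[OF smooth_gen_wave])
    have cv: "continuous_on UNIV (\<lambda>p. cnj (?v R t p))" for t
      by (intro continuous_intros symbol_continuous phase_continuous)
    have ce: "continuous_on UNIV (?e t)" for t
      by (intro continuous_intros remainder_continuous phase_continuous)
    have cL: "continuous_on UNIV (\<lambda>p. cnj (exp (phase_at l A B t p) * (symbol_at l A B t p * of_real (bump R p) - remainder l A B (rot l t) R p)))" for t
      by (intro continuous_intros remainder_continuous phase_continuous symbol_continuous)
    have sw: "sq_int (\<lambda>p. cnj (?w R t p))" "test_fun (\<lambda>p. cnj (?w R t p))" for t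
    proof -
      have "cnj (?w R t p) = 0" if "norm p \<ge> R" for p :: "'n hpoint"
        using bump_zero[OF R0 that] by (simp add: wave_def)
      note * = this
      show "sq_int (\<lambda>p. cnj (?w R t p))" by (rule sq_int_cutoff[OF cw *])
      show "test_fun (\<lambda>p. cnj (?w R t p))" by (rule test_fun_cutoff[OF smooth_gen_cnj[OF smooth_gen_wave] *])
    qed
    have sv: "sq_int (\<lambda>p. cnj (?v R t p))" for t
      by (rule sq_int_cutoff[OF cv, of R]) (simp add: bump_zero[OF R0])
    have sL: "sq_int (sublaplacian (\<lambda>p. cnj (?w R t p)))" for t
      unfolding sublaplacian_wave_cnj[abs_def]
      by (rule sq_int_cutoff[OF cL, of R]) (simp add: bump_zero[OF R0] remainder_outside[OF R0])
    \<comment> \<open>The terms with the symbol cancel because the uncut wave is an exact solution;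
      only derivatives of the cutoff remain.\<close>
    have err: "cnj (?v R t p) + \<i> * sublaplacian (\<lambda>p. cnj (?w R t p)) p = cnj (\<i> * ?e t p)" for t p
      unfolding sublaplacian_wave_cnj by (simp add: algebra_simps)
    have der: "(?F R has_vector_derivative (\<integral>p. U t f p * cnj (cnj (\<i> * ?e t p)) \<partial>lborel)) (at t)" for t
      using schroedinger_pairing_derivative[where \<phi>="\<lambda>s p. cnj (?w R s p)" and \<psi>="\<lambda>p. cnj (?v R t p)", OF U f sw sv sL wave_at_strong_derivative[OF l R0]]
      unfolding err complex_cnj_cnj by simp
    have db: "cmod (\<integral>p. U t f p * cnj (cnj (\<i> * ?e t p)) \<partial>lborel) \<le> L2norm f * (K / sqrt R)" for t
    proof -
      have si: "sq_int (\<lambda>p. cnj (\<i> * ?e t p))"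
        by (rule sq_int_cutoff[of _ R]) (auto simp: remainder_outside[OF R0] intro!: continuous_intros ce simp del: complex_cnj_mult)
      have "cmod (\<integral>p. U t f p * cnj (cnj (\<i> * ?e t p)) \<partial>lborel) \<le> L2norm (U t f) * L2norm (\<lambda>p. cnj (\<i> * ?e t p))"
        by (rule L2_Cauchy_Schwarz[OF D(1)[OF f] si])
      also have "L2norm (\<lambda>p. cnj (\<i> * ?e t p)) = L2norm (?e t)"
        unfolding L2norm_def by (simp add: norm_mult)
      also have "L2norm (U t f) * L2norm (?e t) \<le> L2norm f * (K / sqrt R)"
        unfolding D(2)[OF f] by (intro mult_left_mono K[OF R] L2norm_nonneg)
      finally show ?thesis .
    qed
    have "norm (?F R s - ?F R 0) \<le> L2norm f * (K / sqrt R) * norm (s - 0)"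
    proof (rule differentiable_bound[where S=UNIV])
      show "(?F R has_derivative (\<lambda>x. x *\<^sub>R (\<integral>p. U t f p * cnj (cnj (\<i> * ?e t p)) \<partial>lborel))) (at t within UNIV)" for t
        using der[of t] by (simp add: has_vector_derivative_def)
      show "onorm (\<lambda>x. x *\<^sub>R (\<integral>p. U t f p * cnj (cnj (\<i> * ?e t p)) \<partial>lborel)) \<le> L2norm f * (K / sqrt R)" for t
        by (rule onorm_le) (use mult_left_mono[OF db[of t] abs_ge_zero] in \<open>simp only: norm_scaleR real_norm_def mult.commute\<close>)
    qed auto
    then show ?thesis by simp
  qed
  have R1: "real (Suc n) \<ge> 1" for n by simp
  \<comment> \<open>Stated for any representative \<open>g\<close> of \<open>U t f\<close>, so that
    at time 0 it can be \<open>f\<close> itself. The dominating function is the uncut integrand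
    times the bound \<open>exp 1\<close> of the bump.\<close>
  have lim: "(\<lambda>n. ?F (real (Suc n)) t) \<longlonglongrightarrow> (\<integral>p. g p * exp (phase_at l A B t p) \<partial>lborel)"
    if i: "integrable lborel (\<lambda>p. g p * exp (phase_at l A B t p))" and g: "AE p in lborel. U t f p = g p" "g \<in> borel_measurable borel" for t g
  proof -
    note [measurable] = g(2) borel_measurable_continuous_onI[OF phase_continuous]
      borel_measurable_continuous_onI[OF bump_continuous(1)] sq_int_measurable[OF D(1)[OF f]]
    have "?F R t = (\<integral>p. g p * exp (phase_at l A B t p) * of_real (bump R p) \<partial>lborel)" for R
      unfolding wave_def by (rule integral_cong_AE) (use g(1) in \<open>auto elim!: eventually_mono\<close>)
    moreover have "(\<lambda>n. \<integral>p. g p * exp (phase_at l A B t p) * of_real (bump (real (Suc n)) p) \<partial>lborel)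
       \<longlonglongrightarrow> (\<integral>p. g p * exp (phase_at l A B t p) \<partial>lborel)"
    proof (rule integral_dominated_convergence[where w="\<lambda>p. exp 1 * cmod (g p * exp (phase_at l A B t p))"])
      show "AE p in lborel. (\<lambda>n. g p * exp (phase_at l A B t p) * of_real (bump (real (Suc n)) p)) \<longlonglongrightarrow> g p * exp (phase_at l A B t p)"
      proof (rule AE_I2)
        fix p :: "'n hpoint"
        have "(\<lambda>n. bump (real (Suc n)) p) \<longlonglongrightarrow> 1"
          by (rule filterlim_compose[OF bump_tendsto filterlim_compose[OF filterlim_real_sequentially filterlim_Suc]])
        then have "(\<lambda>n. g p * exp (phase_at l A B t p) * of_real (bump (real (Suc n)) p)) \<longlonglongrightarrow> g p * exp (phase_at l A B t p) * of_real 1"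
          by (intro tendsto_intros)
        then show "(\<lambda>n. g p * exp (phase_at l A B t p) * of_real (bump (real (Suc n)) p)) \<longlonglongrightarrow> g p * exp (phase_at l A B t p)" by simp
      qed
      show "AE p in lborel. norm (g p * exp (phase_at l A B t p) * of_real (bump (real (Suc n)) p)) \<le> exp 1 * cmod (g p * exp (phase_at l A B t p))" for n
      proof (rule AE_I2)
        fix p :: "'n hpoint"
        have "\<bar>bump (real (Suc n)) p\<bar> \<le> exp 1" using bump_bounds[of "real (Suc n)" p] by linarith
        from mult_left_mono[OF this, of "cmod (g p * exp (phase_at l A B t p))"]
        show "norm (g p * exp (phase_at l A B t p) * of_real (bump (real (Suc n)) p)) \<le> exp 1 * cmod (g p * exp (phase_at l A B t p))"
          unfolding norm_mult[of _ "complex_of_real _"] norm_of_real by (simp only: mult.commute norm_ge_zero)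
      qed
      show "integrable lborel (\<lambda>p. exp 1 * cmod (g p * exp (phase_at l A B t p)))"
        by (rule integrable_mult_right[OF integrable_norm[OF i]])
    qed (use i in auto)
    ultimately show ?thesis by simp
  qed
  have "(\<lambda>n. ?F (real (Suc n)) s - ?F (real (Suc n)) 0) \<longlonglongrightarrow>
      (\<integral>p. U s f p * exp (phase_at l A B s p) \<partial>lborel) - (\<integral>p. f p * exp (phase_at l A B 0 p) \<partial>lborel)"
    by (intro tendsto_diff lim i1 i0) (use D(4)[OF f] sq_int_measurable[OF f] sq_int_measurable[OF D(1)[OF f]] in auto)
  moreover have "(\<lambda>n. ?F (real (Suc n)) s - ?F (real (Suc n)) 0) \<longlonglongrightarrow> 0"
  proof (rule Lim_null_comparison)
    have "filterlim (\<lambda>n. sqrt (real (Suc n))) at_top sequentially"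
      by (intro filterlim_compose[OF sqrt_at_top] filterlim_compose[OF filterlim_real_sequentially filterlim_Suc])
    then have "(\<lambda>n. K / sqrt (real (Suc n))) \<longlonglongrightarrow> 0" by (intro real_tendsto_divide_at_top[OF tendsto_const])
    then have "(\<lambda>n. L2norm f * (K / sqrt (real (Suc n))) * \<bar>s\<bar>) \<longlonglongrightarrow> L2norm f * 0 * \<bar>s\<bar>" by (intro tendsto_intros)
    then show "(\<lambda>n. L2norm f * (K / sqrt (real (Suc n))) * \<bar>s\<bar>) \<longlonglongrightarrow> 0" by simp
    show "\<forall>\<^sub>F n in sequentially. norm (?F (real (Suc n)) s - ?F (real (Suc n)) 0) \<le> L2norm f * (K / sqrt (real (Suc n))) * \<bar>s\<bar>"
      using bound[OF R1] by (intro always_eventually allI)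
  qed
  ultimately have "(\<integral>p. U s f p * exp (phase_at l A B s p) \<partial>lborel) - (\<integral>p. f p * exp (phase_at l A B 0 p) \<partial>lborel) = 0"
    by (rule LIMSEQ_unique)
  then show ?thesis by simp
qed

section \<open>The heat kernel\<close>

definition sinhc :: "complex \<Rightarrow> complex" where
  "sinhc u = (if u = 0 then 1 else sinh u / u)"

lemma holomorphic_sinh: "sinh holomorphic_on (S :: complex set)"
  by (rule holomorphic_onI) (auto intro!: derivative_eq_intros simp: field_differentiable_def intro: has_field_derivative_at_within)

lemma holomorphic_cosh: "cosh holomorphic_on (S :: complex set)"
  by (rule holomorphic_onI) (auto intro!: derivative_eq_intros simp: field_differentiable_def intro: has_field_derivative_at_within)

text \<open>With the singularity at 0 removed, the symbol of the heat kernel becomes holomorphic on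
  a whole strip, including the frequency 0 at which it is evaluated later.\<close>

lemma holomorphic_sinhc: "sinhc holomorphic_on S"
proof -
  have "(sinh has_field_derivative cosh 0) (at (0::complex))" by (auto intro!: derivative_eq_intros)
  then have "deriv sinh 0 = (1::complex)" by (simp add: DERIV_imp_deriv)
  then have eq: "sinhc = (\<lambda>z. if z = 0 then deriv sinh 0 else (sinh z - sinh 0) / (z - 0))"
    by (auto simp: sinhc_def)
  have "sinhc holomorphic_on UNIV" unfolding eq by (intro pole_lemma_open holomorphic_sinh open_UNIV)
  then show ?thesis by (rule holomorphic_on_subset) simp
qed

text \<open>Both bounds come from the cubic Taylor polynomial of \<open>exp\<close>. The linear one
  serves near 0; the cubic one gives quadratic decay of \<open>1 / sinhc\<close>, hence
  integrability of the symbol already in dimension 1.\<close>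

lemma real_sinh_lower: "\<bar>x\<bar> / 2 \<le> \<bar>sinh x\<bar>" "\<bar>x\<bar> ^ 3 / 12 \<le> \<bar>sinh x\<bar>" for x :: real
proof -
  have *: "x / 2 \<le> sinh x \<and> x ^ 3 / 12 \<le> sinh x" if x: "x \<ge> 0" for x :: real
  proof -
    have s: "(exp x - 1) / 2 \<le> sinh x" using x by (simp add: sinh_def)
    have "(\<Sum>n<4. x ^ n /\<^sub>R fact n) \<le> exp x"
      unfolding exp_def using x by (intro sum_le_suminf summable_exp_generic) auto
    then have "1 + x + x\<^sup>2 / 2 + x ^ 3 / 6 \<le> exp x"
      by (simp add: numeral_eq_Suc field_simps)
    moreover have "x\<^sup>2 \<ge> 0" "x ^ 3 \<ge> 0" using x by auto
    moreover have "x / 2 \<le> r \<and> b / 12 \<le> r" if "(e - 1) / 2 \<le> r" "1 + x + a / 2 + b / 6 \<le> e" "0 \<le> a" "0 \<le> b"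
      for a b e r :: real using that x by (simp add: field_simps)
    ultimately show ?thesis using s by blast
  qed
  show "\<bar>x\<bar> / 2 \<le> \<bar>sinh x\<bar>" "\<bar>x\<bar> ^ 3 / 12 \<le> \<bar>sinh x\<bar>"
    using *[of "\<bar>x\<bar>"] by (cases "x \<ge> 0"; force simp: abs_if split: if_splits)+
qed

lemma sin_lower: "\<bar>y\<bar> \<le> 1 \<Longrightarrow> \<bar>y\<bar> / 2 \<le> \<bar>sin y\<bar>" for y :: real
proof -
  assume y: "\<bar>y\<bar> \<le> 1"
  have "\<bar>sin y - (\<Sum>m<3. sin_coeff m * y ^ m)\<bar> \<le> inverse (fact 3) * \<bar>y\<bar> ^ 3" by (rule Maclaurin_sin_bound)
  then have "\<bar>sin y - y\<bar> \<le> \<bar>y\<bar> ^ 3 / 6" by (simp add: numeral_eq_Suc sin_coeff_def)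
  also have "\<bar>y\<bar> ^ 3 \<le> \<bar>y\<bar>" using y power_decreasing[of 1 3 "\<bar>y\<bar>"] by simp
  finally show ?thesis by linarith
qed

lemma Re_sinh: "Re (sinh z) = sinh (Re z) * cos (Im z)" and Im_sinh: "Im (sinh z) = cosh (Re z) * sin (Im z)"
  and Re_cosh: "Re (cosh z) = cosh (Re z) * cos (Im z)" and Im_cosh: "Im (cosh z) = sinh (Re z) * sin (Im z)"
  by (simp_all add: sinh_def cosh_def Re_exp Im_exp algebra_simps)

lemma norm_sinh_squared: "(cmod (sinh z))\<^sup>2 = (sinh (Re z))\<^sup>2 + (sin (Im z))\<^sup>2"
proof -
  have "(cmod (sinh z))\<^sup>2 = (sinh (Re z))\<^sup>2 * ((cos (Im z))\<^sup>2 + (sin (Im z))\<^sup>2) + (sin (Im z))\<^sup>2"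
    unfolding cmod_power2 Re_sinh Im_sinh power_mult_distrib cosh_square_eq by algebra
  also have "(cos (Im z))\<^sup>2 + (sin (Im z))\<^sup>2 = 1" by simp
  finally show ?thesis by simp
qed

text \<open>Since \<open>|sinh u|^2 = sinh (Re u)^2 + sin (Im u)^2\<close>, the real lower bounds
  for \<open>sinh\<close> and \<open>sin\<close> suffice. The constant 72 is crude and covers both
  cases.\<close>

lemma norm_sinh_lower:
  assumes "\<bar>Im u\<bar> \<le> 1"
  shows "cmod u * (1 + (Re u)\<^sup>2) \<le> 72 * cmod (sinh u)"
proof (cases "\<bar>Re u\<bar> \<le> 1")
  case True
  have "(\<bar>Re u\<bar> / 2)\<^sup>2 \<le> \<bar>sinh (Re u)\<bar>\<^sup>2" "(\<bar>Im u\<bar> / 2)\<^sup>2 \<le> \<bar>sin (Im u)\<bar>\<^sup>2"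
    by (intro power_mono real_sinh_lower sin_lower assms; simp)+
  then have "(cmod u)\<^sup>2 \<le> 4 * (cmod (sinh u))\<^sup>2"
    unfolding norm_sinh_squared by (simp add: cmod_power2 power_divide)
  then have "(cmod u)\<^sup>2 \<le> (2 * cmod (sinh u))\<^sup>2" by (simp add: power_mult_distrib)
  then have 1: "cmod u \<le> 2 * cmod (sinh u)" by (rule power2_le_imp_le) simp
  have "(Re u)\<^sup>2 \<le> 1" using True by (simp add: abs_square_le_1)
  then have "cmod u * (1 + (Re u)\<^sup>2) \<le> 2 * cmod (sinh u) * 2" using 1 by (intro mult_mono) auto
  also have "\<dots> \<le> 72 * cmod (sinh u)" by simp
  finally show ?thesis .
next
  case False
  have 1: "cmod u \<le> 2 * \<bar>Re u\<bar>" using cmod_le[of u] assms False by linarith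
  have "1 \<le> \<bar>Re u\<bar>\<^sup>2" using False by (intro one_le_power) simp
  then have "cmod u * (1 + (Re u)\<^sup>2) \<le> 2 * \<bar>Re u\<bar> * (2 * \<bar>Re u\<bar>\<^sup>2)" using 1 by (intro mult_mono) auto
  also have "\<dots> = 4 * \<bar>Re u\<bar> ^ 3" by (simp add: power2_eq_square power3_eq_cube)
  also have "\<dots> \<le> 48 * \<bar>sinh (Re u)\<bar>" using real_sinh_lower(2)[of "Re u"] by simp
  also have "\<dots> \<le> 72 * cmod (sinh u)"
  proof -
    have "\<bar>sinh (Re u)\<bar>\<^sup>2 \<le> (cmod (sinh u))\<^sup>2" unfolding norm_sinh_squared by simp
    then have "\<bar>sinh (Re u)\<bar> \<le> cmod (sinh u)" by (rule power2_le_imp_le) simp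
    then show ?thesis by simp
  qed
  finally show ?thesis .
qed

text \<open>For \<open>u = x + \<i> y\<close> away from 0 the real part of \<open>u * coth u\<close>
  is a positive multiple of \<open>x * sinh x * cosh x + y * sin y * cos y\<close>, and both terms
  are nonnegative as \<open>|y| \<le> 1 < pi / 2\<close>. This sign keeps the exponential factor of
  the heat symbol at most 1 in modulus for every \<open>z\<close>.\<close>

lemma sinhc_strip:
  assumes "\<bar>Im u\<bar> \<le> 1"
  shows "sinhc u \<noteq> 0" "cmod (1 / sinhc u) \<le> 72 / (1 + (Re u)\<^sup>2)" "0 \<le> Re (cosh u / sinhc u)"
proof -
  have p: "1 + (Re u)\<^sup>2 > 0" by (simp add: add_pos_nonneg)
  have lower: "(1 + (Re u)\<^sup>2) \<le> 72 * cmod (sinhc u)"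
  proof (cases "u = 0")
    case False
    then show ?thesis using norm_sinh_lower[OF assms]
      by (simp add: sinhc_def norm_divide field_simps)
  qed (simp add: sinhc_def)
  then have pos: "cmod (sinhc u) > 0" using p by linarith
  then show "sinhc u \<noteq> 0" by auto
  show "cmod (1 / sinhc u) \<le> 72 / (1 + (Re u)\<^sup>2)"
    using lower pos p by (simp add: norm_divide field_simps)
  show "0 \<le> Re (cosh u / sinhc u)"
  proof (cases "u = 0")
    case False
    have a: "0 \<le> Re u * sinh (Re u)"
      by (cases "Re u \<ge> 0") (auto simp: mult_nonpos_nonpos)
    have ys: "0 \<le> Im u * sin (Im u)"
    proof (cases "Im u \<ge> 0")
      case True
      then show ?thesis using assms pi_gt3 by (intro mult_nonneg_nonneg sin_ge_zero) auto
    next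
      case False
      then have "0 \<le> sin (- Im u)" using assms pi_gt3 by (intro sin_ge_zero) auto
      then show ?thesis using False by (simp add: mult_nonpos_nonpos)
    qed
    have co: "0 \<le> cos (Im u)" using assms pi_gt3 by (intro cos_ge_zero) auto
    have "sinh u \<noteq> 0" using pos False by (auto simp: sinhc_def)
    then have "cosh u / sinhc u = u * cosh u * cnj (sinh u) / (sinh u * cnj (sinh u))"
      using False by (simp add: sinhc_def)
    then have "cosh u / sinhc u = u * cosh u * cnj (sinh u) / of_real ((cmod (sinh u))\<^sup>2)"
      by (simp only: complex_norm_square)
    moreover have "Re (u * cosh u * cnj (sinh u)) = (Re u * sinh (Re u)) * cosh (Re u) + (Im u * sin (Im u)) * cos (Im u)"
    proof -
      have "Re (cosh u * cnj (sinh u)) = cosh (Re u) * sinh (Re u) * ((cos (Im u))\<^sup>2 + (sin (Im u))\<^sup>2)"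
        unfolding times_complex.sel cnj.sel Re_sinh Im_sinh Re_cosh Im_cosh by algebra
      moreover have "Im (cosh u * cnj (sinh u)) = - sin (Im u) * cos (Im u) * ((cosh (Re u))\<^sup>2 - (sinh (Re u))\<^sup>2)"
        unfolding times_complex.sel cnj.sel Re_sinh Im_sinh Re_cosh Im_cosh by algebra
      ultimately show ?thesis unfolding mult.assoc[of u] times_complex.sel(1)[of u] hyperbolic_pythagoras by simp
    qed
    ultimately have "Re (cosh u / sinhc u) = ((Re u * sinh (Re u)) * cosh (Re u) + (Im u * sin (Im u)) * cos (Im u)) / (cmod (sinh u))\<^sup>2"
      by (simp only: Re_divide_of_real)
    also have "\<dots> \<ge> 0" 
      by (intro divide_nonneg_nonneg add_nonneg_nonneg mult_nonneg_nonneg[OF a] mult_nonneg_nonneg[OF ys co]) auto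
    finally show ?thesis .
  qed (simp add: sinhc_def)
qed

section \<open>Shifting the line of integration, and Fourier inversion at one point\<close>

lemma integrable_inverse_quadratic:
  assumes "k > 0"
  shows "integrable lborel (\<lambda>x::real. K / (1 + k * x\<^sup>2))"
proof -
  have "integrable lborel (\<lambda>x::real. inverse (1 + x\<^sup>2))"
    using integrable_inverse_1_plus_square by (simp add: set_integrable_def)
  from lborel_integrable_real_affine[OF this, of "sqrt k" 0] assms
  have "integrable lborel (\<lambda>x::real. inverse (1 + k * x\<^sup>2))" by (simp add: power_mult_distrib)
  from integrable_mult_right[OF this, of K] show ?thesis by (simp add: divide_inverse)
qed

lemma tendsto_integral_symmetric:
  fixes f :: "real \<Rightarrow> complex"
  assumes "integrable lborel f"
  shows "(\<lambda>n. \<integral>x. indicator {- real n..real n} x *\<^sub>R f x \<partial>lborel) \<longlonglongrightarrow> integral\<^sup>L lborel f"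
proof (rule integral_dominated_convergence[where w="\<lambda>x. norm (f x)"])
  show "AE x in lborel. (\<lambda>n. indicator {- real n..real n} x *\<^sub>R f x) \<longlonglongrightarrow> f x"
  proof (rule AE_I2)
    fix x :: real
    obtain N :: nat where N: "\<bar>x\<bar> \<le> real N" using real_arch_simple by blast
    have "\<forall>\<^sub>F n in sequentially. indicator {- real n..real n} x *\<^sub>R f x = f x"
      using eventually_ge_at_top[of N] by eventually_elim (use N in \<open>auto simp: indicator_def\<close>)
    then show "(\<lambda>n. indicator {- real n..real n} x *\<^sub>R f x) \<longlonglongrightarrow> f x" by (rule tendsto_eventually)
  qed
  show "AE x in lborel. norm (indicator {- real n..real n} x *\<^sub>R f x) \<le> norm (f x)" for n
    by (simp add: indicator_def)
qed (use assms in auto)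

text \<open>A primitive on the convex strip replaces a contour integral. Over the interval from
  \<open>- n\<close> to \<open>n\<close> both line integrals are differences of its values, and they
  differ by its increments along the vertical segments at \<open>Re w = n\<close> and
  \<open>Re w = - n\<close>, which are of order \<open>1 / n^2\<close>.\<close>

lemma integral_horizontal_shift:
  fixes G :: "complex \<Rightarrow> complex"
  assumes hol: "G holomorphic_on {w. \<bar>Im w\<bar> < d}" and y: "\<bar>y\<bar> < d" and k: "k > 0"
    and bound: "\<And>w. \<bar>Im w\<bar> \<le> \<bar>y\<bar> \<Longrightarrow> cmod (G w) \<le> K / (1 + k * (Re w)\<^sup>2)"
  shows "integrable lborel (\<lambda>x. G (of_real x))" "integrable lborel (\<lambda>x. G (Complex x y))"
    "(\<integral>x. G (of_real x) \<partial>lborel) = (\<integral>x. G (Complex x y) \<partial>lborel)"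
proof -
  let ?S = "{w. \<bar>Im w\<bar> < d}"
  have Seq: "?S = {w. Im w < d} \<inter> {w. - d < Im w}" by auto
  have cS: "convex ?S" and oS: "open ?S" unfolding Seq
    by (intro convex_Int convex_halfspace_Im_lt convex_halfspace_Im_gt open_Int open_halfspace_Im_lt open_halfspace_Im_gt)+
  obtain P where P: "\<And>x. x \<in> ?S \<Longrightarrow> (P has_field_derivative G x) (at x within ?S)"
    using holomorphic_convex_primitive'[OF cS oS hol] by blast
  have cG: "continuous_on ?S G" using hol by (rule holomorphic_on_imp_continuous_on)
  have line: "integrable lborel (\<lambda>x. G (Complex x b)) \<and>
      (\<lambda>n. P (Complex (real n) b) - P (Complex (- real n) b)) \<longlonglongrightarrow> (\<integral>x. G (Complex x b) \<partial>lborel)"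
    if b: "\<bar>b\<bar> \<le> \<bar>y\<bar>" for b
  proof -
    have inS: "Complex x b \<in> ?S" for x using b y by simp
    have c: "continuous_on T (\<lambda>x. G (Complex x b))" for T
      by (rule continuous_on_compose2[OF cG]) (use inS in \<open>auto intro!: continuous_intros\<close>)
    have i: "integrable lborel (\<lambda>x. G (Complex x b))"
    proof (rule Bochner_Integration.integrable_bound[OF integrable_inverse_quadratic[OF k, of K]])
      show "(\<lambda>x. G (Complex x b)) \<in> borel_measurable lborel" using c by (simp add: borel_measurable_continuous_onI)
      show "AE x in lborel. norm (G (Complex x b)) \<le> norm (K / (1 + k * x\<^sup>2))"
      proof (rule AE_I2)
        fix x
        have "cmod (G (Complex x b)) \<le> K / (1 + k * x\<^sup>2)" using bound[of "Complex x b"] b by simp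
        also have "\<dots> \<le> norm (K / (1 + k * x\<^sup>2))" unfolding real_norm_def by (rule abs_ge_self)
        finally show "norm (G (Complex x b)) \<le> norm (K / (1 + k * x\<^sup>2))" .
      qed
    qed
    have "(\<integral>x. indicator {- real n..real n} x *\<^sub>R G (Complex x b) \<partial>lborel) = P (Complex (real n) b) - P (Complex (- real n) b)" for n
    proof (rule integral_FTC_Icc)
      fix x
      have d: "(P has_field_derivative G (Complex x b)) (at (Complex x b))"
        using P[OF inS, of x] at_within_open[OF inS oS] by metis
      have "((\<lambda>x. Complex x b) has_vector_derivative 1) (at x)"
        by (auto simp: has_vector_derivative_complex_iff intro!: derivative_eq_intros)
      from field_vector_diff_chain_at[OF this d]
      show "((\<lambda>x. P (Complex x b)) has_vector_derivative G (Complex x b)) (at x within {- real n..real n})"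
        by (simp add: o_def has_vector_derivative_at_within)
    qed (use c in auto)
    then show ?thesis using tendsto_integral_symmetric[OF i] i by simp
  qed
  have vert: "cmod (P (Complex x y) - P (Complex x 0)) \<le> K / (1 + k * x\<^sup>2) * \<bar>y\<bar>" for x
  proof -
    let ?T = "closed_segment (Complex x y) (Complex x 0)"
    have T: "Re w = x \<and> \<bar>Im w\<bar> \<le> \<bar>y\<bar>" if "w \<in> ?T" for w
    proof -
      from that obtain u where u: "0 \<le> u" "u \<le> 1" "w = (1 - u) *\<^sub>R Complex x y + u *\<^sub>R Complex x 0"
        unfolding closed_segment_def by blast
      have "\<bar>(1 - u) * y\<bar> \<le> \<bar>y\<bar>" using u by (simp add: abs_mult mult_left_le_one_le)
      then show ?thesis unfolding u(3) by (simp add: algebra_simps)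
    qed
    have "norm (P (Complex x y) - P (Complex x 0)) \<le> K / (1 + k * x\<^sup>2) * norm (Complex x y - Complex x 0)"
    proof (rule field_differentiable_bound[of ?T])
      fix w assume w: "w \<in> ?T"
      have "w \<in> ?S" using T[OF w] y by auto
      then show "(P has_field_derivative G w) (at w within ?T)"
        using P[of w] at_within_open[of w ?S] oS by (metis has_field_derivative_at_within)
      show "norm (G w) \<le> K / (1 + k * x\<^sup>2)" using bound[of w] T[OF w] by simp
    qed auto
    moreover have "norm (Complex x y - Complex x 0) = \<bar>y\<bar>" by (simp add: cmod_def)
    ultimately show ?thesis by simp
  qed
  have K0: "(\<lambda>n. K / (1 + k * (real n)\<^sup>2) * \<bar>y\<bar> + K / (1 + k * (real n)\<^sup>2) * \<bar>y\<bar>) \<longlonglongrightarrow> 0"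
    using k by real_asymp
  have "(\<lambda>n. (P (Complex (real n) y) - P (Complex (- real n) y)) - (P (Complex (real n) 0) - P (Complex (- real n) 0))) \<longlonglongrightarrow> 0"
  proof (rule Lim_null_comparison[OF always_eventually K0], rule allI)
    fix n
    have eq: "(P (Complex (real n) y) - P (Complex (- real n) y)) - (P (Complex (real n) 0) - P (Complex (- real n) 0))
      = (P (Complex (real n) y) - P (Complex (real n) 0)) - (P (Complex (- real n) y) - P (Complex (- real n) 0))" by simp
    show "norm ((P (Complex (real n) y) - P (Complex (- real n) y)) - (P (Complex (real n) 0) - P (Complex (- real n) 0)))
      \<le> K / (1 + k * (real n)\<^sup>2) * \<bar>y\<bar> + K / (1 + k * (real n)\<^sup>2) * \<bar>y\<bar>"
      unfolding eq by (rule order_trans[OF norm_triangle_ineq4 add_mono[OF vert]]) (use vert[of "- real n"] in simp)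
  qed
  moreover have "(\<lambda>n. (P (Complex (real n) y) - P (Complex (- real n) y)) - (P (Complex (real n) 0) - P (Complex (- real n) 0)))
     \<longlonglongrightarrow> (\<integral>x. G (Complex x y) \<partial>lborel) - (\<integral>x. G (Complex x 0) \<partial>lborel)"
    using line[of y] line[of 0] by (intro tendsto_diff) auto
  ultimately have "(\<integral>x. G (Complex x y) \<partial>lborel) - (\<integral>x. G (Complex x 0) \<partial>lborel) = 0"
    using LIMSEQ_unique by blast
  then show "(\<integral>x. G (of_real x) \<partial>lborel) = (\<integral>x. G (Complex x y) \<partial>lborel)"
    by (simp add: complex_of_real_def)
  show "integrable lborel (\<lambda>x. G (of_real x))" "integrable lborel (\<lambda>x. G (Complex x y))"
    using line[of 0] line[of y] by (simp_all add: complex_of_real_def)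
qed

text \<open>The double integrand is not jointly integrable. A Gaussian factor in
  \<open>e * t\<close> permits Fubini, and its transform concentrates at frequency 0 as
  \<open>e\<close> tends to 0.\<close>

lemma integral_inverse_fourier:
  fixes \<Phi> :: "real \<Rightarrow> complex"
  assumes \<Phi>: "integrable lborel \<Phi>" and c: "continuous_on UNIV \<Phi>" and B: "\<And>l. cmod (\<Phi> l) \<le> B"
    and q: "integrable lborel (\<lambda>t. \<integral>l. exp (- \<i> * of_real (l * t)) * \<Phi> l \<partial>lborel)"
  shows "(\<integral>t. (\<integral>l. exp (- \<i> * of_real (l * t)) * \<Phi> l \<partial>lborel) \<partial>lborel) = 2 * pi * \<Phi> 0"
proof -
  let ?q = "\<lambda>t. \<integral>l. exp (- \<i> * of_real (l * t)) * \<Phi> l \<partial>lborel"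
  let ?g = "\<lambda>x::real. exp (- x\<^sup>2 / 2)"
  have [measurable]: "\<Phi> \<in> borel_measurable borel" using c by (rule borel_measurable_continuous_onI)
  have g: "integrable lborel ?g" using integrable_gaussian[of "1/2", where 'a=real] by simp
  \<comment> \<open>Fubini together with the self-duality of the Gaussian; the factors of
    \<open>e\<close> from the two changes of variable cancel.\<close>
  have reg: "(\<integral>t. ?q t * of_real (?g (e * t)) \<partial>lborel) = of_real (sqrt (2 * pi)) * (\<integral>u. \<Phi> (e * u) * of_real (?g u) \<partial>lborel)"
    if e: "e > 0" for e
  proof -
    have ge: "integrable lborel (\<lambda>t. ?g (e * t))"
      using lborel_integrable_real_affine[OF g, of e 0] e by simp
    have "(\<integral>t. ?q t * of_real (?g (e * t)) \<partial>lborel)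
       = (\<integral>t. (\<integral>l. \<Phi> l * of_real (?g (e * t)) * exp (- \<i> * of_real (l * t)) \<partial>lborel) \<partial>lborel)"
      by (intro Bochner_Integration.integral_cong refl) (simp add: ac_simps flip: integral_mult_right_zero)
    also have "\<dots> = (\<integral>l. (\<integral>t. \<Phi> l * of_real (?g (e * t)) * exp (- \<i> * of_real (l * t)) \<partial>lborel) \<partial>lborel)"
      by (rule Fubini_bounded_kernel[OF \<Phi>, where B=1]) (use ge in auto)
    also have "\<dots> = (\<integral>l. of_real (sqrt (2 * pi) / e) * (\<Phi> l * of_real (?g (l / e))) \<partial>lborel)"
    proof (intro Bochner_Integration.integral_cong refl)
      fix l
      have "(\<integral>t. \<Phi> l * of_real (?g (e * t)) * exp (- \<i> * of_real (l * t)) \<partial>lborel)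
         = \<Phi> l * (\<integral>t. exp (- \<i> * of_real (l * t)) * of_real (?g (e * t)) \<partial>lborel)"
        by (simp add: ac_simps flip: integral_mult_right_zero)
      also have "(\<integral>t. exp (- \<i> * of_real (l * t)) * of_real (?g (e * t)) \<partial>lborel)
         = (1 / e) *\<^sub>R (\<integral>x. exp (\<i> * of_real (x * (- (l / e)))) * of_real (?g x) \<partial>lborel)"
        using e by (subst lborel_integral_real_affine[of "1 / e" _ 0]) (auto simp: field_simps)
      also have "\<dots> = of_real (sqrt (2 * pi) / e) * of_real (?g (l / e))"
        using fourier_gaussian_real[of "- (l / e)"] by (simp add: has_bochner_integral_iff scaleR_conv_of_real)
      finally show "(\<integral>t. \<Phi> l * of_real (?g (e * t)) * exp (- \<i> * of_real (l * t)) \<partial>lborel)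
         = of_real (sqrt (2 * pi) / e) * (\<Phi> l * of_real (?g (l / e)))" by simp
    qed
    also have "\<dots> = of_real (sqrt (2 * pi) / e) * (\<integral>l. \<Phi> l * of_real (?g (l / e)) \<partial>lborel)"
      by (rule integral_mult_right_zero)
    also have "(\<integral>l. \<Phi> l * of_real (?g (l / e)) \<partial>lborel) = e *\<^sub>R (\<integral>u. \<Phi> (e * u) * of_real (?g u) \<partial>lborel)"
      using e by (subst lborel_integral_real_affine[of e _ 0]) auto
    finally show ?thesis using e by (simp add: scaleR_conv_of_real)
  qed
  let ?e = "\<lambda>n::nat. 1 / real (Suc n)"
  have epos: "0 < ?e n" for n by simp
  have e0: "?e \<longlonglongrightarrow> 0" by (rule LIMSEQ_Suc[OF lim_1_over_n])
  have ex: "(\<lambda>n. ?e n * x) \<longlonglongrightarrow> 0" for x using tendsto_mult[OF e0 tendsto_const[of x]] by simp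
  have "(\<lambda>n. \<integral>t. ?q t * of_real (?g (?e n * t)) \<partial>lborel) \<longlonglongrightarrow> (\<integral>t. ?q t * of_real (?g 0) \<partial>lborel)"
  proof (rule integral_dominated_convergence[where w="\<lambda>t. norm (?q t)"])
    have "(\<lambda>n. ?g (?e n * t)) \<longlonglongrightarrow> ?g 0" for t by (intro tendsto_intros ex) simp
    then show "AE t in lborel. (\<lambda>n. ?q t * of_real (?g (?e n * t))) \<longlonglongrightarrow> ?q t * of_real (?g 0)"
      by (intro AE_I2 tendsto_mult tendsto_const tendsto_of_real)
    show "AE t in lborel. norm (?q t * of_real (?g (?e n * t))) \<le> norm (?q t)" for n
      by (simp add: norm_mult mult_left_le)
  qed (use q in auto)
  moreover have "(\<lambda>n. \<integral>u. \<Phi> (?e n * u) * of_real (?g u) \<partial>lborel) \<longlonglongrightarrow> (\<integral>u. \<Phi> 0 * of_real (?g u) \<partial>lborel)"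
  proof (rule integral_dominated_convergence[where w="\<lambda>u. B * ?g u"])
    have "(\<lambda>n. \<Phi> (?e n * u)) \<longlonglongrightarrow> \<Phi> 0" for u
      by (rule continuous_on_tendsto_compose[OF c ex]) auto
    then show "AE u in lborel. (\<lambda>n. \<Phi> (?e n * u) * of_real (?g u)) \<longlonglongrightarrow> \<Phi> 0 * of_real (?g u)"
      by (intro AE_I2 tendsto_mult tendsto_const)
    show "AE u in lborel. norm (\<Phi> (?e n * u) * of_real (?g u)) \<le> B * ?g u" for n
      using B by (simp add: norm_mult mult_right_mono)
  qed (use g in auto)
  then have "(\<lambda>n. of_real (sqrt (2 * pi)) * (\<integral>u. \<Phi> (?e n * u) * of_real (?g u) \<partial>lborel))
      \<longlonglongrightarrow> of_real (sqrt (2 * pi)) * (\<integral>u. \<Phi> 0 * of_real (?g u) \<partial>lborel)"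
    by (intro tendsto_mult tendsto_const)
  then have "(\<lambda>n. \<integral>t. ?q t * of_real (?g (?e n * t)) \<partial>lborel) \<longlonglongrightarrow> of_real (sqrt (2 * pi)) * (\<integral>u. \<Phi> 0 * of_real (?g u) \<partial>lborel)"
    by (simp only: reg[OF epos])
  ultimately have "(\<integral>t. ?q t * of_real (?g 0) \<partial>lborel) = of_real (sqrt (2 * pi)) * (\<integral>u. \<Phi> 0 * of_real (?g u) \<partial>lborel)"
    by (rule LIMSEQ_unique)
  also have "(\<integral>u. \<Phi> 0 * of_real (?g u) \<partial>lborel) = \<Phi> 0 * (\<integral>u. of_real (?g u) \<partial>lborel)"
    by (rule integral_mult_right_zero)
  also have "(\<integral>u. complex_of_real (?g u) \<partial>lborel) = of_real (sqrt (2 * pi))"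
    using fourier_gaussian_real[of 0] by (simp add: has_bochner_integral_iff)
  finally have "integral\<^sup>L lborel ?q = of_real (sqrt (2 * pi)) * (\<Phi> 0 * of_real (sqrt (2 * pi)))" by simp
  also have "\<dots> = of_real (sqrt (2 * pi) * sqrt (2 * pi)) * \<Phi> 0" by (simp only: of_real_mult ac_simps)
  also have "sqrt (2 * pi) * sqrt (2 * pi) = 2 * pi" by simp
  finally show ?thesis by simp
qed

section \<open>Decay and mass of the heat kernel\<close>

lemma of_real_sinh_complex: "complex_of_real (sinh x) = sinh (of_real x)"
  and of_real_cosh_complex: "complex_of_real (cosh x) = cosh (of_real x)"
  by (simp_all add: sinh_def cosh_def scaleR_conv_of_real exp_of_real[symmetric])

text \<open>The Fourier transform in \<open>t\<close> of the heat kernel at complex frequency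
  \<open>u\<close>, with \<open>m\<close> standing for \<open>(norm z)\<^sup>2 / 4\<close>; it is
  written through \<open>sinhc\<close> so that it extends across \<open>u = 0\<close>.\<close>

definition heat_symbol :: "nat \<Rightarrow> real \<Rightarrow> real \<Rightarrow> complex \<Rightarrow> complex" where
  "heat_symbol n s m u = of_real ((4 * pi) powr (- real n)) * (1 / (of_real s * sinhc (of_real s * u))) ^ n
     * exp (- of_real (m / s) * (cosh (of_real s * u) / sinhc (of_real s * u)))"

lemma heat_kernel_eq:
  fixes z :: "complex ^ 'n::finite"
  assumes s: "s > 0"
  shows "heat_kernel s (z, t) = of_real (1 / (2 * pi)) *
     (\<integral>l. exp (- \<i> * of_real (l * t)) * heat_symbol CARD('n) s ((norm z)\<^sup>2 / 4) (of_real l) \<partial>lborel)"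
proof -
  let ?n = "CARD('n)"
  let ?\<phi> = "\<lambda>l. of_real ((4 * pi) powr (- real ?n) * (l / sinh (l * s)) ^ ?n *
                 exp (- (1/4) * l * (cosh (s * l) / sinh (s * l)) * (norm z)\<^sup>2))"
  have eq: "?\<phi> l = heat_symbol ?n s ((norm z)\<^sup>2 / 4) (of_real l)" if "l \<noteq> 0" for l :: real
  proof -
    have sc: "sinhc (complex_of_real s * of_real l) = of_real (sinh (s * l)) / of_real (s * l)"
      using that s by (simp add: sinhc_def of_real_sinh_complex)
    have 1: "1 / (of_real s * sinhc (complex_of_real s * of_real l)) = of_real (l / sinh (l * s))"
      unfolding sc using s that by (simp add: mult.commute)
    have 2: "- complex_of_real ((norm z)\<^sup>2 / 4 / s) * (cosh (of_real s * of_real l) / sinhc (of_real s * of_real l))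
       = of_real (- (1/4) * l * (cosh (s * l) / sinh (s * l)) * (norm z)\<^sup>2)"
      unfolding sc using s that by (simp add: of_real_cosh_complex field_simps)
    show ?thesis unfolding heat_symbol_def 1 2 exp_of_real by (simp only: of_real_mult of_real_power)
  qed
  have "(\<integral>l. exp (- \<i> * of_real (l * t)) * ?\<phi> l \<partial>lborel)
      = (\<integral>l. exp (- \<i> * of_real (l * t)) * heat_symbol ?n s ((norm z)\<^sup>2 / 4) (of_real l) \<partial>lborel)"
  proof (rule integral_cong_AE)
    show "AE l in lborel. exp (- \<i> * of_real (l * t)) * ?\<phi> l = exp (- \<i> * of_real (l * t)) * heat_symbol ?n s ((norm z)\<^sup>2 / 4) (of_real l)"
      using AE_lborel_singleton[of "0::real"] by eventually_elim (drule eq, simp only:)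
    have [measurable]: "(\<lambda>l::real. sinh l) \<in> borel_measurable borel" "(\<lambda>l::real. cosh l) \<in> borel_measurable borel"
      by (intro borel_measurable_continuous_onI continuous_intros; simp)+
    show "(\<lambda>l. exp (- \<i> * of_real (l * t)) * ?\<phi> l) \<in> borel_measurable lborel" by measurable
    have "continuous_on UNIV sinhc" by (rule holomorphic_on_imp_continuous_on[OF holomorphic_sinhc])
    then have [measurable]: "sinhc \<in> borel_measurable borel" by (rule borel_measurable_continuous_onI)
    have "continuous_on UNIV (cosh :: complex \<Rightarrow> complex)" by (rule holomorphic_on_imp_continuous_on[OF holomorphic_cosh])
    then have [measurable]: "(cosh :: complex \<Rightarrow> complex) \<in> borel_measurable borel" by (rule borel_measurable_continuous_onI)
    show "(\<lambda>l. exp (- \<i> * of_real (l * t)) * heat_symbol ?n s ((norm z)\<^sup>2 / 4) (of_real l)) \<in> borel_measurable lborel"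
      unfolding heat_symbol_def by measurable
  qed
  then show ?thesis by (simp add: heat_kernel_def Let_def)
qed

lemma heat_symbol_holomorphic:
  assumes s: "s > 0"
  shows "heat_symbol n s m holomorphic_on {u. \<bar>Im u\<bar> < 1 / s}"
proof -
  have c: "(\<lambda>u. of_real s * u) holomorphic_on S" for S by (intro holomorphic_intros)
  have "(\<lambda>u. sinhc (of_real s * u)) holomorphic_on {u. \<bar>Im u\<bar> < 1 / s}"
    "(\<lambda>u. cosh (of_real s * u)) holomorphic_on {u. \<bar>Im u\<bar> < 1 / s}"
    using holomorphic_on_compose[OF c holomorphic_sinhc] holomorphic_on_compose[OF c holomorphic_cosh] by (simp_all add: o_def)
  moreover have "sinhc (of_real s * u) \<noteq> 0" if "\<bar>Im u\<bar> < 1 / s" for u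
    using that s by (intro sinhc_strip) (simp add: abs_mult field_simps)
  ultimately show ?thesis
    unfolding heat_symbol_def using s by (intro holomorphic_intros) auto
qed

text \<open>One power of \<open>1 / sinhc\<close> gives the decay in \<open>Re u\<close>, and the
  other powers are bounded. The exponential has modulus at most 1 because its exponent has
  nonpositive real part, so the bound does not depend on \<open>m\<close>.\<close>

lemma heat_symbol_bound:
  assumes s: "s > 0" and m: "m \<ge> 0" and n: "n \<ge> 1" and u: "\<bar>Im u\<bar> \<le> 1 / s"
  shows "cmod (heat_symbol n s m u) \<le> (4 * pi) powr (- real n) * (72 / s) ^ n / (1 + s\<^sup>2 * (Re u)\<^sup>2)"
proof -
  have su: "\<bar>Im (of_real s * u)\<bar> \<le> 1" using u s by (simp add: abs_mult field_simps)
  let ?q = "1 + s\<^sup>2 * (Re u)\<^sup>2"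
  have q: "?q \<ge> 1" by simp
  have 1: "cmod (1 / (of_real s * sinhc (of_real s * u))) \<le> (72 / s) / ?q"
  proof -
    have "cmod (1 / (of_real s * sinhc (of_real s * u))) = (1 / s) * cmod (1 / sinhc (of_real s * u))"
      using s by (simp add: norm_divide norm_mult)
    also have "\<dots> \<le> (1 / s) * (72 / (1 + (Re (of_real s * u))\<^sup>2))"
      using sinhc_strip(2)[OF su] s by (intro mult_left_mono) auto
    finally show ?thesis by (simp add: power_mult_distrib)
  qed
  have "cmod ((1 / (of_real s * sinhc (of_real s * u))) ^ n) \<le> ((72 / s) / ?q) ^ n"
    unfolding norm_power using 1 by (intro power_mono) auto
  also have "\<dots> = (72 / s) ^ n / ?q ^ n" by (rule power_divide)
  also have "\<dots> \<le> (72 / s) ^ n / ?q"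
    using q n s power_increasing[of 1 n ?q] by (intro divide_left_mono mult_pos_pos zero_less_power) (auto simp: add_pos_nonneg)
  finally have 2: "cmod ((1 / (of_real s * sinhc (of_real s * u))) ^ n) \<le> (72 / s) ^ n / ?q" .
  have e1: "cmod (exp (- of_real (m / s) * (cosh (of_real s * u) / sinhc (of_real s * u)))) \<le> 1"
  proof -
    have Re_mult: "Re (- complex_of_real r * x) = - (r * Re x)" for r x by simp
    have "Re (- of_real (m / s) * (cosh (of_real s * u) / sinhc (of_real s * u))) = - (m / s * Re (cosh (of_real s * u) / sinhc (of_real s * u)))"
      by (rule Re_mult)
    also have "\<dots> \<le> 0" using mult_nonneg_nonneg[OF _ sinhc_strip(3)[OF su], of "m / s"] m s by simp
    finally show ?thesis unfolding norm_exp_eq_Re by simp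
  qed
  have prod: "cmod (complex_of_real a * x * y) \<le> a * b * 1" if "0 \<le> a" "cmod x \<le> b" "cmod y \<le> 1" for a b x y
    unfolding norm_mult norm_of_real using that order_trans[OF norm_ge_zero that(2)] by (intro mult_mono) auto
  have "cmod (heat_symbol n s m u) \<le> (4 * pi) powr (- real n) * ((72 / s) ^ n / ?q) * 1"
    unfolding heat_symbol_def by (rule prod[OF _ 2 e1]) simp
  then show ?thesis by simp
qed

lemma heat_symbol_zero: "heat_symbol n s m 0 = of_real ((4 * pi) powr (- real n) * (1 / s) ^ n * exp (- m / s))"
  by (simp add: heat_symbol_def sinhc_def exp_of_real[symmetric])

text \<open>Moving the line of integration halfway to the edge of the strip, to a height of modulus
  \<open>1 / (2 * s)\<close>, gains the exponential factor. The constant is uniform in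
  \<open>z\<close> because the bound for the symbol is.\<close>

lemma heat_kernel_bound:
  assumes s: "s > 0"
  obtains K where "\<And>(z :: complex ^ 'n::finite) t. cmod (heat_kernel s (z, t)) \<le> K * exp (- \<bar>t\<bar> / (2 * s))"
proof -
  let ?n = "CARD('n)"
  have n: "?n \<ge> 1" by (simp add: Suc_le_eq)
  define K0 where "K0 = (4 * pi) powr (- real ?n) * (72 / s) ^ ?n"
  define I where "I = (\<integral>x. K0 / (1 + s\<^sup>2 * x\<^sup>2) \<partial>(lborel :: real measure))"
  have K0: "K0 \<ge> 0" using s by (simp add: K0_def)
  have "cmod (heat_kernel s (z, t)) \<le> (1 / (2 * pi) * I) * exp (- \<bar>t\<bar> / (2 * s))" for z :: "complex ^ 'n" and t
  proof -
    let ?\<Phi> = "heat_symbol ?n s ((norm z)\<^sup>2 / 4)"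
    let ?G = "\<lambda>u. exp (- \<i> * of_real t * u) * ?\<Phi> u"
    \<comment> \<open>As \<open>|exp (- \<i> * t * u)| = exp (t * Im u)\<close>, the line moves to
      the side on which \<open>t * y\<close> is nonpositive.\<close>
    define y where "y = (if t \<ge> 0 then - (1 / (2 * s)) else 1 / (2 * s))"
    have ya: "\<bar>y\<bar> = 1 / (2 * s)" "y * t = - \<bar>t\<bar> / (2 * s)" using s by (auto simp: y_def)
    have y1: "\<bar>y\<bar> < 1 / s" using s unfolding ya by (simp add: field_simps)
    have \<Phi>b: "cmod (?\<Phi> u) \<le> K0 / (1 + s\<^sup>2 * (Re u)\<^sup>2)" if "\<bar>Im u\<bar> \<le> \<bar>y\<bar>" for u
      unfolding K0_def using that y1 by (intro heat_symbol_bound s n) auto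
    have nG: "cmod (?G u) = exp (t * Im u) * cmod (?\<Phi> u)" for u by (simp add: norm_mult)
    have Gb: "cmod (?G u) \<le> (exp (\<bar>t\<bar> * \<bar>y\<bar>) * K0) / (1 + s\<^sup>2 * (Re u)\<^sup>2)" if "\<bar>Im u\<bar> \<le> \<bar>y\<bar>" for u
    proof -
      have "\<bar>t * Im u\<bar> \<le> \<bar>t\<bar> * \<bar>y\<bar>" unfolding abs_mult using that by (intro mult_left_mono) auto
      then have "t * Im u \<le> \<bar>t\<bar> * \<bar>y\<bar>" by (rule order_trans[OF abs_ge_self])
      then have "exp (t * Im u) * cmod (?\<Phi> u) \<le> exp (\<bar>t\<bar> * \<bar>y\<bar>) * (K0 / (1 + s\<^sup>2 * (Re u)\<^sup>2))"
        using \<Phi>b[OF that] by (intro mult_mono) auto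
      then show ?thesis unfolding nG by simp
    qed
    have "?G holomorphic_on {w. \<bar>Im w\<bar> < 1 / s}"
      by (intro holomorphic_intros heat_symbol_holomorphic s)
    note shift = integral_horizontal_shift[OF this y1 _ Gb]
    have s2: "s\<^sup>2 > 0" using s by simp
    have "heat_kernel s (z, t) = of_real (1 / (2 * pi)) * (\<integral>l. ?G (of_real l) \<partial>lborel)"
      unfolding heat_kernel_eq[OF s] by (simp add: mult.assoc mult.commute[of "of_real t"])
    also have "(\<integral>l. ?G (of_real l) \<partial>lborel) = (\<integral>l. ?G (Complex l y) \<partial>lborel)" by (rule shift(3)[OF s2])
    finally have "cmod (heat_kernel s (z, t)) = 1 / (2 * pi) * cmod (\<integral>l. ?G (Complex l y) \<partial>lborel)"
      by (simp only: norm_mult norm_of_real) simp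
    also have "cmod (\<integral>l. ?G (Complex l y) \<partial>lborel) \<le> (\<integral>l. exp (- \<bar>t\<bar> / (2 * s)) * (K0 / (1 + s\<^sup>2 * l\<^sup>2)) \<partial>lborel)"
    proof (rule order_trans[OF integral_norm_bound integral_mono])
      show "integrable lborel (\<lambda>l. norm (?G (Complex l y)))" by (rule integrable_norm[OF shift(2)[OF s2]])
      show "integrable lborel (\<lambda>l. exp (- \<bar>t\<bar> / (2 * s)) * (K0 / (1 + s\<^sup>2 * l\<^sup>2)))"
        by (intro integrable_mult_right integrable_inverse_quadratic s2)
      show "norm (?G (Complex l y)) \<le> exp (- \<bar>t\<bar> / (2 * s)) * (K0 / (1 + s\<^sup>2 * l\<^sup>2))" for l
        unfolding nG using \<Phi>b[of "Complex l y"] ya(2) by (intro mult_mono) (auto simp: mult.commute)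
    qed
    also have "\<dots> = exp (- \<bar>t\<bar> / (2 * s)) * I" unfolding I_def by (rule integral_mult_right_zero)
    finally show ?thesis by (simp add: field_simps)
  qed
  then show ?thesis by (rule that)
qed

lemma integrable_exp_neg_abs:
  assumes c: "c > 0"
  shows "integrable lborel (\<lambda>t::real. exp (- c * \<bar>t\<bar>))"
proof (rule Bochner_Integration.integrable_bound[OF integrable_inverse_quadratic[of "c\<^sup>2 / 2" 1]])
  show "c\<^sup>2 / 2 > 0" using c by simp
  show "AE t in lborel. norm (exp (- c * \<bar>t\<bar>)) \<le> norm (1 / (1 + c\<^sup>2 / 2 * t\<^sup>2))"
  proof (rule AE_I2)
    fix t :: real
    have p: "1 + c\<^sup>2 / 2 * t\<^sup>2 > 0" by (intro add_pos_nonneg) auto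
    have "1 + c * \<bar>t\<bar> + (c * \<bar>t\<bar>)\<^sup>2 / 2 \<le> exp (c * \<bar>t\<bar>)" by (rule exp_lower_Taylor_quadratic) (use c in simp)
    moreover have "0 \<le> c * \<bar>t\<bar>" using c by simp
    moreover have "(c * \<bar>t\<bar>)\<^sup>2 / 2 = c\<^sup>2 / 2 * t\<^sup>2" by (simp add: power_mult_distrib)
    ultimately have "1 + c\<^sup>2 / 2 * t\<^sup>2 \<le> exp (c * \<bar>t\<bar>)" by simp
    then have "exp (- c * \<bar>t\<bar>) \<le> 1 / (1 + c\<^sup>2 / 2 * t\<^sup>2)" using p by (simp add: exp_minus field_simps)
    then show "norm (exp (- c * \<bar>t\<bar>)) \<le> norm (1 / (1 + c\<^sup>2 / 2 * t\<^sup>2))" using p by simp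
  qed
qed auto

text \<open>The mass over a fibre is the symbol at frequency 0, a Gaussian in \<open>z\<close>. The
  exponential bound supplies the integrability in \<open>t\<close> that inversion requires.\<close>

lemma heat_kernel_integral:
  fixes z :: "complex ^ 'n::finite"
  assumes s: "s > 0"
  shows "has_bochner_integral lborel (\<lambda>t. heat_kernel s (z, t))
    (of_real ((4 * pi) powr (- real CARD('n)) * (1 / s) ^ CARD('n) * exp (- (norm z)\<^sup>2 / (4 * s))))"
proof -
  let ?n = "CARD('n)"
  have n: "?n \<ge> 1" by (simp add: Suc_le_eq)
  let ?\<Phi> = "\<lambda>l. heat_symbol ?n s ((norm z)\<^sup>2 / 4) (of_real l)"
  define K0 where "K0 = (4 * pi) powr (- real ?n) * (72 / s) ^ ?n"
  have K0: "K0 \<ge> 0" using s by (simp add: K0_def)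
  have hol: "heat_symbol ?n s ((norm z)\<^sup>2 / 4) holomorphic_on {u. \<bar>Im u\<bar> < 1 / s}" by (rule heat_symbol_holomorphic[OF s])
  have c: "continuous_on UNIV ?\<Phi>"
    by (rule continuous_on_compose2[OF holomorphic_on_imp_continuous_on[OF hol]]) (use s in \<open>auto intro!: continuous_intros\<close>)
  then have [measurable]: "?\<Phi> \<in> borel_measurable borel" by (rule borel_measurable_continuous_onI)
  have b: "cmod (?\<Phi> l) \<le> K0 / (1 + s\<^sup>2 * l\<^sup>2)" for l
    using heat_symbol_bound[OF s _ n, of "(norm z)\<^sup>2 / 4" "of_real l"] s by (simp add: K0_def)
  have i: "integrable lborel ?\<Phi>"
    by (rule Bochner_Integration.integrable_bound[OF integrable_inverse_quadratic[of "s\<^sup>2" K0]])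
      (use s b order_trans[OF b abs_ge_self] in auto)
  have B: "cmod (?\<Phi> l) \<le> K0" for l
    using b[of l] K0 by (elim order_trans) (simp add: divide_le_eq add_pos_nonneg mult_left_le[of _ K0] field_simps)
  obtain K where K: "\<And>(z :: complex ^ 'n) t. cmod (heat_kernel s (z, t)) \<le> K * exp (- \<bar>t\<bar> / (2 * s))"
    using heat_kernel_bound[OF s] by blast
  have m: "(\<lambda>t. heat_kernel s (z, t)) \<in> borel_measurable borel"
    unfolding heat_kernel_eq[OF s] by measurable
  have hk: "integrable lborel (\<lambda>t. heat_kernel s (z, t))"
  proof (rule Bochner_Integration.integrable_bound)
    show "integrable lborel (\<lambda>t. K * exp (- (1 / (2 * s)) * \<bar>t\<bar>))"
      using s by (intro integrable_mult_right integrable_exp_neg_abs) simp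
    show "AE t in lborel. norm (heat_kernel s (z, t)) \<le> norm (K * exp (- (1 / (2 * s)) * \<bar>t\<bar>))"
      using order_trans[OF K abs_ge_self] by (intro AE_I2) simp
  qed (use m in simp)
  let ?q = "\<lambda>t. \<integral>l. exp (- \<i> * of_real (l * t)) * ?\<Phi> l \<partial>lborel"
  have q: "?q t = of_real (2 * pi) * heat_kernel s (z, t)" for t
    unfolding heat_kernel_eq[OF s] by simp
  have qi: "integrable lborel ?q" unfolding q by (rule integrable_mult_right[OF hk])
  have "of_real (2 * pi) * (\<integral>t. heat_kernel s (z, t) \<partial>lborel) = (\<integral>t. ?q t \<partial>lborel)"
    unfolding q by (rule integral_mult_right_zero[symmetric])
  also have "\<dots> = 2 * pi * ?\<Phi> 0" by (rule integral_inverse_fourier[OF i c B qi])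
  finally have "(\<integral>t. heat_kernel s (z, t) \<partial>lborel) = ?\<Phi> 0" by simp
  then show ?thesis using hk by (simp add: has_bochner_integral_iff heat_symbol_zero)
qed

section \<open>The Fock transform\<close>

text \<open>Tonelli with \<open>t\<close> innermost: the weight is bounded by a function of
  \<open>z\<close> alone, so only the mass of \<open>f\<close> on each fibre matters.\<close>

lemma fibre_dominated_integral:
  fixes f h :: "'a::euclidean_space \<times> real \<Rightarrow> complex"
  assumes [measurable]: "f \<in> borel_measurable borel" "h \<in> borel_measurable borel"
    and fib: "AE z in lborel. (\<integral>\<^sup>+t. ennreal (cmod (f (z, t))) \<partial>lborel) \<le> ennreal (D z)"
    and hb: "\<And>p. cmod (h p) \<le> W (fst p)" and D: "\<And>z. 0 \<le> D z"
    and int: "integrable lborel (\<lambda>z. W z * D z)"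
  shows "integrable lborel (\<lambda>p. f p * h p)" "cmod (\<integral>p. f p * h p \<partial>lborel) \<le> (\<integral>z. W z * D z \<partial>lborel)"
proof -
  have W: "0 \<le> W z" for z using order_trans[OF norm_ge_zero hb[of "(z, 0)"]] by simp
  have m: "(\<lambda>p. ennreal (cmod (f p * h p))) \<in> borel_measurable (lborel \<Otimes>\<^sub>M lborel)"
    unfolding lborel_prod by measurable
  have "(\<integral>\<^sup>+p. ennreal (cmod (f p * h p)) \<partial>lborel) = (\<integral>\<^sup>+z. (\<integral>\<^sup>+t. ennreal (cmod (f (z, t) * h (z, t))) \<partial>lborel) \<partial>lborel)"
    using lborel.nn_integral_fst[OF m] by (simp add: lborel_prod)
  also have "\<dots> \<le> (\<integral>\<^sup>+z. ennreal (W z * D z) \<partial>lborel)"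
  proof (rule nn_integral_mono_AE, use fib in eventually_elim)
    fix z assume z: "(\<integral>\<^sup>+t. ennreal (cmod (f (z, t))) \<partial>lborel) \<le> ennreal (D z)"
    have "(\<integral>\<^sup>+t. ennreal (cmod (f (z, t) * h (z, t))) \<partial>lborel) \<le> (\<integral>\<^sup>+t. ennreal (W z) * ennreal (cmod (f (z, t))) \<partial>lborel)"
    proof (rule nn_integral_mono)
      fix t
      have "cmod (f (z, t) * h (z, t)) \<le> W z * cmod (f (z, t))"
        using mult_right_mono[OF hb[of "(z, t)"], of "cmod (f (z, t))"] by (simp add: norm_mult mult.commute)
      then show "ennreal (cmod (f (z, t) * h (z, t))) \<le> ennreal (W z) * ennreal (cmod (f (z, t)))"
        using W[of z] by (simp add: ennreal_leI flip: ennreal_mult)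
    qed
    also have "\<dots> = ennreal (W z) * (\<integral>\<^sup>+t. ennreal (cmod (f (z, t))) \<partial>lborel)"
      by (rule nn_integral_cmult) measurable
    also have "\<dots> \<le> ennreal (W z) * ennreal (D z)" using z by (rule mult_left_mono) simp
    also have "\<dots> = ennreal (W z * D z)" using W[of z] D[of z] by (simp add: ennreal_mult)
    finally show "(\<integral>\<^sup>+t. ennreal (cmod (f (z, t) * h (z, t))) \<partial>lborel) \<le> ennreal (W z * D z)" .
  qed
  also have "\<dots> = ennreal (\<integral>z. W z * D z \<partial>lborel)"
    using int W D by (intro nn_integral_eq_integral) auto
  finally have N: "(\<integral>\<^sup>+p. ennreal (cmod (f p * h p)) \<partial>lborel) \<le> ennreal (\<integral>z. W z * D z \<partial>lborel)" .
  show i: "integrable lborel (\<lambda>p. f p * h p)"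
    by (rule integrableI_bounded) (use le_less_trans[OF N] in \<open>auto simp: norm_mult\<close>)
  have "ennreal (cmod (\<integral>p. f p * h p \<partial>lborel)) \<le> ennreal (\<integral>z. W z * D z \<partial>lborel)"
    using integral_norm_bound_ennreal[OF i] N by (rule order_trans)
  moreover have "0 \<le> (\<integral>z. W z * D z \<partial>lborel)" using W D by simp
  ultimately show "cmod (\<integral>p. f p * h p \<partial>lborel) \<le> (\<integral>z. W z * D z \<partial>lborel)" by (simp add: ennreal_le_iff)
qed

lemma AE_fibres: "AE p in (lborel :: ('a::euclidean_space \<times> 'b::euclidean_space) measure). P p \<Longrightarrow> AE x in lborel. AE y in lborel. P (x, y)"
  unfolding lborel_prod[symmetric] by (rule lborel_pair.AE_pair)

text \<open>Integrating the kernel bound over a fibre replaces the heat kernel by its mass, a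
  Gaussian in \<open>z\<close> with coefficient \<open>1 / (4 * a)\<close>. The growth estimates for
  the transform start from this.\<close>

lemma heat_dominated_fibre_mass:
  fixes f :: "'n::finite hpoint \<Rightarrow> complex"
  assumes a: "a > 0" and C: "C > 0" and [measurable]: "f \<in> borel_measurable borel"
    and dom: "AE p in lborel. cmod (f p) \<le> C * Re (heat_kernel a p)"
  obtains Q where "Q \<ge> 0"
    "AE z in lborel. (\<integral>\<^sup>+t. ennreal (cmod (f (z, t))) \<partial>lborel) \<le> ennreal (Q * exp (- (1 / (4 * a)) * (norm z)\<^sup>2))"
proof
  let ?Q = "C * ((4 * pi) powr (- real CARD('n)) * (1 / a) ^ CARD('n))"
  show "?Q \<ge> 0" using C a by simp
  show "AE z in lborel. (\<integral>\<^sup>+t. ennreal (cmod (f (z, t))) \<partial>lborel) \<le> ennreal (?Q * exp (- (1 / (4 * a)) * (norm z)\<^sup>2))"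
    using AE_fibres[OF dom]
  proof eventually_elim
    fix z assume z: "AE t in lborel. cmod (f (z, t)) \<le> C * Re (heat_kernel a (z, t))"
    note hk = heat_kernel_integral[OF a, of z]
    have i: "integrable lborel (\<lambda>t. C * Re (heat_kernel a (z, t)))"
      using hk by (intro integrable_mult_right integrable_Re) (simp add: has_bochner_integral_iff)
    have fi: "integrable lborel (\<lambda>t. cmod (f (z, t)))"
      by (rule Bochner_Integration.integrable_bound[OF i], measurable) (use z in \<open>auto elim!: eventually_mono\<close>)
    have "(\<integral>t. cmod (f (z, t)) \<partial>lborel) \<le> (\<integral>t. C * Re (heat_kernel a (z, t)) \<partial>lborel)"
      by (rule integral_mono_AE[OF fi i z])
    also have "\<dots> = C * Re (\<integral>t. heat_kernel a (z, t) \<partial>lborel)"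
      using hk by (simp add: has_bochner_integral_iff)
    also have "\<dots> = ?Q * exp (- (1 / (4 * a)) * (norm z)\<^sup>2)"
      using hk by (simp add: has_bochner_integral_iff)
    finally show "(\<integral>\<^sup>+t. ennreal (cmod (f (z, t))) \<partial>lborel) \<le> ennreal (?Q * exp (- (1 / (4 * a)) * (norm z)\<^sup>2))"
      using fi by (subst nn_integral_eq_integral) (auto intro: ennreal_leI)
  qed
qed

section \<open>The transform as an entire function\<close>

definition fock_weight :: "real \<Rightarrow> 'n::finite hpoint \<Rightarrow> complex" where
  "fock_weight l p = exp (\<i> * of_real (l * snd p) - of_real (l / 4 * (fst p \<bullet> fst p)))"

text \<open>A Bargmann transform at frequency \<open>l\<close>, restricted to the complex multiples
  of a direction \<open>\<xi>\<close>. For imaginary \<open>\<zeta>\<close> it is an ordinary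
  Fourier transform in \<open>z\<close> of the weighted function.\<close>

definition fock :: "('n::finite hpoint \<Rightarrow> complex) \<Rightarrow> real \<Rightarrow> complex ^ 'n \<Rightarrow> complex \<Rightarrow> complex" where
  "fock f l \<xi> \<zeta> = (\<integral>p. f p * fock_weight l p * exp (\<zeta> * of_real (fst p \<bullet> \<xi>)) \<partial>lborel)"

lemma fock_weight_continuous: "continuous_on UNIV (fock_weight l)"
  unfolding fock_weight_def by (intro continuous_intros)

text \<open>Completing the square in
  \<open>Re \<zeta> * (z \<bullet> \<xi>) - |z|^2 / (4 * a)\<close> gives the maximum
  \<open>a * (Re \<zeta>)^2 * |\<xi>|^2\<close> and a translated Gaussian of unchanged integral. The
  weight is estimated by 1, which loses nothing in the limit of small \<open>l\<close>.\<close>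

lemma fock_bound:
  fixes f :: "'n::finite hpoint \<Rightarrow> complex"
  assumes a: "a > 0" and l: "l > 0" and Q: "Q \<ge> 0" and [measurable]: "f \<in> borel_measurable borel"
    and fib: "AE z in lborel. (\<integral>\<^sup>+t. ennreal (cmod (f (z, t))) \<partial>lborel) \<le> ennreal (Q * exp (- (1 / (4 * a)) * (norm z)\<^sup>2))"
  shows "integrable lborel (\<lambda>p. f p * fock_weight l p * exp (\<zeta> * of_real (fst p \<bullet> \<xi>)))"
    "cmod (fock f l \<xi> \<zeta>) \<le> Q * (\<integral>z. exp (- (1 / (4 * a)) * (norm z)\<^sup>2) \<partial>(lborel :: (complex ^ 'n) measure)) * exp (a * (Re \<zeta>)\<^sup>2 * (norm \<xi>)\<^sup>2)"
proof -
  let ?h = "\<lambda>p. fock_weight l p * exp (\<zeta> * of_real (fst p \<bullet> \<xi>))"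
  let ?W = "\<lambda>z. exp (Re \<zeta> * (z \<bullet> \<xi>))"
  let ?D = "\<lambda>z::complex ^ 'n. Q * exp (- (1 / (4 * a)) * (norm z)\<^sup>2)"
  let ?g = "\<lambda>z::complex ^ 'n. exp (- (1 / (4 * a)) * (norm z)\<^sup>2)"
  have h: "?h \<in> borel_measurable borel"
    by (intro borel_measurable_continuous_onI continuous_intros fock_weight_continuous)
  have hb: "cmod (?h p) \<le> ?W (fst p)" for p
  proof -
    have "cmod (fock_weight l p) \<le> 1" using l by (simp add: fock_weight_def)
    then have "cmod (fock_weight l p) * ?W (fst p) \<le> 1 * ?W (fst p)" by (rule mult_right_mono) simp
    then show ?thesis by (simp add: norm_mult)
  qed
  have WD: "?W z * ?D z = Q * exp (a * (Re \<zeta>)\<^sup>2 * (norm \<xi>)\<^sup>2) * ?g (- (2 * a * Re \<zeta>) *\<^sub>R \<xi> + 1 *\<^sub>R z)" for z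
  proof -
    have "Re \<zeta> * (z \<bullet> \<xi>) + (- (1 / (4 * a)) * (norm z)\<^sup>2)
      = a * (Re \<zeta>)\<^sup>2 * (norm \<xi>)\<^sup>2 + (- (1 / (4 * a)) * (norm (- (2 * a * Re \<zeta>) *\<^sub>R \<xi> + 1 *\<^sub>R z))\<^sup>2)"
    proof -
      have "(norm (- (2 * a * Re \<zeta>) *\<^sub>R \<xi> + 1 *\<^sub>R z))\<^sup>2 = 4 * a\<^sup>2 * (Re \<zeta>)\<^sup>2 * (norm \<xi>)\<^sup>2 - 4 * a * Re \<zeta> * (z \<bullet> \<xi>) + (norm z)\<^sup>2"
        unfolding power2_norm_eq_inner
        by (simp add: inner_diff_left inner_diff_right inner_commute[of \<xi> z] power2_eq_square algebra_simps)
      then show ?thesis using a by (simp only:) (simp add: field_simps power2_eq_square)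
    qed
    then have "?W z * ?g z = exp (a * (Re \<zeta>)\<^sup>2 * (norm \<xi>)\<^sup>2) * ?g (- (2 * a * Re \<zeta>) *\<^sub>R \<xi> + 1 *\<^sub>R z)"
      unfolding exp_add[symmetric] by (simp only:)
    then show ?thesis by (simp only: mult.left_commute[of _ Q] mult.assoc)
  qed
  have g: "integrable lborel ?g" using a by (intro integrable_gaussian) simp
  have gs: "integrable lborel (\<lambda>z. ?g (- (2 * a * Re \<zeta>) *\<^sub>R \<xi> + 1 *\<^sub>R z))"
    by (rule integrable_affine_euclidean[OF _ g]) simp
  have int: "integrable lborel (\<lambda>z. ?W z * ?D z)" unfolding WD by (rule integrable_mult_right[OF gs])
  have "(\<integral>z. ?W z * ?D z \<partial>lborel) = Q * exp (a * (Re \<zeta>)\<^sup>2 * (norm \<xi>)\<^sup>2) * (\<integral>z. ?g (- (2 * a * Re \<zeta>) *\<^sub>R \<xi> + 1 *\<^sub>R z) \<partial>lborel)"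
    unfolding WD by (rule integral_mult_right_zero)
  also have "(\<integral>z. ?g (- (2 * a * Re \<zeta>) *\<^sub>R \<xi> + 1 *\<^sub>R z) \<partial>lborel) = (\<integral>z. ?g z \<partial>lborel)"
    using integral_affine_euclidean[of 1 ?g "- (2 * a * Re \<zeta>) *\<^sub>R \<xi>"] by simp
  finally have val: "(\<integral>z. ?W z * ?D z \<partial>lborel) = Q * (\<integral>z. ?g z \<partial>lborel) * exp (a * (Re \<zeta>)\<^sup>2 * (norm \<xi>)\<^sup>2)" by simp
  note dom = fibre_dominated_integral[of f ?h ?D ?W, OF _ h fib hb _ int]
  show "integrable lborel (\<lambda>p. f p * fock_weight l p * exp (\<zeta> * of_real (fst p \<bullet> \<xi>)))"
    using dom(1) Q by (simp add: mult.assoc)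
  show "cmod (fock f l \<xi> \<zeta>) \<le> Q * (\<integral>z. ?g z \<partial>lborel) * exp (a * (Re \<zeta>)\<^sup>2 * (norm \<xi>)\<^sup>2)"
    using dom(2) Q unfolding val fock_def by (simp add: mult.assoc)
qed

text \<open>The exponent is linear in \<open>\<zeta>\<close>, so this is a two-sided Laplace
  integral that converges on every vertical strip, and the strips exhaust the plane.\<close>

lemma fock_entire:
  fixes f :: "'n::finite hpoint \<Rightarrow> complex"
  assumes a: "a > 0" and l: "l > 0" and Q: "Q \<ge> 0" and f[measurable]: "f \<in> borel_measurable borel"
    and fib: "AE z in lborel. (\<integral>\<^sup>+t. ennreal (cmod (f (z, t))) \<partial>lborel) \<le> ennreal (Q * exp (- (1 / (4 * a)) * (norm z)\<^sup>2))"
  shows "fock f l \<xi> holomorphic_on UNIV"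
proof -
  have [measurable]: "fock_weight l \<in> borel_measurable (borel :: 'n hpoint measure)"
    by (rule borel_measurable_continuous_onI[OF fock_weight_continuous])
  have "fock f l \<xi> holomorphic_on {\<zeta>. \<bar>Re \<zeta>\<bar> < c}" for c
    unfolding fock_def
  proof (rule holomorphic_on_laplace_integral)
    fix \<sigma> :: real
    show "integrable lborel (\<lambda>p. f p * fock_weight l p * of_real (exp (\<sigma> * (fst p \<bullet> \<xi>))))"
      using fock_bound(1)[OF a l Q f fib, of "of_real \<sigma>" \<xi>] by (simp add: exp_of_real flip: of_real_mult)
    have "(\<lambda>p::'n hpoint. fst p \<bullet> \<xi>) \<in> borel_measurable borel"
      by (intro borel_measurable_continuous_onI continuous_intros)
    then show "(\<lambda>p::'n hpoint. fst p \<bullet> \<xi>) \<in> borel_measurable lborel" by simp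
  qed measurable
  then have "fock f l \<xi> holomorphic_on (\<Union>n::nat. {\<zeta>. \<bar>Re \<zeta>\<bar> < real n})"
  proof (intro holomorphic_on_UN_open)
    fix n :: nat
    have "{\<zeta>. \<bar>Re \<zeta>\<bar> < real n} = {\<zeta>. Re \<zeta> < real n} \<inter> {\<zeta>. - real n < Re \<zeta>}" by auto
    then show "open {\<zeta>. \<bar>Re \<zeta>\<bar> < real n}" by (simp add: open_Int open_halfspace_Re_lt open_halfspace_Re_gt)
  qed
  moreover have "(\<Union>n::nat. {\<zeta>. \<bar>Re \<zeta>\<bar> < real n}) = UNIV"
    using reals_Archimedean2 by auto
  ultimately show ?thesis by simp
qed

section \<open>Evolution of coherent states\<close>

definition rotate_vec :: "complex \<Rightarrow> complex ^ 'n \<Rightarrow> complex ^ 'n::finite" where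
  "rotate_vec e \<xi> = (\<chi> k. e * \<xi> $ k)"

lemma norm_rotate_vec: "cmod e = 1 \<Longrightarrow> norm (rotate_vec e \<xi>) = norm \<xi>"
  by (simp add: rotate_vec_def norm_vec_def norm_mult)

text \<open>At \<open>e = 1\<close> the two halves of the linear part add up to
  \<open>\<zeta>\<close> times a real inner product with \<open>\<xi>\<close>. Multiplying the
  antiholomorphic half by \<open>e * e\<close> and extracting one factor \<open>e\<close> leaves a
  state of the same form, with \<open>\<zeta>\<close> and \<open>\<xi>\<close> both multiplied by
  \<open>e\<close>.\<close>

lemma phase_coherent:
  fixes p :: "'n::finite hpoint"
  assumes e: "cmod e = 1"
  shows "exp (phase l (\<chi> k. \<zeta> / 2 * cnj (\<xi> $ k)) (\<chi> k. \<zeta> / 2 * \<xi> $ k) (e * e) c p)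
    = fock_weight l p * exp ((\<zeta> * e) * of_real (fst p \<bullet> rotate_vec e \<xi>)) * exp c"
proof -
  have ic: "x \<bullet> y = Re (x * cnj y)" for x y :: complex by (simp add: inner_complex_def)
  have ee: "e * cnj e = 1" using e complex_norm_square[of e] by simp
  have "(\<zeta> * e) * of_real (fst p \<bullet> rotate_vec e \<xi>)
     = (\<Sum>k\<in>UNIV. (\<zeta> * e) * of_real (Re (fst p $ k * cnj (e * \<xi> $ k))))"
    by (simp only: inner_vec_def rotate_vec_def ic of_real_sum sum_distrib_left vec_lambda_beta)
  also have "\<dots> = (\<Sum>k\<in>UNIV. \<zeta> / 2 * cnj (\<xi> $ k) * fst p $ k + (e * e) * (\<zeta> / 2 * \<xi> $ k * cnj (fst p $ k)))"
  proof (rule sum.cong[OF refl])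
    fix k
    have "(\<zeta> * e) * of_real (Re (fst p $ k * cnj (e * \<xi> $ k)))
       = \<zeta> * e * (fst p $ k * cnj (e * \<xi> $ k) + cnj (fst p $ k * cnj (e * \<xi> $ k))) / 2"
      unfolding complex_add_cnj by simp
    also have "\<dots> = (e * cnj e) * (\<zeta> / 2 * cnj (\<xi> $ k) * fst p $ k) + (e * e) * (\<zeta> / 2 * \<xi> $ k * cnj (fst p $ k))"
      by (simp add: field_simps)
    finally show "(\<zeta> * e) * of_real (Re (fst p $ k * cnj (e * \<xi> $ k)))
       = \<zeta> / 2 * cnj (\<xi> $ k) * fst p $ k + (e * e) * (\<zeta> / 2 * \<xi> $ k * cnj (fst p $ k))" unfolding ee by simp
  qed
  finally show ?thesis
    unfolding phase_def fock_weight_def by (simp add: exp_add)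
qed

lemma drift_coherent:
  fixes \<xi> :: "complex ^ 'n::finite"
  shows "drift l (\<chi> k. \<zeta> / 2 * cnj (\<xi> $ k)) (\<chi> k. \<zeta> / 2 * \<xi> $ k) s
    = \<i> * of_real (l * CARD('n) * s) - of_real ((norm \<xi>)\<^sup>2 / (2 * l)) * \<zeta>\<^sup>2 * rot l s"
proof -
  have "(\<Sum>k\<in>UNIV. \<zeta> / 2 * cnj (\<xi> $ k) * (\<zeta> / 2 * \<xi> $ k)) = \<zeta>\<^sup>2 / 4 * (\<Sum>k\<in>UNIV. \<xi> $ k * cnj (\<xi> $ k))"
    by (simp add: sum_distrib_left power2_eq_square ac_simps)
  also have "\<dots> = \<zeta>\<^sup>2 / 4 * of_real ((norm \<xi>)\<^sup>2)"
    by (simp only: power2_norm_eq_inner inner_self_complex_vec)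
  finally have S: "(\<Sum>k\<in>UNIV. \<zeta> / 2 * cnj (\<xi> $ k) * (\<zeta> / 2 * \<xi> $ k)) = \<zeta>\<^sup>2 / 4 * of_real ((norm \<xi>)\<^sup>2)" .
  show ?thesis unfolding drift_def vec_lambda_beta S by simp
qed

text \<open>The wave identity for coherent states. The prefactor is the exponential of the drift at
  time \<open>s\<close> minus the drift at time 0; the factor \<open>cis (l * s)\<close> acts on
  both \<open>\<zeta>\<close> and \<open>\<xi>\<close>, its square being
  \<open>rot l s\<close>.\<close>

lemma fock_evolution:
  fixes U :: "real \<Rightarrow> ('n::finite hpoint \<Rightarrow> complex) \<Rightarrow> ('n hpoint \<Rightarrow> complex)" and \<xi> :: "complex ^ 'n"
  assumes U: "schroedinger_group U" and f: "sq_int f" and l: "l > 0" and a: "a > 0" and b: "b > 0" and Q: "Q \<ge> 0" and Q': "Q' \<ge> 0"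
    and fib: "AE z in lborel. (\<integral>\<^sup>+t. ennreal (cmod (f (z, t))) \<partial>lborel) \<le> ennreal (Q * exp (- (1 / (4 * a)) * (norm z)\<^sup>2))"
    and fib': "AE z in lborel. (\<integral>\<^sup>+t. ennreal (cmod (U s f (z, t))) \<partial>lborel) \<le> ennreal (Q' * exp (- (1 / (4 * b)) * (norm z)\<^sup>2))"
  shows "fock f l \<xi> \<zeta> = exp (\<i> * of_real (l * CARD('n) * s) + of_real ((norm \<xi>)\<^sup>2 / (2 * l)) * \<zeta>\<^sup>2 * (1 - rot l s))
     * fock (U s f) l (rotate_vec (cis (l * s)) \<xi>) (\<zeta> * cis (l * s))"
proof -
  let ?A = "\<chi> k. \<zeta> / 2 * cnj (\<xi> $ k)" and ?B = "\<chi> k. \<zeta> / 2 * \<xi> $ k"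
  let ?c = "of_real ((norm \<xi>)\<^sup>2 / (2 * l)) * \<zeta>\<^sup>2"
  note m = sq_int_measurable[OF f] sq_int_measurable[OF schroedinger_groupD(1)[OF U f]]
  have r: "rot l t = cis (l * t) * cis (l * t)" for t
    by (simp add: rot_def cis_conv_exp exp_add[symmetric] algebra_simps)
  have ph: "exp (phase_at l ?A ?B t p) = fock_weight l p * exp ((\<zeta> * cis (l * t)) * of_real (fst p \<bullet> rotate_vec (cis (l * t)) \<xi>)) * exp (drift l ?A ?B t)" for t p
    unfolding r by (rule phase_coherent) simp
  have z0: "rotate_vec 1 \<xi> = \<xi>" by (simp add: rotate_vec_def)
  have ph0: "exp (phase_at l ?A ?B 0 p) = fock_weight l p * exp (\<zeta> * of_real (fst p \<bullet> \<xi>)) * exp (drift l ?A ?B 0)" for p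
    using ph[of 0 p] by (simp only: mult_zero_right cis_zero mult_1_right z0)
  have d0: "drift l ?A ?B 0 = - ?c" unfolding drift_coherent by (simp add: rot_def)
  have i0: "integrable lborel (\<lambda>p. f p * exp (phase_at l ?A ?B 0 p))"
    using integrable_mult_left[OF fock_bound(1)[OF a l Q m(1) fib, of \<zeta> \<xi>], of "exp (drift l ?A ?B 0)"]
    unfolding ph0 by (simp only: mult.assoc)
  have i1: "integrable lborel (\<lambda>p. U s f p * exp (phase_at l ?A ?B s p))"
    using integrable_mult_left[OF fock_bound(1)[OF b l Q' m(2) fib', of "\<zeta> * cis (l * s)" "rotate_vec (cis (l * s)) \<xi>"], of "exp (drift l ?A ?B s)"]
    unfolding ph by (simp only: mult.assoc)
  have e1: "(\<integral>p. U s f p * exp (phase_at l ?A ?B s p) \<partial>lborel) = fock (U s f) l (rotate_vec (cis (l * s)) \<xi>) (\<zeta> * cis (l * s)) * exp (drift l ?A ?B s)"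
    unfolding ph fock_def by (subst integral_mult_left_zero[symmetric]) (simp only: mult.assoc)
  have e0: "(\<integral>p. f p * exp (phase_at l ?A ?B 0 p) \<partial>lborel) = fock f l \<xi> \<zeta> * exp (- ?c)"
    unfolding ph0 unfolding fock_def d0 by (subst integral_mult_left_zero[symmetric]) (simp only: mult.assoc)
  have "fock f l \<xi> \<zeta> * exp (- ?c) = fock (U s f) l (rotate_vec (cis (l * s)) \<xi>) (\<zeta> * cis (l * s)) * exp (drift l ?A ?B s)"
    using wave_identity[OF U f l i0 i1] unfolding e0 e1 by (rule sym)
  then have "fock f l \<xi> \<zeta> * exp (- ?c) * exp ?c = exp (drift l ?A ?B s) * exp ?c * fock (U s f) l (rotate_vec (cis (l * s)) \<xi>) (\<zeta> * cis (l * s))"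
    by (simp only: ac_simps)
  moreover have "exp (- ?c) * exp ?c = 1" by (simp add: exp_minus)
  moreover have "exp (drift l ?A ?B s) * exp ?c = exp (\<i> * of_real (l * CARD('n) * s) + ?c * (1 - rot l s))"
    unfolding drift_coherent exp_add[symmetric] by (simp add: algebra_simps diff_divide_distrib)
  ultimately show ?thesis by (simp only: mult.assoc mult_1_right)
qed

text \<open>As \<open>l\<close> tends to 0 the sum of the two exponents along the rays \<open>w\<close> and \<open>\<i>w\<close>
  tends to \<open>2 * sqrt (a * b) * (sqrt (a * b) - \<bar>s\<bar>)\<close>: this is where the sharp constant comes from.\<close>

lemma exponents_eventually_negative:
  fixes a b s :: real
  assumes a: "a > 0" and b: "b > 0" and s: "s \<noteq> 0" and ab: "a * b < s\<^sup>2"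
  obtains w l0 where "l0 > 0"
    "\<And>l. 0 < l \<Longrightarrow> l < l0 \<Longrightarrow> a * (Re w)\<^sup>2 + (b * (Re (\<i> * w * cis (l * s)))\<^sup>2 + Re ((\<i> * w)\<^sup>2 * (1 - rot l s) / of_real (2 * l))) < 0"
proof -
  \<comment> \<open>With \<open>w = u + \<i> v\<close> this choice makes the limiting square terms
    \<open>a * u^2\<close> and \<open>b * v^2\<close> equal, and the sign makes the mixed term
    \<open>- 2 * s * u * v\<close> negative.\<close>
  define w where "w = Complex (sqrt b) (sgn s * sqrt a)"
  \<comment> \<open>Half of a difference quotient at 0 of
    \<open>\<lambda>l. exp (2 * \<i> * s * l)\<close>.\<close>
  have d: "((\<lambda>l. (rot l s - 1) / of_real (2 * l)) \<longlongrightarrow> \<i> * of_real s) (at_right 0)"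
  proof -
    have "((\<lambda>x. exp (2 * \<i> * of_real s * x)) has_field_derivative 2 * \<i> * of_real s) (at 0)"
      by (auto intro!: derivative_eq_intros)
    then have "((\<lambda>x. (exp (2 * \<i> * of_real s * x) - 1) / x) \<longlongrightarrow> 2 * \<i> * of_real s) (at 0)"
      by (simp add: DERIV_def)
    moreover have "filterlim complex_of_real (at 0) (at_right 0)"
      by (auto simp: filterlim_at eventually_at_filter intro!: tendsto_eq_intros)
    ultimately have "((\<lambda>l::real. (exp (2 * \<i> * of_real s * of_real l) - 1) / of_real l) \<longlongrightarrow> 2 * \<i> * of_real s) (at_right 0)"
      by (rule filterlim_compose)
    then have "((\<lambda>l::real. (exp (2 * \<i> * of_real s * of_real l) - 1) / of_real l / 2) \<longlongrightarrow> 2 * \<i> * of_real s / 2) (at_right 0)"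
      by (intro tendsto_divide tendsto_const) simp_all
    moreover have "(exp (2 * \<i> * of_real s * of_real l) - 1) / of_real l / 2 = (rot l s - 1) / of_real (2 * l)" for l
    proof -
      have "2 * \<i> * of_real s * complex_of_real l = 2 * \<i> * of_real l * of_real s" by (simp only: ac_simps)
      then show ?thesis unfolding rot_def by (simp only:) simp
    qed
    ultimately show ?thesis by simp
  qed
  let ?h = "\<lambda>l. a * (Re w)\<^sup>2 + (b * (Re (\<i> * w * cis (l * s)))\<^sup>2 + Re (w\<^sup>2 * ((rot l s - 1) / of_real (2 * l))))"
  have "(?h \<longlongrightarrow> a * (Re w)\<^sup>2 + (b * (Re (\<i> * w * cis (0 * s)))\<^sup>2 + Re (w\<^sup>2 * (\<i> * of_real s)))) (at_right 0)"
    by (intro tendsto_intros d)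
  moreover have "a * (Re w)\<^sup>2 + (b * (Re (\<i> * w * cis (0 * s)))\<^sup>2 + Re (w\<^sup>2 * (\<i> * of_real s))) < 0"
  proof -
    have sg: "(sgn s)\<^sup>2 = 1" "sgn s * s = \<bar>s\<bar>" using s by (auto simp: sgn_if abs_if)
    have "sqrt (a * b) < \<bar>s\<bar>" using ab by (simp add: real_less_lsqrt real_sqrt_less_iff flip: real_sqrt_abs)
    moreover have p: "sqrt a * sqrt b > 0" using a b by simp
    ultimately have lt: "(sqrt a * sqrt b) * (sqrt a * sqrt b) < (sqrt a * sqrt b) * \<bar>s\<bar>"
      by (intro mult_strict_left_mono) (simp_all add: real_sqrt_mult)
    have "a * (Re w)\<^sup>2 + (b * (Re (\<i> * w * cis (0 * s)))\<^sup>2 + Re (w\<^sup>2 * (\<i> * of_real s)))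
      = a * b + b * a - 2 * sqrt b * sqrt a * (sgn s * s)"
      using a b sg(1) by (simp add: w_def power2_eq_square algebra_simps)
    also have "a * b = (sqrt a * sqrt b) * (sqrt a * sqrt b)" using a b by (simp add: algebra_simps)
    also have "b * a = (sqrt a * sqrt b) * (sqrt a * sqrt b)" using a b by (simp add: algebra_simps)
    finally show ?thesis using lt unfolding sg(2) by (simp add: algebra_simps)
  qed
  ultimately have "\<forall>\<^sub>F l in at_right 0. ?h l < 0" by (rule order_tendstoD)
  then obtain l0 where l0: "l0 > 0" "\<And>l. 0 < l \<Longrightarrow> l < l0 \<Longrightarrow> ?h l < 0"
    unfolding eventually_at_right_field by auto
  have eq: "(\<i> * w)\<^sup>2 * (1 - rot l s) / of_real (2 * l) = w\<^sup>2 * ((rot l s - 1) / of_real (2 * l))" for l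
    by (simp add: power_mult_distrib field_simps)
  show ?thesis by (rule that[of l0 w, OF l0(1)], unfold eq, rule l0(2))
qed

text \<open>Exponential decay makes the transform holomorphic in a strip around the imaginary axis.
  The given zeros accumulate at 0, inside the strip, so it vanishes identically and Fourier
  uniqueness applies. A sequence of frequencies, instead of an interval, allows the exceptional null
  sets to be united later.\<close>

lemma exp_decay_fourier_uniqueness:
  fixes g :: "real \<Rightarrow> complex"
  assumes g[measurable]: "g \<in> borel_measurable borel" and c: "c > 0" and l0: "l0 > 0"
    and decay: "AE t in lborel. cmod (g t) \<le> K * exp (- c * \<bar>t\<bar>)"
    and zero: "\<And>n. (\<integral>t. g t * exp (\<i> * of_real (l0 / (real n + 2) * t)) \<partial>lborel) = 0"
  shows "AE t in lborel. g t = 0"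
proof -
  let ?S = "{\<zeta>. \<bar>Re \<zeta>\<bar> < c}"
  let ?H = "\<lambda>\<zeta>. \<integral>t. g t * exp (\<zeta> * of_real t) \<partial>lborel"
  have int: "integrable lborel (\<lambda>t. g t * of_real (exp (\<sigma> * t)))" if "\<bar>\<sigma>\<bar> < c" for \<sigma>
  proof (rule Bochner_Integration.integrable_bound)
    show "integrable lborel (\<lambda>t. K * exp (- (c - \<bar>\<sigma>\<bar>) * \<bar>t\<bar>))"
      using that by (intro integrable_mult_right integrable_exp_neg_abs) simp
    show "AE t in lborel. norm (g t * of_real (exp (\<sigma> * t))) \<le> norm (K * exp (- (c - \<bar>\<sigma>\<bar>) * \<bar>t\<bar>))"
      using decay
    proof eventually_elim
      case (elim t)
      have "\<sigma> * t \<le> \<bar>\<sigma>\<bar> * \<bar>t\<bar>" using abs_ge_self[of "\<sigma> * t"] by (simp add: abs_mult)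
      then have "cmod (g t) * exp (\<sigma> * t) \<le> (K * exp (- c * \<bar>t\<bar>)) * exp (\<bar>\<sigma>\<bar> * \<bar>t\<bar>)"
        using elim order_trans[OF norm_ge_zero elim] by (intro mult_mono) auto
      also have "\<dots> = K * exp (- (c - \<bar>\<sigma>\<bar>) * \<bar>t\<bar>)" by (simp add: exp_add[symmetric] algebra_simps)
      also have "\<dots> \<le> norm (K * exp (- (c - \<bar>\<sigma>\<bar>) * \<bar>t\<bar>))" unfolding real_norm_def by (rule abs_ge_self)
      finally show ?case by (simp add: norm_mult)
    qed
  qed measurable
  have hol: "?H holomorphic_on ?S"
    by (rule holomorphic_on_laplace_integral[OF _ _ int]) measurable
  have Seq: "?S = {\<zeta>. Re \<zeta> < c} \<inter> {\<zeta>. - c < Re \<zeta>}" by auto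
  have oS: "open ?S" and cS: "connected ?S" unfolding Seq
    by (auto intro!: convex_connected convex_Int convex_halfspace_Re_lt convex_halfspace_Re_gt open_Int
        simp: open_halfspace_Re_lt open_halfspace_Re_gt)
  let ?x = "\<lambda>n::nat. \<i> * of_real (l0 / (real n + 2))"
  have lp: "0 islimpt range ?x"
    unfolding islimpt_sequential
  proof (intro exI[of _ ?x] conjI allI)
    show "?x n \<in> range ?x - {0}" for n
    proof -
      have "l0 / (real n + 2) \<noteq> 0" using l0 by simp
      then show ?thesis by (simp del: of_real_divide)
    qed
    have "(\<lambda>n::nat. l0 / (real n + 2)) \<longlonglongrightarrow> 0" by real_asymp
    then have "(\<lambda>n::nat. complex_of_real (l0 / (real n + 2))) \<longlonglongrightarrow> of_real 0" by (rule tendsto_of_real)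
    from tendsto_mult_left[OF this, of "\<i>"] show "?x \<longlonglongrightarrow> 0" by simp
  qed
  have H0: "?H \<zeta> = 0" if "\<bar>Re \<zeta>\<bar> < c" for \<zeta>
  proof (rule analytic_continuation[OF hol oS cS _ _ lp])
    show "?H z = 0" if z: "z \<in> range ?x" for z
    proof -
      from z obtain n where z: "z = ?x n" by blast
      show ?thesis unfolding z using zero[of n] by (simp only: of_real_mult mult.assoc)
    qed
  qed (use c that in auto)
  have "integrable lborel g" using int[of 0] c by simp
  then show ?thesis
  proof (rule fourier_uniqueness)
    fix \<xi> :: real
    show "(\<integral>t. g t * exp (\<i> * of_real (t \<bullet> \<xi>)) \<partial>lborel) = 0"
      using H0[of "\<i> * of_real \<xi>"] c by (simp add: ac_simps)
  qed
qed

lemma fock_zero: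
  fixes U :: "real \<Rightarrow> ('n::finite hpoint \<Rightarrow> complex) \<Rightarrow> ('n hpoint \<Rightarrow> complex)"
  assumes U: "schroedinger_group U" and f: "sq_int f" and l: "l > 0" and a: "a > 0" and b: "b > 0" and Q: "Q \<ge> 0" and Q': "Q' \<ge> 0"
    and fib: "AE z in lborel. (\<integral>\<^sup>+t. ennreal (cmod (f (z, t))) \<partial>lborel) \<le> ennreal (Q * exp (- (1 / (4 * a)) * (norm z)\<^sup>2))"
    and fib': "AE z in lborel. (\<integral>\<^sup>+t. ennreal (cmod (U s f (z, t))) \<partial>lborel) \<le> ennreal (Q' * exp (- (1 / (4 * b)) * (norm z)\<^sup>2))"
    and neg: "a * (Re w)\<^sup>2 + (b * (Re (\<i> * w * cis (l * s)))\<^sup>2 + Re ((\<i> * w)\<^sup>2 * (1 - rot l s) / of_real (2 * l))) < 0"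
  shows "fock f l \<xi> \<zeta> = 0"
proof -
  note m = sq_int_measurable[OF f] sq_int_measurable[OF schroedinger_groupD(1)[OF U f]]
  have ne: "fock f l \<xi> \<zeta> = 0" if \<xi>: "\<xi> \<noteq> 0" for \<xi> \<zeta>
  proof -
    \<comment> \<open>Both exponents are proportional to \<open>(norm \<xi>)\<^sup>2\<close>, so one
      sign condition on \<open>w\<close> serves all nonzero directions.\<close>
    let ?k1 = "\<lambda>\<zeta>. a * (Re \<zeta>)\<^sup>2 * (norm \<xi>)\<^sup>2"
    let ?k2 = "\<lambda>\<zeta>. (b * (Re (\<zeta> * cis (l * s)))\<^sup>2 + Re (\<zeta>\<^sup>2 * (1 - rot l s) / of_real (2 * l))) * (norm \<xi>)\<^sup>2"
    let ?G = "\<lambda>a. \<integral>z. exp (- (1 / (4 * a)) * (norm z)\<^sup>2) \<partial>(lborel :: (complex ^ 'n) measure)"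
    show ?thesis
    proof (rule entire_zero_if_two_gaussian_bounds[where F="fock f l \<xi>" and z=\<zeta> and ?k1.0="?k1" and ?k2.0="?k2" and ?C1.0="Q * ?G a" and ?C2.0="Q' * ?G b" and w=w])
      show "fock f l \<xi> holomorphic_on UNIV" by (rule fock_entire[OF a l Q m(1) fib])
      show "cmod (fock f l \<xi> \<zeta>) \<le> Q * ?G a * exp (?k1 \<zeta>)" for \<zeta> by (rule fock_bound(2)[OF a l Q m(1) fib])
      show "cmod (fock f l \<xi> \<zeta>) \<le> Q' * ?G b * exp (?k2 \<zeta>)" for \<zeta>
      proof -
        have n: "norm (rotate_vec (cis (l * s)) \<xi>) = norm \<xi>" by (rule norm_rotate_vec) simp
        have R: "Re (\<i> * of_real (l * CARD('n) * s) + of_real ((norm \<xi>)\<^sup>2 / (2 * l)) * \<zeta>\<^sup>2 * (1 - rot l s))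
           = Re (\<zeta>\<^sup>2 * (1 - rot l s) / of_real (2 * l)) * (norm \<xi>)\<^sup>2"
        proof -
          have "of_real ((norm \<xi>)\<^sup>2 / (2 * l)) * \<zeta>\<^sup>2 * (1 - rot l s) = of_real ((norm \<xi>)\<^sup>2) * (\<zeta>\<^sup>2 * (1 - rot l s) / of_real (2 * l))"
            by simp
          moreover have "Re (\<i> * of_real x + of_real y * v) = Re v * y" for x y v by simp
          ultimately show ?thesis by (simp only:)
        qed
        have "cmod (fock f l \<xi> \<zeta>) = exp (Re (\<zeta>\<^sup>2 * (1 - rot l s) / of_real (2 * l)) * (norm \<xi>)\<^sup>2)
            * cmod (fock (U s f) l (rotate_vec (cis (l * s)) \<xi>) (\<zeta> * cis (l * s)))"
          unfolding fock_evolution[OF U f l a b Q Q' fib fib'] norm_mult norm_exp_eq_Re R ..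
        also have "\<dots> \<le> exp (Re (\<zeta>\<^sup>2 * (1 - rot l s) / of_real (2 * l)) * (norm \<xi>)\<^sup>2)
            * (Q' * ?G b * exp (b * (Re (\<zeta> * cis (l * s)))\<^sup>2 * (norm \<xi>)\<^sup>2))"
          using fock_bound(2)[OF b l Q' m(2) fib', of "rotate_vec (cis (l * s)) \<xi>" "\<zeta> * cis (l * s)"] unfolding n
          by (intro mult_left_mono) simp_all
        also have "\<dots> = Q' * ?G b * exp (?k2 \<zeta>)"
          unfolding distrib_right exp_add by (simp only: ac_simps)
        finally show ?thesis .
      qed
      show "continuous_on UNIV ?k1" "continuous_on UNIV ?k2" using l by (intro continuous_intros; simp)+
      show "?k1 (of_real r * z) = r\<^sup>2 * ?k1 z" for r z by (simp add: power_mult_distrib)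
      show "?k2 (of_real r * z) = r\<^sup>2 * ?k2 z" for r z
      proof -
        have "(of_real r * z)\<^sup>2 * (1 - rot l s) / of_real (2 * l) = of_real (r\<^sup>2) * (z\<^sup>2 * (1 - rot l s) / of_real (2 * l))"
          by (simp add: power_mult_distrib)
        moreover have "Re (of_real r * z * cis (l * s)) = r * Re (z * cis (l * s))" by (simp add: algebra_simps)
        moreover have "Re (of_real x * v) = x * Re v" for x v by simp
        ultimately show ?thesis by (simp only: power_mult_distrib ring_distribs mult.assoc mult.left_commute)
      qed
      have "?k1 w + ?k2 (\<i> * w) = (a * (Re w)\<^sup>2 + (b * (Re (\<i> * w * cis (l * s)))\<^sup>2 + Re ((\<i> * w)\<^sup>2 * (1 - rot l s) / of_real (2 * l)))) * (norm \<xi>)\<^sup>2"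
        by (simp only: distrib_right)
      also have "\<dots> < 0" using neg \<xi> by (intro mult_neg_pos) simp_all
      finally show "?k1 w + ?k2 (\<i> * w) < 0" .
    qed
  qed
  show ?thesis
  proof (cases "\<xi> = 0")
    case True
    \<comment> \<open>For \<open>\<xi> = 0\<close> both exponents degenerate to 0 and the growth
      argument says nothing; but the integrand is then the one for a nonzero vector at
      \<open>\<zeta> = 0\<close>.\<close>
    have "fock f l 0 \<zeta> = fock f l (axis undefined 1) 0" by (simp add: fock_def)
    then show ?thesis using True ne[of "axis undefined 1" 0] by (simp add: axis_eq_0_iff)
  qed (rule ne)
qed

text \<open>At \<open>\<zeta> = \<i>\<close> with \<open>\<xi>\<close> varying, \<open>fock\<close>
  is the Fourier transform in \<open>z\<close> of the partial transform in \<open>t\<close> times a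
  Gaussian. Uniqueness makes this product vanish, and the Gaussian has no zeros.\<close>

lemma fibre_transform_zero:
  fixes f :: "'n::finite hpoint \<Rightarrow> complex"
  assumes a: "a > 0" and l: "l > 0" and Q: "Q \<ge> 0" and f[measurable]: "f \<in> borel_measurable borel"
    and fib: "AE z in lborel. (\<integral>\<^sup>+t. ennreal (cmod (f (z, t))) \<partial>lborel) \<le> ennreal (Q * exp (- (1 / (4 * a)) * (norm z)\<^sup>2))"
    and zero: "\<And>\<xi>. fock f l \<xi> \<i> = 0"
  shows "AE z in lborel. (\<integral>t. f (z, t) * exp (\<i> * of_real (l * t)) \<partial>lborel) = 0"
proof -
  let ?g = "\<lambda>z. \<integral>t. f (z, t) * fock_weight l (z, t) \<partial>lborel"
  have i: "integrable lborel (\<lambda>p. f p * fock_weight l p * exp (\<zeta> * of_real (fst p \<bullet> \<xi>)))" for \<zeta> \<xi>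
    by (rule fock_bound(1)[OF a l Q f fib])
  have "integrable (lborel \<Otimes>\<^sub>M lborel) (\<lambda>p. f p * fock_weight l p)"
    using i[of 0 0] by (simp add: lborel_prod)
  from lborel_pair.integrable_fst'[OF this] have gi: "integrable lborel ?g" .
  have "AE z in lborel. ?g z = 0"
  proof (rule fourier_uniqueness[OF gi])
    fix \<xi> :: "complex ^ 'n"
    have "(\<integral>z. ?g z * exp (\<i> * of_real (z \<bullet> \<xi>)) \<partial>lborel)
      = (\<integral>z. (\<integral>t. f (z, t) * fock_weight l (z, t) * exp (\<i> * of_real (fst (z, t) \<bullet> \<xi>)) \<partial>lborel) \<partial>lborel)"
      by simp
    also have "\<dots> = fock f l \<xi> \<i>"
      unfolding fock_def using i[of "\<i>" \<xi>] lborel_pair.integral_fst'[of "\<lambda>p. f p * fock_weight l p * exp (\<i> * of_real (fst p \<bullet> \<xi>))"]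
      by (simp add: lborel_prod)
    finally show "(\<integral>z. ?g z * exp (\<i> * of_real (z \<bullet> \<xi>)) \<partial>lborel) = 0" using zero by simp
  qed
  then show ?thesis
  proof eventually_elim
    case (elim z)
    have "?g z = (\<integral>t. f (z, t) * exp (\<i> * of_real (l * t)) * exp (- of_real (l / 4 * (z \<bullet> z))) \<partial>lborel)"
      unfolding fock_weight_def diff_conv_add_uminus exp_add by (simp only: fst_conv snd_conv mult.assoc)
    also have "\<dots> = (\<integral>t. f (z, t) * exp (\<i> * of_real (l * t)) \<partial>lborel) * exp (- of_real (l / 4 * (z \<bullet> z)))"
      by (rule integral_mult_left_zero)
    finally show ?case using elim by simp
  qed
qed

theorem theorem3p1:
  fixes U :: "real \<Rightarrow> ('n::finite hpoint \<Rightarrow> complex) \<Rightarrow> ('n hpoint \<Rightarrow> complex)"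
    and f :: "'n hpoint \<Rightarrow> complex"
    and C a b s0 :: real
  assumes "schroedinger_group U"
    and "sq_int f"
    and "C > 0" and "a > 0" and "b > 0" and "s0 \<noteq> 0"
    and "AE p in lborel. cmod (f p) \<le> C * Re (heat_kernel a p)"
    and "AE p in lborel. cmod (U s0 f p) \<le> C * Re (heat_kernel b p)"
    and "a * b < s0\<^sup>2"
  shows "\<forall>s. AE p in lborel. U s f p = 0"
proof
  note U = assms(1) and f = assms(2) and C = assms(3) and a = assms(4) and b = assms(5)
  note D = schroedinger_groupD[OF U]
  note m[measurable] = sq_int_measurable[OF f]
  obtain Q where Q: "Q \<ge> 0"
    and fib: "AE z in lborel. (\<integral>\<^sup>+t. ennreal (cmod (f (z, t))) \<partial>lborel) \<le> ennreal (Q * exp (- (1 / (4 * a)) * (norm z)\<^sup>2))"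
    using heat_dominated_fibre_mass[OF a C m assms(7)] by blast
  obtain Q' where Q': "Q' \<ge> 0"
    and fib': "AE z in lborel. (\<integral>\<^sup>+t. ennreal (cmod (U s0 f (z, t))) \<partial>lborel) \<le> ennreal (Q' * exp (- (1 / (4 * b)) * (norm z)\<^sup>2))"
    using heat_dominated_fibre_mass[OF b C sq_int_measurable[OF D(1)[OF f]] assms(8)] by blast
  obtain w l0 where l0: "l0 > 0" and neg: "\<And>l. 0 < l \<Longrightarrow> l < l0 \<Longrightarrow>
      a * (Re w)\<^sup>2 + (b * (Re (\<i> * w * cis (l * s0)))\<^sup>2 + Re ((\<i> * w)\<^sup>2 * (1 - rot l s0) / of_real (2 * l))) < 0"
    using exponents_eventually_negative[OF a b assms(6,9)] by blast
  \<comment> \<open>The shift by 2 keeps every frequency strictly below \<open>l0\<close>, the first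
    being \<open>l0 / 2\<close>.\<close>
  let ?l = "\<lambda>n::nat. l0 / (real n + 2)"
  have "AE z in lborel. (\<integral>t. f (z, t) * exp (\<i> * of_real (?l n * t)) \<partial>lborel) = 0" for n
  proof (rule fibre_transform_zero[OF a _ Q m fib])
    show l: "0 < ?l n" using l0 by simp
    have "?l n < l0" using l0 by (simp add: divide_less_eq)
    then show "fock f (?l n) \<xi> \<i> = 0" for \<xi>
      by (rule fock_zero[OF U f l a b Q Q' fib fib' neg[OF l]])
  qed
  \<comment> \<open>There are countably many frequencies, so one null set of \<open>z\<close> serves
    them all.\<close>
  then have tr: "AE z in lborel. \<forall>n. (\<integral>t. f (z, t) * exp (\<i> * of_real (?l n * t)) \<partial>lborel) = 0"
    by (simp add: AE_all_countable)
  obtain K where K: "\<And>(z :: complex ^ 'n) t. cmod (heat_kernel a (z, t)) \<le> K * exp (- \<bar>t\<bar> / (2 * a))"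
    using heat_kernel_bound[OF a] by blast
  have "AE z in lborel. AE t in lborel. f (z, t) = 0"
    using AE_fibres[OF assms(7)] tr
  proof eventually_elim
    fix z assume dom: "AE t in lborel. cmod (f (z, t)) \<le> C * Re (heat_kernel a (z, t))"
      and z: "\<forall>n. (\<integral>t. f (z, t) * exp (\<i> * of_real (?l n * t)) \<partial>lborel) = 0"
    show "AE t in lborel. f (z, t) = 0"
    proof (rule exp_decay_fourier_uniqueness[where c="1 / (2 * a)" and K="C * K", OF _ _ l0])
      show "AE t in lborel. cmod (f (z, t)) \<le> C * K * exp (- (1 / (2 * a)) * \<bar>t\<bar>)"
        using dom
      proof eventually_elim
        case (elim t)
        have "Re (heat_kernel a (z, t)) \<le> K * exp (- \<bar>t\<bar> / (2 * a))"
          by (rule order_trans[OF complex_Re_le_cmod K])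
        then have "C * Re (heat_kernel a (z, t)) \<le> C * (K * exp (- \<bar>t\<bar> / (2 * a)))" using C by simp
        with elim show ?case by (simp add: mult.assoc)
      qed
    qed (use a z in auto)
  qed
  moreover have "{p \<in> space (lborel \<Otimes>\<^sub>M lborel). f p = 0} \<in> sets (lborel \<Otimes>\<^sub>M lborel)"
    unfolding lborel_prod by measurable
  ultimately have "AE p in lborel \<Otimes>\<^sub>M lborel. f p = 0"
    by (intro lborel_pair.AE_pair_measure)
  then have f0: "AE p in lborel. f p = 0" unfolding lborel_prod .
  fix s
  \<comment> \<open>Conservation of the norm carries the vanishing at time 0 to every other
    time.\<close>
  have "L2norm (U s f) = L2norm (\<lambda>p::'n hpoint. 0)"
    unfolding D(2)[OF f] by (rule L2norm_cong_AE[OF _ m]) (simp_all add: f0)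
  then have "(\<integral>p. (cmod (U s f p))\<^sup>2 \<partial>lborel) = 0" by (simp add: L2norm_def)
  then show "AE p in lborel. U s f p = 0"
    using integral_nonneg_eq_0_iff_AE[OF sq_int_integrable[OF D(1)[OF f]]] by simp
qed

end
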